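(* Let $p,q\in[1,\infty]$ satisfy $\frac{d_0}{p}+\frac1q=1$. Let $R\in(0,\bar R/2]$, let $g$ be a Borel bounded function on $\bar C_{2R}$ and $f\in L_{p,q}(C_{2R})$. Define $$u(t,x)=E_{t,x}\int_0^{\tau_{2R}}f(t+s,x_s)\,ds+E_{t,x}g(t+\tau_{2R},x_{\tau_{2R}})$$ for $(t,x)\in C_{2R}$ (and by the same formula, i.e. $u=g$, on $\bar C_{2R}\setminus C_{2R}$), where $\tau_{2R}$ is the first exit time of $(t+s,x_s)$ from $C_{2R}$. Then there exists a constant $N$, which depends only on $\delta,d,\underline R,\bar R,p,p_0$ and $\bar b_{\bar R}$, such that $$|u(z_1)-u(z_2)|\le NR^{-\beta}\rho^\beta(z_1,z_2)\Big(\sup_{\bar C_{2R}}|u|+R^{(2d_0-d)/p}\|f\|_{L_{p,q}(C_{2R})}\Big)$$ for $z_1,z_2\in C_R$, where $$\beta=\frac{\alpha_0(2d_0-d)}{\alpha_0p+2d_0-d}$$ (read as $\beta=0$ if $p=\infty$).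
   Context: Notation. $d\ge2$; $B_R=\{x\in\mathbb R^d:|x|<R\}$, $C_{T,R}=[0,T)\times B_R$, $C_{T,R}(t,x)=(t,x)+C_{T,R}$, $C_R(t,x)=C_{R^2,R}(t,x)$, $C_R=C_R(0,0)$; $\mathbb R^{d+1}_+=[0,\infty)\times\mathbb R^d$. For $p,q\in[1,\infty]$, $Q\subset\mathbb R^{d+1}$: $\|f\|^q_{L_{p,q}(Q)}=\int_{\mathbb R}(\int_{\mathbb R^d}I_Q|f|^pdx)^{q/p}dt$ if $p\ge q$, $\|f\|^p_{L_{p,q}(Q)}=\int_{\mathbb R^d}(\int_{\mathbb R}I_Q|f|^qdt)^{p/q}dx$ if $p\le q$, with the natural interpretation if $p$ or $q$ is $\infty$; $L_{p,q}(Q)$ is the set of Borel $f$ with finite norm. For $z_i=(t_i,x_i)$, $\rho(z_1,z_2)=|x_1-x_2|+|t_1-t_2|^{1/2}$. Parameters. $\delta\in(0,1)$; $p_0,q_0\in[1,\infty)$, $d/p_0+1/q_0=1$; $\mathbb S_\delta$ is the set of symmetric $d\times d$ matrices with eigenvalues in $[\delta,\delta^{-1}]$. $h\ge 0$ is a function on $\mathbb R^{d+1}$ and $\bar b_R$, $R\in(0,\infty)$, a bounded nondecreasing function with $\|h\|^{q_0}_{L_{p_0,q_0}(C_R(t,x))}\le\bar b_RR$ for all $(t,x)$, $R>0$; $\bar b_\infty=\lim_{R\to\infty}\bar b_R$. Diffusion-type processes. These are $x_t=\int_0^t\sigma_sdw_s+\int_0^tb_sds$ on a filtered complete probability space, $w_t$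 a $d$-dimensional Wiener process, $\sigma_t$ adapted $\mathbb S_\delta$-valued, $b_t$ adapted with $\int_0^T|b_t|dt<\infty$ and $|b_t|\le h(t,x_t)$, for some such $h,\bar b$. For them $\tau_R(x)$ is the first exit time of $(t,x+x_t)$ from $C_R$, $\tau'_R(x)=\inf\{t\ge0:x+x_t\notin B_R\}$, $\gamma_R(x)=\inf\{t\ge0:x+x_t\in\bar B_R\}$. Constants from earlier work (fixed). $\bar\xi=\bar\xi(d,\delta)\in(0,1)$ and $\bar N=\bar N(d,p_0,\delta)$ (continuous in $\delta$) are such that for every diffusion-type process and every $R$ with $\bar N\bar b_R\le1$: $P(\tau_R(x)=R^2)\le1-\bar\xi$ ($|x|\le R$), $P(\tau_R(0)=R^2)\ge\bar\xi$, $P(\tau'_R(x)\ge nR^2)\le(1-\bar\xi)^n$ ($|x|\le R$, $n\ge1$), $P(\tau'_R(x)>\gamma_{R/16}(x))\ge\bar\xi$ ($|x|\le9R/16$). Standing assumption: $\underline R\in(0,\infty)$ satisfies $\bar N\bar b_{\underline R}<1$; $\bar R\in[\underline R,\infty)$ is fixed. $d_0\in(d/2,d)$ is the constant, depending only on $\delta,d,\underline R,p_0$, known to have the following properties for all diffusion-type processes with $\bar N\bar b_{\underline R}<1$. (i) For $\lambda>0$ let $G_\lambda\ge0$ be the Green's function: $E\int_0^\infty e^{-\lambda t}f(t,x_t)dt=\int_0^\infty\int_{\mathbb R^d}G_\lambda f\,dxdt$ for Borel $f\ge0$; then $\int_0^\infty\int_{\mathbb R^d}G_\lambda^{p/(p-1)}dxdt\le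 N(\delta,d,\underline R,p_0,\lambda,p)$ for $p\ge d_0+1$. (ii) If $p,q\in[1,\infty]$, $\nu=1-d_0/p-1/q\ge0$, then for $\lambda>0$ and Borel $f\ge0$, $E\int_0^\infty e^{-\lambda t}f(t,x_t)dt\le N\ddot\lambda^{-\nu+(d-2d_0)/(2p)}\|\Psi_\lambda^{1-\nu}f\|_{L_{p,q}(\mathbb R^{d+1}_+)}$ with $N=N(\delta,d,\underline R,p,q,p_0,\bar b_\infty)$, $\ddot\lambda=\lambda(1\wedge\lambda)^{d/(2d_0-d)}$, $\Psi_\lambda(t,x)=\exp(-\sqrt{\dot\lambda}(|x|+\sqrt t)\bar\xi/16)$, $\dot\lambda=\lambda\min(1,\lambda\underline R^2)$. (iii) If $\nu=0$, $R\in(0,\bar R]$, Borel $f\ge0$ on $C_R$: $E\int_0^{\tau_R(x)}f(t,x+x_t)dt\le NR^{(2d_0-d)/p}\|f\|_{L_{p,q}(C_R)}$ with $N=N(\delta,d,\underline R,p,p_0,\bar b_{\bar R},\bar R)$. Markov process. $\sigma(t,x)$, $b(t,x)$ are Borel on $\mathbb R^{d+1}$ with values in $\mathbb S_\delta$ and $\mathbb R^d$, $|b|\le h$. $\Omega$ is the set of continuous functions $\omega=\{(t_0+t,x_t),t\ge0\}$, $t_0\in\mathbb R$, with values in $\mathbb R^{d+1}$; $\mathsf t_t(\omega)=t_0+t$, $x_t(\omega)=x_t$, $\mathcal N_t=\sigma((\mathsf t_s,x_s),s\le t)$. $X=\{(\mathsf t_t,x_t),\infty,\mathcal N_t,P_{t,x}\}$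 is a fixed strong Markov process on $\mathbb R^{d+1}$ with infinite lifetime (Dynkin's terminology; existence is known) such that $\{(\mathsf t_t,x_t),\infty,\mathcal N_{t+},P_{t,x}\}$ is Markov and for any $(t,x)$ there is a $d$-dimensional Wiener process $w$ relative to the $P_{t,x}$-completions of $\mathcal N_s$ such that $P_{t,x}$-a.s., for all $s\ge0$, $\mathsf t_s=t+s$ and $x_s=x+\int_0^s\sigma(t+r,x_r)dw_r+\int_0^sb(t+r,x_r)dr$. $E_{t,x}$ is expectation under $P_{t,x}$. Caloric functions and $\alpha_0$. A bounded Borel $u$ on $Q\subset\mathbb R^{d+1}$ is caloric in $Q$ if for any $(s,y)$, $T,R\in(0,\infty)$ with $\bar C_{T,R}(s,y)\subset Q$ and any $(t,x)\in C:=C_{T,R}(s,y)$, $u(t,x)=E_{t,x}u(t+\tau_C,x_{\tau_C})$, $\tau_C$ being the first exit time of $(t+r,x_r)$ from $C$. $\alpha_0\in(0,1)$ is a fixed constant, depending only on $\delta,d,p_0,\underline R,\bar R,\bar b_{\bar R}$, such that with some $N$ depending only on the same quantities, $|u(z_1)-u(z_2)|\le NR^{-\alpha}\rho^\alpha(z_1,z_2)\sup_{\bar C_{2R}}|u|$ for all $R\in(0,\bar R]$, $u$ caloric in $\bar C_{2R}$, $z_1,z_2\in C_R$, $\alpha\in(0,\alpha_0]$. A constant "depends only on" listed quantities if it is the same for all $\sigma,b,h,\bar b,X$ with the same values of them (and uniform in the remaining variables). *)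

theory Defs
  imports "HOL-Probability.Probability"
begin

section \<open>Space-time, cylinders, mixed norms\<close>

type_synonym 'd pt = "real \<times> (real ^ 'd)"
type_synonym 'd path = "real \<Rightarrow> 'd pt"

definition cyl2 :: "real \<Rightarrow> real \<Rightarrow> 'd::finite pt \<Rightarrow> 'd pt set" where
  "cyl2 T R z = {fst z ..< fst z + T} \<times> ball (snd z) R"

definition cyl :: "real \<Rightarrow> 'd::finite pt \<Rightarrow> 'd pt set" where
  "cyl R z = cyl2 (R\<^sup>2) R z"

definition rho :: "'d::finite pt \<Rightarrow> 'd pt \<Rightarrow> real" where
  "rho z1 z2 = norm (snd z1 - snd z2) + sqrt \<bar>fst z1 - fst z2\<bar>"

definition sup_abs :: "'a set \<Rightarrow> ('a \<Rightarrow> real) \<Rightarrow> ennreal" where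
  "sup_abs Q u = (SUP z\<in>Q. ennreal \<bar>u z\<bar>)"

text \<open>Powers of extended nonnegative numbers, used for positive exponents only.\<close>

definition epow :: "ennreal \<Rightarrow> real \<Rightarrow> ennreal" where
  "epow x a = (if x = \<infinity> then \<infinity> else ennreal (enn2real x powr a))"

definition lp_norm :: "ereal \<Rightarrow> 'a measure \<Rightarrow> ('a \<Rightarrow> ennreal) \<Rightarrow> ennreal" where
  "lp_norm p M \<phi> =
    (if p = \<infinity> then esssup M \<phi>
     else epow (\<integral>\<^sup>+ x. epow (\<phi> x) (real_of_ereal p) \<partial>M) (1 / real_of_ereal p))"

text \<open>The mixed norm: the inner norm is in \<open>x\<close> if \<open>p \<ge> q\<close> and in \<open>t\<close> if \<open>p \<le> q\<close>
  (for \<open>p = q\<close> the two agree by Tonelli's theorem).\<close>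

definition Lpq_norm :: "ereal \<Rightarrow> ereal \<Rightarrow> 'd::finite pt set \<Rightarrow> ('d pt \<Rightarrow> real) \<Rightarrow> ennreal" where
  "Lpq_norm p q Q f =
    (if q \<le> p
     then lp_norm q lborel (\<lambda>t. lp_norm p lborel (\<lambda>x. indicator Q (t, x) * ennreal \<bar>f (t, x)\<bar>))
     else lp_norm p lborel (\<lambda>x. lp_norm q lborel (\<lambda>t. indicator Q (t, x) * ennreal \<bar>f (t, x)\<bar>)))"

definition Lpq :: "ereal \<Rightarrow> ereal \<Rightarrow> 'd::finite pt set \<Rightarrow> ('d pt \<Rightarrow> real) set" where
  "Lpq p q Q = {f \<in> borel_measurable (restrict_space borel Q). Lpq_norm p q Q f < \<infinity>}"

text \<open>\<open>1 / p\<close> for \<open>p \<in> [1, \<infinity>]\<close>, with \<open>1 / \<infinity> = 0\<close>.\<close>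

definition recip :: "ereal \<Rightarrow> real" where
  "recip p = real_of_ereal (1 / p)"

section \<open>Coefficients\<close>

definition S_delta :: "real \<Rightarrow> (real ^ 'd ^ 'd::finite) set" where
  "S_delta \<delta> = {A. transpose A = A \<and>
     (\<forall>l v. v \<noteq> 0 \<longrightarrow> A *v v = l *\<^sub>R v \<longrightarrow> \<delta> \<le> l \<and> l \<le> 1 / \<delta>)}"

definition admissible_exponents :: "'d::finite itself \<Rightarrow> real \<Rightarrow> real \<Rightarrow> bool" where
  "admissible_exponents _ p0 q0 \<longleftrightarrow> 1 \<le> p0 \<and> 1 \<le> q0 \<and> real CARD('d) / p0 + 1 / q0 = 1"

text \<open>Only the values of \<open>bb\<close> on \<open>(0, \<infinity>)\<close> matter.  That they are nonnegative has to be
  said because \<^const>\<open>ennreal\<close> truncates negative numbers to \<open>0\<close>.\<close>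

definition drift_bound ::
  "real \<Rightarrow> real \<Rightarrow> ('d::finite pt \<Rightarrow> real) \<Rightarrow> (real \<Rightarrow> real) \<Rightarrow> bool" where
  "drift_bound p0 q0 h bb \<longleftrightarrow>
     h \<in> borel_measurable borel \<and> (\<forall>z. 0 \<le> h z) \<and>
     bounded (bb ` {0<..}) \<and> mono_on {0<..} bb \<and> (\<forall>R>0. 0 \<le> bb R) \<and>
     (\<forall>R>0. \<forall>z. epow (Lpq_norm (ereal p0) (ereal q0) (cyl R z) h) q0 \<le> ennreal (bb R * R))"

section \<open>Wiener processes and stochastic integrals\<close>

text \<open>Time runs over \<open>[0, \<infinity>)\<close>; values of processes and filtrations at negative times are
  irrelevant.\<close>

definition filtered_complete_prob_space :: "'w measure \<Rightarrow> (real \<Rightarrow> 'w measure) \<Rightarrow> bool" where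
  "filtered_complete_prob_space M F \<longleftrightarrow>
     prob_space M \<and> complete_measure M \<and>
     (\<forall>t\<ge>0. subalgebra M (F t) \<and> null_sets M \<subseteq> sets (F t)) \<and>
     (\<forall>s\<ge>0. \<forall>t\<ge>s. sets (F s) \<subseteq> sets (F t))"

definition wiener :: 
  "'w measure \<Rightarrow> (real \<Rightarrow> 'w measure) \<Rightarrow> (real \<Rightarrow> 'w \<Rightarrow> real ^ 'd::finite) \<Rightarrow> bool" where
  "wiener M F w \<longleftrightarrow>
     (\<forall>t\<ge>0. w t \<in> borel_measurable (F t)) \<and>
     (AE \<omega> in M. w 0 \<omega> = 0 \<and> continuous_on {0..} (\<lambda>t. w t \<omega>)) \<and>
     (\<forall>s\<ge>0. \<forall>t>s.
        prob_space.indep_set M (sets (F s))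
          {(\<lambda>\<omega>. w t \<omega> - w s \<omega>) -` B \<inter> space M | B. B \<in> sets borel} \<and>
        distributed M lborel (\<lambda>\<omega>. w t \<omega> - w s \<omega>)
          (\<lambda>y. ennreal (\<Prod>i\<in>UNIV. normal_density 0 (sqrt (t - s)) (y $ i))))"

definition measurable_adapted ::
  "'w measure \<Rightarrow> (real \<Rightarrow> 'w measure) \<Rightarrow> (real \<Rightarrow> 'w \<Rightarrow> 'b::topological_space) \<Rightarrow> bool" where
  "measurable_adapted M F X \<longleftrightarrow>
     (\<forall>t\<ge>0. X t \<in> borel_measurable (F t)) \<and>
     (\<lambda>(t, \<omega>). X t \<omega>) \<in> borel_measurable (restrict_space borel {0..} \<Otimes>\<^sub>M M)"

text \<open>The step process \<open>\<Sum>\<^sub>k 1\<^bsub>(r k, r (k+1)]\<^esub> \<xi> k\<close> and its integral against \<open>w\<close>.\<close>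

definition step_process ::
  "'w measure \<Rightarrow> (real \<Rightarrow> 'w measure) \<Rightarrow> nat \<Rightarrow> (nat \<Rightarrow> real) \<Rightarrow> (nat \<Rightarrow> 'w \<Rightarrow> real ^ 'd ^ 'd::finite) \<Rightarrow> bool"
  where
  "step_process M F n r \<xi> \<longleftrightarrow>
     0 \<le> r 0 \<and> (\<forall>k<n. r k \<le> r (Suc k)) \<and>
     (\<forall>k<n. \<xi> k \<in> borel_measurable (F (r k)) \<and> bounded (\<xi> k ` space M))"

definition step_value ::
  "nat \<Rightarrow> (nat \<Rightarrow> real) \<Rightarrow> (nat \<Rightarrow> 'w \<Rightarrow> real ^ 'd ^ 'd::finite) \<Rightarrow> real \<Rightarrow> 'w \<Rightarrow> real ^ 'd ^ 'd" where
  "step_value n r \<xi> s \<omega> = (\<Sum>k<n. indicator {r k<..r (Suc k)} s *\<^sub>R \<xi> k \<omega>)"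

definition step_integral ::
  "nat \<Rightarrow> (nat \<Rightarrow> real) \<Rightarrow> (nat \<Rightarrow> 'w \<Rightarrow> real ^ 'd ^ 'd::finite) \<Rightarrow> (real \<Rightarrow> 'w \<Rightarrow> real ^ 'd)
    \<Rightarrow> real \<Rightarrow> 'w \<Rightarrow> real ^ 'd" where
  "step_integral n r \<xi> w t \<omega> =
     (\<Sum>k<n. \<xi> k \<omega> *v (w (min t (r (Suc k))) \<omega> - w (min t (r k)) \<omega>))"

text \<open>\<open>ito_integral M F w \<sigma> J\<close>: the process \<open>J\<close> is (a continuous version of) the Ito integral
  \<open>J\<^sub>t = \<integral>\<^sub>0\<^sup>t \<sigma>\<^sub>s dw\<^sub>s\<close>, defined as usual by the \<open>L\<^sub>2\<close>-closure of the integral of step processes;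
  this determines \<open>J\<close> up to indistinguishability.  The norm on matrices is the Frobenius norm.\<close>

definition ito_integral ::
  "'w measure \<Rightarrow> (real \<Rightarrow> 'w measure) \<Rightarrow> (real \<Rightarrow> 'w \<Rightarrow> real ^ 'd::finite)
    \<Rightarrow> (real \<Rightarrow> 'w \<Rightarrow> real ^ 'd ^ 'd) \<Rightarrow> (real \<Rightarrow> 'w \<Rightarrow> real ^ 'd) \<Rightarrow> bool" where
  "ito_integral M F w \<sigma> J \<longleftrightarrow>
     (\<forall>t\<ge>0. J t \<in> borel_measurable (F t)) \<and>
     (AE \<omega> in M. continuous_on {0..} (\<lambda>t. J t \<omega>)) \<and>
     (\<exists>n r \<xi>. (\<forall>j::nat. step_process M F (n j) (r j) (\<xi> j)) \<and>
        (\<forall>T\<ge>0. (\<lambda>j. \<integral>\<^sup>+ \<omega>. (\<integral>\<^sup>+ s\<in>{0..T}.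
             ennreal ((norm (step_value (n j) (r j) (\<xi> j) s \<omega> - \<sigma> s \<omega>))\<^sup>2) \<partial>lborel) \<partial>M)
           \<longlonglongrightarrow> 0) \<and>
        (\<forall>t\<ge>0. (\<lambda>j. \<integral>\<^sup>+ \<omega>.
             ennreal ((norm (step_integral (n j) (r j) (\<xi> j) w t \<omega> - J t \<omega>))\<^sup>2) \<partial>M)
           \<longlonglongrightarrow> 0))"

section \<open>Diffusion-type processes\<close>

definition diffusion_type ::
  "real \<Rightarrow> ('d::finite pt \<Rightarrow> real) \<Rightarrow> 'w measure \<Rightarrow> (real \<Rightarrow> 'w \<Rightarrow> real ^ 'd) \<Rightarrow> bool" where
  "diffusion_type \<delta> h M x \<longleftrightarrow>
     (\<exists>F w \<sigma> b J.
        filtered_complete_prob_space M F \<and> wiener M F w \<and>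
        measurable_adapted M F \<sigma> \<and> measurable_adapted M F b \<and>
        (\<forall>t\<ge>0. \<forall>\<omega>\<in>space M. \<sigma> t \<omega> \<in> S_delta \<delta> \<and> norm (b t \<omega>) \<le> h (t, x t \<omega>)) \<and>
        ito_integral M F w \<sigma> J \<and>
        (AE \<omega> in M. \<forall>t\<ge>0. set_integrable lborel {0..t} (\<lambda>s. b s \<omega>) \<and>
           x t \<omega> = J t \<omega> + (LINT s:{0..t}|lborel. b s \<omega>)))"

definition hit_time :: "'b set \<Rightarrow> (real \<Rightarrow> 'b) \<Rightarrow> ereal" where
  "hit_time A \<phi> = (INF s\<in>{s. 0 \<le> s \<and> \<phi> s \<in> A}. ereal s)"

abbreviation exit_time :: "'b set \<Rightarrow> (real \<Rightarrow> 'b) \<Rightarrow> ereal" where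
  "exit_time Q \<phi> \<equiv> hit_time (- Q) \<phi>"

text \<open>\<open>tau\<close>, \<open>tau'\<close>, \<open>gam\<close> are \<open>\<tau>\<^sub>R(y)\<close>, \<open>\<tau>'\<^sub>R(y)\<close>, \<open>\<gamma>\<^sub>R(y)\<close> for the process \<open>x\<close>.\<close>

definition tau :: "(real \<Rightarrow> 'w \<Rightarrow> real ^ 'd::finite) \<Rightarrow> real \<Rightarrow> real ^ 'd \<Rightarrow> 'w \<Rightarrow> ereal" where
  "tau x R y \<omega> = exit_time (cyl R (0, 0)) (\<lambda>t. (t, y + x t \<omega>))"

definition tau' :: "(real \<Rightarrow> 'w \<Rightarrow> real ^ 'd::finite) \<Rightarrow> real \<Rightarrow> real ^ 'd \<Rightarrow> 'w \<Rightarrow> ereal" where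
  "tau' x R y \<omega> = exit_time (ball 0 R) (\<lambda>t. y + x t \<omega>)"

definition gam :: "(real \<Rightarrow> 'w \<Rightarrow> real ^ 'd::finite) \<Rightarrow> real \<Rightarrow> real ^ 'd \<Rightarrow> 'w \<Rightarrow> ereal" where
  "gam x R y \<omega> = hit_time (cball 0 R) (\<lambda>t. y + x t \<omega>)"

section \<open>The constants \<open>\<xi>\<close>, \<open>N\<close> and \<open>d\<^sub>0\<close>\<close>

text \<open>Quantification over all diffusion-type processes cannot range over all sample types
  within one formula.  In the properties that characterise the constants the sample type is the
  type of space-time paths, which is large enough to carry every possible law.\<close>

text \<open>\<open>xi \<delta>\<close> is \<open>\<xi>(d, \<delta>)\<close> and \<open>Nb p0 \<delta>\<close> is \<open>N(d, p0, \<delta>)\<close>, where \<open>d = CARD('d)\<close>.\<close>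

definition basic_constants ::
  "'d::finite itself \<Rightarrow> (real \<Rightarrow> real) \<Rightarrow> (real \<Rightarrow> real \<Rightarrow> real) \<Rightarrow> bool" where
  "basic_constants _ xi Nb \<longleftrightarrow>
     (\<forall>\<delta>\<in>{0<..<1}. 0 < xi \<delta> \<and> xi \<delta> < 1) \<and>
     (\<forall>p0 q0. admissible_exponents TYPE('d) p0 q0 \<longrightarrow>
        continuous_on {0<..<1} (Nb p0) \<and>
        (\<forall>\<delta>\<in>{0<..<1}. \<forall>(h :: 'd pt \<Rightarrow> real) bb (M :: 'd path measure) x R.
           drift_bound p0 q0 h bb \<longrightarrow> diffusion_type \<delta> h M x \<longrightarrow>
           0 < R \<longrightarrow> Nb p0 \<delta> * bb R \<le> 1 \<longrightarrow>
           (\<forall>y. norm y \<le> R \<longrightarrow>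
              measure M {\<omega>\<in>space M. tau x R y \<omega> = ereal (R\<^sup>2)} \<le> 1 - xi \<delta>) \<and>
           measure M {\<omega>\<in>space M. tau x R 0 \<omega> = ereal (R\<^sup>2)} \<ge> xi \<delta> \<and>
           (\<forall>y. \<forall>n\<ge>1. norm y \<le> R \<longrightarrow>
              measure M {\<omega>\<in>space M. tau' x R y \<omega> \<ge> ereal (real n * R\<^sup>2)} \<le> (1 - xi \<delta>) ^ n) \<and>
           (\<forall>y. norm y \<le> 9 * R / 16 \<longrightarrow>
              measure M {\<omega>\<in>space M. tau' x R y \<omega> > gam x (R / 16) y \<omega>} \<ge> xi \<delta>)))"

definition green_function ::
  "'w measure \<Rightarrow> (real \<Rightarrow> 'w \<Rightarrow> real ^ 'd::finite) \<Rightarrow> real \<Rightarrow> ('d pt \<Rightarrow> real) \<Rightarrow> bool" where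
  "green_function M x l G \<longleftrightarrow>
     G \<in> borel_measurable borel \<and> (\<forall>z. 0 \<le> G z) \<and>
     (\<forall>f \<in> borel_measurable borel. (\<forall>z. 0 \<le> f z) \<longrightarrow>
        (\<integral>\<^sup>+ \<omega>. (\<integral>\<^sup>+ t\<in>{0..}. ennreal (exp (- l * t) * f (t, x t \<omega>)) \<partial>lborel) \<partial>M) =
        (\<integral>\<^sup>+ t\<in>{0..}. (\<integral>\<^sup>+ y. ennreal (G (t, y) * f (t, y)) \<partial>lborel) \<partial>lborel))"

definition lam_dot :: "real \<Rightarrow> real \<Rightarrow> real" where
  "lam_dot Ru l = l * min 1 (l * Ru\<^sup>2)"

definition lam_ddot :: "real \<Rightarrow> real \<Rightarrow> real \<Rightarrow> real" where
  "lam_ddot d d0 l = l * (min 1 l) powr (d / (2 * d0 - d))"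

definition Psi :: "real \<Rightarrow> real \<Rightarrow> real \<Rightarrow> 'd::finite pt \<Rightarrow> real" where
  "Psi xi Ru l z = exp (- sqrt (lam_dot Ru l) * (norm (snd z) + sqrt (fst z)) * xi / 16)"

text \<open>\<open>xi\<close> and \<open>Nb\<close> are now the values of these constants at the given \<open>\<delta>\<close>, \<open>p0\<close>; \<open>Ru\<close>
  is the radius \<open>R\<close> (underlined) of the standing assumption.  The order of the quantifiers
  expresses what the constants \<open>N\<close> may depend on.\<close>

definition d0_constant ::
  "'d::finite itself \<Rightarrow> real \<Rightarrow> real \<Rightarrow> real \<Rightarrow> real \<Rightarrow> real \<Rightarrow> real \<Rightarrow> real \<Rightarrow> bool" where
  "d0_constant _ \<delta> p0 q0 xi Nb Ru d0 \<longleftrightarrow>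
     real CARD('d) / 2 < d0 \<and> d0 < real CARD('d) \<and>
     (\<forall>l>0. \<forall>p\<ge>d0 + 1. \<exists>N.
        \<forall>(h :: 'd pt \<Rightarrow> real) bb (M :: 'd path measure) x.
          drift_bound p0 q0 h bb \<longrightarrow> Nb * bb Ru < 1 \<longrightarrow> diffusion_type \<delta> h M x \<longrightarrow>
          (\<exists>G. green_function M x l G) \<and>
          (\<forall>G. green_function M x l G \<longrightarrow>
             (\<integral>\<^sup>+ t\<in>{0..}. (\<integral>\<^sup>+ y. ennreal (G (t, y) powr (p / (p - 1))) \<partial>lborel) \<partial>lborel)
               \<le> ennreal N)) \<and>
     (\<forall>p\<ge>1. \<forall>q\<ge>1. \<forall>binf. 0 \<le> 1 - d0 * recip p - recip q \<longrightarrow>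
        (\<exists>N. \<forall>(h :: 'd pt \<Rightarrow> real) bb (M :: 'd path measure) x.
          drift_bound p0 q0 h bb \<longrightarrow> Nb * bb Ru < 1 \<longrightarrow> Lim at_top bb = binf \<longrightarrow>
          diffusion_type \<delta> h M x \<longrightarrow>
          (\<forall>l>0. \<forall>f \<in> borel_measurable borel. (\<forall>z. 0 \<le> f z) \<longrightarrow>
             (let \<nu> = 1 - d0 * recip p - recip q; d = real CARD('d) in
              (\<integral>\<^sup>+ \<omega>. (\<integral>\<^sup>+ t\<in>{0..}. ennreal (exp (- l * t) * f (t, x t \<omega>)) \<partial>lborel) \<partial>M)
              \<le> ennreal (N * lam_ddot d d0 l powr (- \<nu> + (d - 2 * d0) / 2 * recip p)) *
                 Lpq_norm p q ({0..} \<times> UNIV) (\<lambda>z. Psi xi Ru l z powr (1 - \<nu>) * f z))))) \<and>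
     (\<forall>p\<ge>1. \<forall>q\<ge>1. \<forall>Rb\<ge>Ru. \<forall>B. 1 - d0 * recip p - recip q = 0 \<longrightarrow>
        (\<exists>N. \<forall>(h :: 'd pt \<Rightarrow> real) bb (M :: 'd path measure) x.
          drift_bound p0 q0 h bb \<longrightarrow> Nb * bb Ru < 1 \<longrightarrow> bb Rb = B \<longrightarrow>
          diffusion_type \<delta> h M x \<longrightarrow>
          (\<forall>R\<in>{0<..Rb}. \<forall>y. \<forall>f \<in> borel_measurable (restrict_space borel (cyl R (0, 0))).
             (\<forall>z\<in>cyl R (0, 0). 0 \<le> f z) \<longrightarrow>
             (\<integral>\<^sup>+ \<omega>. (\<integral>\<^sup>+ t\<in>{t. 0 \<le> t \<and> ereal t < tau x R y \<omega>}.
                  ennreal (f (t, y + x t \<omega>)) \<partial>lborel) \<partial>M)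
             \<le> ennreal (N * R powr ((2 * d0 - real CARD('d)) * recip p)) *
                Lpq_norm p q (cyl R (0, 0)) f)))"

section \<open>The Markov process\<close>

text \<open>A path \<open>\<omega>\<close> is a function on \<open>[0, \<infinity>)\<close> (\<^const>\<open>undefined\<close> at negative times);
  \<open>fst (\<omega> s)\<close> is its time coordinate and \<open>snd (\<omega> s)\<close> its space coordinate.\<close>

definition paths :: "'d::finite path set" where
  "paths = {\<omega> \<in> extensional {0..}. continuous_on {0..} \<omega> \<and>
              (\<forall>s\<ge>0. fst (\<omega> s) = fst (\<omega> 0) + s)}"

definition path_filt :: "real \<Rightarrow> 'd::finite path measure" where
  "path_filt t = sigma paths {(\<lambda>\<omega>. \<omega> s) -` B \<inter> paths | s B. 0 \<le> s \<and> s \<le> t \<and> B \<in> sets borel}"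

definition path_filt_plus :: "real \<Rightarrow> 'd::finite path measure" where
  "path_filt_plus t = sigma paths (\<Inter>s\<in>{t<..}. sets (path_filt s))"

definition path_space :: "'d::finite path measure" where
  "path_space = sigma paths {(\<lambda>\<omega>. \<omega> s) -` B \<inter> paths | s B. 0 \<le> s \<and> B \<in> sets borel}"

text \<open>The Markov property
  \<open>P\<^sub>z(z\<^bsub>t+s\<^esub> \<in> \<Gamma> | F\<^sub>t) = P\<^bsub>z\<^sub>t\<^esub>(z\<^sub>s \<in> \<Gamma>)\<close> and its version for Markov times, with the
  conditional probabilities written out.\<close>

definition markov ::
  "(real \<Rightarrow> 'd::finite path measure) \<Rightarrow> ('d pt \<Rightarrow> 'd path measure) \<Rightarrow> bool" where
  "markov F P \<longleftrightarrow>
     P \<in> borel \<rightarrow>\<^sub>M prob_algebra path_space \<and>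
     (\<forall>z. AE \<omega> in P z. \<omega> 0 = z) \<and>
     (\<forall>z. \<forall>t\<ge>0. \<forall>s\<ge>0. \<forall>A\<in>sets (F t). \<forall>\<Gamma>\<in>sets borel.
        emeasure (P z) {\<omega>\<in>A. \<omega> (t + s) \<in> \<Gamma>} =
        (\<integral>\<^sup>+ \<omega>\<in>A. emeasure (P (\<omega> t)) {\<omega>'\<in>paths. \<omega>' s \<in> \<Gamma>} \<partial>P z))"

definition markov_time :: "(real \<Rightarrow> 'w measure) \<Rightarrow> 'w set \<Rightarrow> ('w \<Rightarrow> ereal) \<Rightarrow> bool" where
  "markov_time F \<Omega> T \<longleftrightarrow>
     (\<forall>\<omega>\<in>\<Omega>. 0 \<le> T \<omega>) \<and> (\<forall>t\<ge>0. {\<omega>\<in>\<Omega>. T \<omega> \<le> ereal t} \<in> sets (F t))"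

definition strong_markov ::
  "(real \<Rightarrow> 'd::finite path measure) \<Rightarrow> ('d pt \<Rightarrow> 'd path measure) \<Rightarrow> bool" where
  "strong_markov F P \<longleftrightarrow>
     markov F P \<and>
     (\<forall>z T. \<forall>s\<ge>0. \<forall>A\<in>sets path_space. \<forall>\<Gamma>\<in>sets borel.
        markov_time F paths T \<longrightarrow>
        (\<forall>t\<ge>0. {\<omega>\<in>A. T \<omega> \<le> ereal t} \<in> sets (F t)) \<longrightarrow>
        emeasure (P z) {\<omega>\<in>A. T \<omega> < \<infinity> \<and> \<omega> (real_of_ereal (T \<omega>) + s) \<in> \<Gamma>} =
        (\<integral>\<^sup>+ \<omega>\<in>{\<omega>\<in>A. T \<omega> < \<infinity>}.
            emeasure (P (\<omega> (real_of_ereal (T \<omega>)))) {\<omega>'\<in>paths. \<omega>' s \<in> \<Gamma>} \<partial>P z))"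

text \<open>Each sigma-algebra is augmented by all \<open>P\<^sub>z\<close>-null sets of the path space.\<close>

definition completed_filt :: "('d::finite pt \<Rightarrow> 'd path measure) \<Rightarrow> 'd pt \<Rightarrow> real \<Rightarrow> 'd path measure" where
  "completed_filt P z s = sigma paths (sets (path_filt s) \<union> null_sets (completion (P z)))"

definition solves_sde ::
  "('d::finite pt \<Rightarrow> real ^ 'd ^ 'd) \<Rightarrow> ('d pt \<Rightarrow> real ^ 'd) \<Rightarrow> ('d pt \<Rightarrow> 'd path measure) \<Rightarrow> bool" where
  "solves_sde \<sigma> b P \<longleftrightarrow>
     (\<forall>t x. \<exists>w J.
        wiener (completion (P (t, x))) (completed_filt P (t, x)) w \<and>
        ito_integral (completion (P (t, x))) (completed_filt P (t, x)) w
          (\<lambda>r \<omega>. \<sigma> (t + r, snd (\<omega> r))) J \<and>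
        (AE \<omega> in completion (P (t, x)). \<forall>s\<ge>0.
           fst (\<omega> s) = t + s \<and>
           set_integrable lborel {0..s} (\<lambda>r. b (t + r, snd (\<omega> r))) \<and>
           snd (\<omega> s) = x + J s \<omega> + (LINT r:{0..s}|lborel. b (t + r, snd (\<omega> r)))))"

text \<open>The process \<open>X\<close> lives on the canonical space \<^const>\<open>paths\<close> and is therefore given by its
  laws \<open>P\<close>.\<close>

definition markov_diffusion ::
  "real \<Rightarrow> real \<Rightarrow> real \<Rightarrow> ('d::finite pt \<Rightarrow> real) \<Rightarrow> (real \<Rightarrow> real)
    \<Rightarrow> ('d pt \<Rightarrow> real ^ 'd ^ 'd) \<Rightarrow> ('d pt \<Rightarrow> real ^ 'd) \<Rightarrow> ('d pt \<Rightarrow> 'd path measure) \<Rightarrow> bool" where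
  "markov_diffusion \<delta> p0 q0 h bb \<sigma> b P \<longleftrightarrow>
     drift_bound p0 q0 h bb \<and>
     \<sigma> \<in> borel_measurable borel \<and> (\<forall>z. \<sigma> z \<in> S_delta \<delta>) \<and>
     b \<in> borel_measurable borel \<and> (\<forall>z. norm (b z) \<le> h z) \<and>
     strong_markov path_filt P \<and> markov path_filt_plus P \<and> solves_sde \<sigma> b P"

text \<open>Expectations are taken over the completion so that functions of the path which are only
  defined and measurable along paths starting at \<open>z\<close> (a set of full measure) are admitted.\<close>

definition expec :: "('d::finite pt \<Rightarrow> 'd path measure) \<Rightarrow> 'd pt \<Rightarrow> ('d path \<Rightarrow> real) \<Rightarrow> real" where
  "expec P z \<phi> = (LINT \<omega>|completion (P z). \<phi> \<omega>)"

text \<open>\<open>path_exit C t \<omega>\<close> is the first exit time of \<open>(t + r, x\<^sub>r(\<omega>))\<close> from \<open>C\<close>, and \<open>exit_point C t \<omega>\<close>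
  the corresponding point (used for bounded \<open>C\<close>, where the exit time is finite).\<close>

definition path_exit :: "'d::finite pt set \<Rightarrow> real \<Rightarrow> 'd path \<Rightarrow> ereal" where
  "path_exit C t \<omega> = exit_time C (\<lambda>r. (t + r, snd (\<omega> r)))"

definition exit_point :: "'d::finite pt set \<Rightarrow> real \<Rightarrow> 'd path \<Rightarrow> 'd pt" where
  "exit_point C t \<omega> = (let r = real_of_ereal (path_exit C t \<omega>) in (t + r, snd (\<omega> r)))"

definition caloric ::
  "('d::finite pt \<Rightarrow> 'd path measure) \<Rightarrow> 'd pt set \<Rightarrow> ('d pt \<Rightarrow> real) \<Rightarrow> bool" where
  "caloric P Q u \<longleftrightarrow>
     u \<in> borel_measurable (restrict_space borel Q) \<and> bounded (u ` Q) \<and>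
     (\<forall>z T R. 0 < T \<longrightarrow> 0 < R \<longrightarrow> closure (cyl2 T R z) \<subseteq> Q \<longrightarrow>
        (\<forall>(t, x)\<in>cyl2 T R z.
           u (t, x) = expec P (t, x) (\<lambda>\<omega>. u (exit_point (cyl2 T R z) t \<omega>))))"

text \<open>\<open>B\<close> is the common value of \<open>bb Rb\<close>.\<close>

definition alpha0_constant ::
  "'d::finite itself \<Rightarrow> real \<Rightarrow> real \<Rightarrow> real \<Rightarrow> real \<Rightarrow> real \<Rightarrow> real \<Rightarrow> real \<Rightarrow> real \<Rightarrow> bool" where
  "alpha0_constant _ \<delta> p0 q0 Nb Ru Rb B \<alpha>0 \<longleftrightarrow>
     0 < \<alpha>0 \<and> \<alpha>0 < 1 \<and>
     (\<exists>N. \<forall>(h :: 'd pt \<Rightarrow> real) bb \<sigma> b P.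
        markov_diffusion \<delta> p0 q0 h bb \<sigma> b P \<longrightarrow> Nb * bb Ru < 1 \<longrightarrow> bb Rb = B \<longrightarrow>
        (\<forall>R\<in>{0<..Rb}. \<forall>u. caloric P (closure (cyl (2 * R) (0, 0))) u \<longrightarrow>
           (\<forall>z1\<in>cyl R (0, 0). \<forall>z2\<in>cyl R (0, 0). \<forall>\<alpha>\<in>{0<..\<alpha>0}.
              ennreal \<bar>u z1 - u z2\<bar> \<le>
              ennreal (N * R powr (- \<alpha>) * rho z1 z2 powr \<alpha>) *
                sup_abs (closure (cyl (2 * R) (0, 0))) u)))"

section \<open>The function \<open>u\<close> and the exponent \<open>\<beta>\<close>\<close>

text \<open>For points of \<open>closure C - C\<close> the exit time is \<open>0\<close> and the formula gives \<open>g\<close>.\<close>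

definition solution ::
  "('d::finite pt \<Rightarrow> 'd path measure) \<Rightarrow> 'd pt set \<Rightarrow> ('d pt \<Rightarrow> real) \<Rightarrow> ('d pt \<Rightarrow> real) \<Rightarrow> 'd pt \<Rightarrow> real" where
  "solution P C f g z =
     expec P z (\<lambda>\<omega>. LINT s:{s. 0 \<le> s \<and> ereal s < path_exit C (fst z) \<omega>}|lborel.
                       f (fst z + s, snd (\<omega> s))) +
     expec P z (\<lambda>\<omega>. g (exit_point C (fst z) \<omega>))"

definition holder_exponent :: "real \<Rightarrow> real \<Rightarrow> real \<Rightarrow> ereal \<Rightarrow> real" where
  "holder_exponent d d0 \<alpha>0 p =
     (if p = \<infinity> then 0
      else \<alpha>0 * (2 * d0 - d) / (\<alpha>0 * real_of_ereal p + 2 * d0 - d))"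

end

theory Submission
  imports Defs
begin

text \<open>Let \<open>Q\<close> be the cylinder of radius \<open>2 R\<close>, \<open>\<rho>\<close> the parabolic distance of two points in the cylinder
  of radius \<open>R\<close>, and \<open>\<kappa> = 2 d\<^sub>0 - d\<close>.  For \<open>\<rho> < r \<le> R / 2\<close> the cylinder \<open>C\<close> of radius \<open>2 r\<close> based at the
  earlier of the two points contains both and lies in \<open>Q\<close>.  By the strong Markov property at the exit
  from \<open>C\<close>, the solution in \<open>C\<close> is the expected time integral of \<open>f\<close> up to this exit plus the
  expectation of \<open>u\<close> at the exit point (\<open>value_fun_split\<close>).  The first term is at most a constant times
  \<open>(2 r)\<^bsup>\<kappa>/p\<^esup>\<close> and the norm of \<open>f\<close> (\<open>green_op_bound\<close>).  The second one is caloric in the closure of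
  \<open>C\<close> (\<open>caloric_exit_op\<close>) and bounded by \<open>sup \<bar>u\<bar>\<close>, so that its oscillation is at most a constant times
  \<open>(\<rho>/r)\<^bsup>a\<^esup> sup \<bar>u\<bar>\<close> with \<open>a = \<alpha>\<^sub>0\<close>.  The choice of \<open>r\<close> that balances the two terms gives the exponent
  \<open>\<beta>\<close> (\<open>optimal_radius\<close>); if \<open>\<rho>/R\<close> is too large for this choice, or if \<open>p = \<infinity>\<close> and \<open>\<beta> = 0\<close>, the
  estimate by \<open>2 sup \<bar>u\<bar>\<close> is enough.

  Three steps of this sketch need work.  The strong Markov property is given for the position at
  one time after a Markov time, and is extended to functionals of the whole future path
  (\<open>strong_markov_law\<close>); exit times of cylinders are Markov times of the uncompleted filtration
  (\<open>exit_real_markov\<close>).  The estimate of the time integral is given for diffusion-type processes, which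
  start at the origin (\<open>diffusion_type_of_markov\<close>).  The estimate of caloric functions is given for
  cylinders based at the origin; the whole setting, including the Wiener process and the stochastic
  integral, is therefore translated (\<open>markov_diffusion_translate\<close>).\<close>

section \<open>Mixed norms under translations\<close>

text \<open>For an integrand that is not known to be measurable the transformation formula still holds as
  an inequality, because a simple minorant can be composed with the map.\<close>

lemma nn_integral_distr_le:
  assumes T: "T \<in> M \<rightarrow>\<^sub>M N"
  shows "(\<integral>\<^sup>+y. f y \<partial>distr M N T) \<le> (\<integral>\<^sup>+x. f (T x) \<partial>M)"
  unfolding nn_integral_def[of "distr M N T"]
proof (rule SUP_least, safe)
  fix g :: "'b \<Rightarrow> ennreal" assume g: "simple_function (distr M N T) g" and le: "g \<le> f"
  have "integral\<^sup>S (distr M N T) g = (\<integral>\<^sup>+y. g y \<partial>distr M N T)"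
    using nn_integral_eq_simple_integral[OF g] by simp
  also have "\<dots> = (\<integral>\<^sup>+x. g (T x) \<partial>M)"
    using borel_measurable_simple_function[OF g] by (rule nn_integral_distr[OF T])
  also have "\<dots> \<le> (\<integral>\<^sup>+x. f (T x) \<partial>M)"
    using le by (intro nn_integral_mono) (simp add: le_fun_def)
  finally show "integral\<^sup>S (distr M N T) g \<le> (\<integral>\<^sup>+x. f (T x) \<partial>M)" .
qed

lemma nn_integral_le_translate:
  fixes \<phi> \<psi> :: "'a::euclidean_space \<Rightarrow> ennreal"
  assumes le: "\<And>x. \<phi> x \<le> \<psi> (x + c)"
  shows "(\<integral>\<^sup>+x. \<phi> x \<partial>lborel) \<le> (\<integral>\<^sup>+x. \<psi> x \<partial>lborel)"
proof -
  have "(\<integral>\<^sup>+x. \<phi> x \<partial>lborel) = (\<integral>\<^sup>+x. \<phi> x \<partial>distr lborel borel ((+) (- c)))"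
    by (simp only: lborel_distr_plus)
  also have "\<dots> \<le> (\<integral>\<^sup>+x. \<phi> (- c + x) \<partial>lborel)"
    by (rule nn_integral_distr_le) simp
  also have "\<dots> \<le> (\<integral>\<^sup>+x. \<psi> x \<partial>lborel)"
    by (rule nn_integral_mono) (use le[of "- c + _"] in simp)
  finally show ?thesis .
qed

lemma epow_mono: "x \<le> y \<Longrightarrow> 0 \<le> a \<Longrightarrow> epow x a \<le> epow y a"
  unfolding epow_def
  by (auto simp: top_unique intro!: ennreal_leI powr_mono2 enn2real_mono simp: less_top)

lemma lp_norm_le_translate:
  fixes \<phi> \<psi> :: "'a::euclidean_space \<Rightarrow> ennreal"
  assumes le: "\<And>x. \<phi> x \<le> \<psi> (x + c)" and p: "1 \<le> p"
    and m: "p = \<infinity> \<Longrightarrow> \<phi> \<in> borel_measurable borel"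
  shows "lp_norm p lborel \<phi> \<le> lp_norm p lborel \<psi>"
proof (cases "p = \<infinity>")
  case True
  have "AE x in distr lborel borel ((+) c). \<psi> x \<le> esssup lborel \<psi>"
    using esssup_AE[of \<psi> lborel] by (simp only: lborel_distr_plus)
  then have "AE x in lborel. \<psi> (c + x) \<le> esssup lborel \<psi>"
    by (rule AE_distrD[rotated]) simp
  then have "AE x in lborel. \<phi> x \<le> esssup lborel \<psi>"
    by eventually_elim (metis le order_trans add.commute)
  then show ?thesis using True m by (auto simp: lp_norm_def intro!: esssup_I)
next
  case False
  then obtain r where r: "p = ereal r" "1 \<le> r" using p by (cases p) auto
  show ?thesis
    unfolding lp_norm_def using r
    by (auto intro!: epow_mono nn_integral_le_translate[where c=c] le)
qed

text \<open>Only the inner norm can be an essential supremum when \<open>p\<close> is finite, and the sections of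
  a Borel function are Borel.\<close>

lemma Lpq_norm_le_translate:
  fixes f f' :: "'d::finite pt \<Rightarrow> real"
  assumes p: "1 \<le> p" "p \<noteq> \<infinity>" and q: "1 \<le> q"
    and m: "(\<lambda>z. indicator Q z * f z) \<in> borel_measurable borel"
    and le: "\<And>z. indicator Q z * \<bar>f z\<bar> \<le> indicator Q' (z + c) * \<bar>f' (z + c)\<bar>"
  shows "Lpq_norm p q Q f \<le> Lpq_norm p q Q' f'"
proof -
  obtain a b where c: "c = (a, b)" by (cases c)
  let ?F = "\<lambda>z. indicator Q z * ennreal \<bar>f z\<bar>" and ?F' = "\<lambda>z. indicator Q' z * ennreal \<bar>f' z\<bar>"
  have le': "?F (t, x) \<le> ?F' (t + a, x + b)" for t x
    using le[of "(t, x)"] by (auto simp: c indicator_def intro: ennreal_leI split: if_splits)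
  have "?F = (\<lambda>z. ennreal \<bar>indicator Q z * f z\<bar>)" by (auto simp: indicator_def)
  then have "?F \<in> borel_measurable borel" using m by simp
  then have [measurable]: "?F \<in> borel_measurable (borel \<Otimes>\<^sub>M borel)"
    by (simp only: borel_prod)
  show ?thesis
  proof (cases "q \<le> p")
    case True
    then have "q \<noteq> \<infinity>" using p by auto
    then show ?thesis unfolding Lpq_norm_def using True p q
      by (auto intro!: lp_norm_le_translate[where c=a] lp_norm_le_translate[where c=b] le')
  next
    case False
    have "(\<lambda>t. ?F (t, x)) \<in> borel_measurable borel" for x by measurable
    then show ?thesis unfolding Lpq_norm_def using False p q
      by (auto intro!: lp_norm_le_translate[where c=b] lp_norm_le_translate[where c=a] le')
  qed
qed

section \<open>Measurability on the path space\<close>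

lemma space_path_space [simp]: "space (path_space :: 'd::finite path measure) = paths"
  unfolding path_space_def by (rule space_measure_of) auto

lemma space_path_filt [simp]: "space (path_filt t :: 'd::finite path measure) = paths"
  unfolding path_filt_def by (rule space_measure_of) auto

lemma sets_path_filt:
  "sets (path_filt t :: 'd::finite path measure) =
     sigma_sets paths {(\<lambda>\<omega>. \<omega> s) -` B \<inter> paths | s B. 0 \<le> s \<and> s \<le> t \<and> B \<in> sets borel}"
  unfolding path_filt_def by (rule sets_measure_of) auto

lemma sets_path_space:
  "sets (path_space :: 'd::finite path measure) =
     sigma_sets paths {(\<lambda>\<omega>. \<omega> s) -` B \<inter> paths | s B. 0 \<le> s \<and> B \<in> sets borel}"
  unfolding path_space_def by (rule sets_measure_of) auto

lemma sets_path_filt_mono: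
  "s \<le> t \<Longrightarrow> sets (path_filt s :: 'd::finite path measure) \<subseteq> sets (path_filt t)"
  unfolding sets_path_filt by (rule sigma_sets_mono') (blast intro: order_trans)

lemma sets_path_filt_subset: "sets (path_filt s :: 'd::finite path measure) \<subseteq> sets path_space"
  unfolding sets_path_filt sets_path_space by (rule sigma_sets_mono') auto

lemma measurable_eval_filt:
  "0 \<le> s \<Longrightarrow> s \<le> t \<Longrightarrow> (\<lambda>\<omega>. \<omega> s) \<in> (path_filt t :: 'd::finite path measure) \<rightarrow>\<^sub>M borel"
  by (rule measurableI) (auto simp: sets_path_filt intro!: sigma_sets.Basic)

lemma measurable_eval:
  "0 \<le> s \<Longrightarrow> (\<lambda>\<omega>. \<omega> s) \<in> (path_space :: 'd::finite path measure) \<rightarrow>\<^sub>M borel"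
  by (rule measurableI) (auto simp: sets_path_space intro!: sigma_sets.Basic)

lemma measurable_into_path_space:
  assumes "\<And>x. x \<in> space M \<Longrightarrow> f x \<in> (paths :: 'd::finite path set)"
    and "\<And>s. 0 \<le> s \<Longrightarrow> (\<lambda>x. f x s) \<in> M \<rightarrow>\<^sub>M borel"
  shows "f \<in> M \<rightarrow>\<^sub>M path_space"
  unfolding path_space_def
proof (rule measurable_measure_of)
  fix y assume "y \<in> {(\<lambda>\<omega>. \<omega> s) -` B \<inter> paths |s B. 0 \<le> s \<and> B \<in> sets (borel :: 'd pt measure)}"
  then obtain s B where y: "y = (\<lambda>\<omega>. \<omega> s) -` B \<inter> paths" "0 \<le> s" "B \<in> sets borel" by auto
  have "f -` y \<inter> space M = (\<lambda>x. f x s) -` B \<inter> space M" using assms(1) y by auto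
  then show "f -` y \<inter> space M \<in> sets M" using assms(2)[OF y(2)] y(3) by (simp add: measurable_sets)
qed (use assms in auto)

lemma measurable_into_path_filt:
  assumes "\<And>x. x \<in> space M \<Longrightarrow> f x \<in> (paths :: 'd::finite path set)"
    and "\<And>s. 0 \<le> s \<Longrightarrow> s \<le> t \<Longrightarrow> (\<lambda>x. f x s) \<in> M \<rightarrow>\<^sub>M borel"
  shows "f \<in> M \<rightarrow>\<^sub>M path_filt t"
  unfolding path_filt_def
proof (rule measurable_measure_of)
  fix y assume "y \<in> {(\<lambda>\<omega>. \<omega> s) -` B \<inter> paths |s B. 0 \<le> s \<and> s \<le> t \<and> B \<in> sets (borel :: 'd pt measure)}"
  then obtain s B where y: "y = (\<lambda>\<omega>. \<omega> s) -` B \<inter> paths" "0 \<le> s" "s \<le> t" "B \<in> sets borel" by auto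
  have "f -` y \<inter> space M = (\<lambda>x. f x s) -` B \<inter> space M" using assms(1) y by auto
  then show "f -` y \<inter> space M \<in> sets M" using assms(2)[OF y(2,3)] y(4) by (simp add: measurable_sets)
qed (use assms in auto)

lemma pathsD:
  assumes "\<omega> \<in> paths"
  shows "continuous_on {0..} \<omega>" "0 \<le> s \<Longrightarrow> fst (\<omega> s) = fst (\<omega> 0) + s" "\<omega> \<in> extensional {0..}"
  using assms unfolding paths_def by blast+

text \<open>Evaluation is jointly measurable by continuity of paths: the time is approximated from above
  by the grid of mesh \<open>1 / (n + 1)\<close>.  The clipping function \<open>\<kappa>\<close> keeps the grid points in the time
  range that \<open>M\<close> knows about; with \<open>\<kappa> = max 0 \<circ> min t\<close> this is progressive measurability.\<close>

lemma measurable_eval_joint: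
  fixes M :: "'d::finite path measure" and \<kappa> :: "real \<Rightarrow> real"
  assumes M: "space M \<subseteq> paths" and \<kappa>: "continuous_on UNIV \<kappa>" "\<And>s. 0 \<le> \<kappa> s"
    and ev: "\<And>s. (\<lambda>\<omega>. \<omega> (\<kappa> s)) \<in> M \<rightarrow>\<^sub>M borel"
  shows "(\<lambda>(s, \<omega>). \<omega> (\<kappa> s)) \<in> borel \<Otimes>\<^sub>M M \<rightarrow>\<^sub>M borel"
proof -
  define g where "g n s = \<lceil>real (Suc n) * s\<rceil>" for n and s :: real
  define f where "f n x = snd x (\<kappa> (of_int (g n (fst x)) / real (Suc n)))" for n and x :: "real \<times> 'd path"
  have fm: "f n \<in> borel \<Otimes>\<^sub>M M \<rightarrow>\<^sub>M borel" for n
    unfolding f_def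
  proof (rule measurable_compose_countable[where g="\<lambda>x. g n (fst x)"])
    show "(\<lambda>x. snd x (\<kappa> (real_of_int i / real (Suc n)))) \<in> borel \<Otimes>\<^sub>M M \<rightarrow>\<^sub>M borel" for i
      by (rule measurable_compose[OF measurable_snd ev])
    show "(\<lambda>x. g n (fst x)) \<in> borel \<Otimes>\<^sub>M M \<rightarrow>\<^sub>M count_space UNIV"
      unfolding g_def by measurable
  qed
  have "(\<lambda>x. snd x (\<kappa> (fst x))) \<in> borel \<Otimes>\<^sub>M M \<rightarrow>\<^sub>M borel"
  proof (rule borel_measurable_LIMSEQ_metric[OF fm])
    fix x :: "real \<times> 'd path" assume "x \<in> space (borel \<Otimes>\<^sub>M M)"
    then have x: "snd x \<in> paths" using M by (auto simp: space_pair_measure)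
    have b: "\<bar>of_int (g n (fst x)) / real (Suc n) - fst x\<bar> \<le> 1 / real (Suc n)" for n
    proof -
      have "real_of_int (g n (fst x)) - real (Suc n) * fst x \<le> 1"
        "0 \<le> real_of_int (g n (fst x)) - real (Suc n) * fst x"
        unfolding g_def by linarith+
      moreover have "of_int (g n (fst x)) / real (Suc n) - fst x
          = (of_int (g n (fst x)) - real (Suc n) * fst x) / real (Suc n)"
        by (simp add: diff_divide_distrib del: of_nat_Suc)
      ultimately show ?thesis by (simp add: divide_right_mono)
    qed
    have "(\<lambda>n. of_int (g n (fst x)) / real (Suc n) - fst x) \<longlonglongrightarrow> 0"
      by (rule Lim_null_comparison[OF _ LIMSEQ_inverse_real_of_nat])
        (use b in \<open>auto intro!: always_eventually simp: inverse_eq_divide\<close>)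
    then have "(\<lambda>n. of_int (g n (fst x)) / real (Suc n)) \<longlonglongrightarrow> fst x"
      by (simp add: LIM_zero_iff)
    then have "(\<lambda>n. \<kappa> (of_int (g n (fst x)) / real (Suc n))) \<longlonglongrightarrow> \<kappa> (fst x)"
      by (rule continuous_on_tendsto_compose[OF \<kappa>(1)]) auto
    then show "(\<lambda>n. f n x) \<longlonglongrightarrow> snd x (\<kappa> (fst x))"
      unfolding f_def
      by (rule continuous_on_tendsto_compose[OF pathsD(1)[OF x]]) (use \<kappa>(2) in auto)
  qed
  then show ?thesis by (simp add: case_prod_beta)
qed

lemma measurable_eval_at_filt:
  fixes f :: "'x \<Rightarrow> 'd::finite path"
  assumes t: "0 \<le> t" and f: "f \<in> N \<rightarrow>\<^sub>M path_filt t" and r: "r \<in> N \<rightarrow>\<^sub>M borel"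
  shows "(\<lambda>x. f x (max 0 (min t (r x)))) \<in> N \<rightarrow>\<^sub>M borel"
proof -
  have "(\<lambda>(s, \<omega>). \<omega> (max 0 (min t s))) \<in> borel \<Otimes>\<^sub>M (path_filt t :: 'd path measure) \<rightarrow>\<^sub>M borel"
    by (rule measurable_eval_joint)
      (use t in \<open>auto intro!: continuous_intros measurable_eval_filt\<close>)
  from measurable_compose[OF measurable_Pair[OF r f] this] show ?thesis by simp
qed

lemma measurable_eval_at:
  fixes f :: "'x \<Rightarrow> 'd::finite path"
  assumes f: "f \<in> N \<rightarrow>\<^sub>M path_space" and r: "r \<in> N \<rightarrow>\<^sub>M borel"
    and pos: "\<And>x. x \<in> space N \<Longrightarrow> 0 \<le> r x"
  shows "(\<lambda>x. f x (r x)) \<in> N \<rightarrow>\<^sub>M borel"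
proof -
  have "(\<lambda>(s, \<omega>). \<omega> (max 0 s)) \<in> borel \<Otimes>\<^sub>M (path_space :: 'd path measure) \<rightarrow>\<^sub>M borel"
    by (rule measurable_eval_joint) (auto intro!: continuous_intros measurable_eval)
  from measurable_compose[OF measurable_Pair[OF r f] this]
  have "(\<lambda>x. f x (max 0 (r x))) \<in> N \<rightarrow>\<^sub>M borel" by simp
  then show ?thesis by (rule measurable_cong[THEN iffD1, rotated]) (simp add: pos max_def)
qed

definition path_shift :: "real \<Rightarrow> 'd::finite path \<Rightarrow> 'd path" where
  "path_shift a \<omega> = (\<lambda>s\<in>{0..}. \<omega> (a + s))"

lemma path_shift_apply [simp]: "0 \<le> s \<Longrightarrow> path_shift a \<omega> s = \<omega> (a + s)"
  by (simp add: path_shift_def)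

lemma path_shift_in_paths:
  assumes w: "\<omega> \<in> paths" and a: "0 \<le> a" shows "path_shift a \<omega> \<in> paths"
proof -
  have "continuous_on {0..} (\<lambda>s. \<omega> (a + s))"
    by (rule continuous_on_compose2[OF pathsD(1)[OF w]]) (use a in \<open>auto intro!: continuous_intros\<close>)
  then have "continuous_on {0..} (path_shift a \<omega>)"
    by (rule continuous_on_eq) simp
  moreover have "fst (\<omega> (a + s)) = fst (\<omega> a) + s" if "0 \<le> s" for s
    using pathsD(2)[OF w, of "a + s"] pathsD(2)[OF w, of a] a that by simp
  ultimately show ?thesis by (auto simp: paths_def path_shift_def)
qed

lemma measurable_path_shift:
  assumes r: "r \<in> path_space \<rightarrow>\<^sub>M borel" and pos: "\<And>\<omega>. \<omega> \<in> paths \<Longrightarrow> 0 \<le> r \<omega>"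
  shows "(\<lambda>\<omega>. path_shift (r \<omega>) \<omega>) \<in> path_space \<rightarrow>\<^sub>M (path_space :: 'd::finite path measure)"
proof (rule measurable_into_path_space)
  show "path_shift (r \<omega>) \<omega> \<in> paths" if "\<omega> \<in> space path_space" for \<omega> :: "'d path"
    using that pos by (auto intro: path_shift_in_paths)
  fix s :: real assume "0 \<le> s"
  then show "(\<lambda>\<omega>. path_shift (r \<omega>) \<omega> s) \<in> path_space \<rightarrow>\<^sub>M borel"
    using pos by (simp, intro measurable_eval_at) (auto intro!: borel_measurable_add r)
qed

section \<open>Exit times of cylinders\<close>

text \<open>The exit time is \<open>e\<close> and is attained.  Such an \<open>e\<close> is unique, so that identities between exit
  times reduce to checking this property.\<close>

definition exits_at :: "'b set \<Rightarrow> (real \<Rightarrow> 'b) \<Rightarrow> real \<Rightarrow> bool" where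
  "exits_at C \<phi> e \<longleftrightarrow> 0 \<le> e \<and> (\<forall>r. 0 \<le> r \<longrightarrow> r < e \<longrightarrow> \<phi> r \<in> C) \<and> \<phi> e \<notin> C"

definition exit_real :: "'b set \<Rightarrow> (real \<Rightarrow> 'b) \<Rightarrow> real" where
  "exit_real C \<phi> = real_of_ereal (exit_time C \<phi>)"

lemma exit_time_eq: "exits_at C \<phi> e \<Longrightarrow> exit_time C \<phi> = ereal e"
  unfolding hit_time_def exits_at_def
  by (intro antisym INF_lower INF_greatest) (auto simp: not_less[symmetric])

lemma exit_real_eq: "exits_at C \<phi> e \<Longrightarrow> exit_real C \<phi> = e"
  by (simp add: exit_real_def exit_time_eq)

text \<open>A cylinder is not open, but inside it the clock can only leave through the upper end, so
  that the exit is through a closed set and is attained.\<close>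

lemma exits_cyl2:
  assumes w: "\<omega> \<in> paths" and T: "0 < T"
  shows "exits_at (cyl2 T R z) \<omega> (exit_real (cyl2 T R z) \<omega>)"
    and "exit_real (cyl2 T R z) \<omega> \<le> T"
proof -
  let ?C = "cyl2 T R z"
  have "\<exists>e\<le>T. exits_at ?C \<omega> e"
  proof (cases "\<omega> 0 \<in> ?C")
    case False
    then show ?thesis using T by (intro exI[of _ 0]) (auto simp: exits_at_def)
  next
    case True
    define U where "U = fst z + T - fst (\<omega> 0)"
    have U: "0 < U" "U \<le> T" using True by (auto simp: U_def cyl2_def mem_Times_iff)
    define S where "S = {r \<in> {0..U}. R \<le> dist (snd z) (snd (\<omega> r))} \<union> {U}"
    have "continuous_on {0..U} (\<lambda>r. dist (snd z) (snd (\<omega> r)))"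
      by (intro continuous_intros continuous_on_subset[OF pathsD(1)[OF w]]) auto
    then have "closed {r \<in> {0..U}. R \<le> dist (snd z) (snd (\<omega> r))}"
      by (intro continuous_on_closed_Collect_le continuous_on_const) auto
    moreover have "bounded {r \<in> {0..U}. R \<le> dist (snd z) (snd (\<omega> r))}"
      by (rule bounded_subset[OF bounded_closed_interval[of 0 U]]) auto
    ultimately have "compact S" unfolding S_def
      by (intro compact_Un compact_insert compact_empty) (simp_all add: compact_eq_bounded_closed)
    then obtain e where e: "e \<in> S" "\<And>r. r \<in> S \<Longrightarrow> e \<le> r"
      using compact_attains_inf[of S] by (auto simp: S_def)
    have "\<omega> r \<in> ?C" if "0 \<le> r" "r < e" for r
    proof -
      have "r \<notin> S" "r < U" using that e by (force simp: S_def)+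
      then show ?thesis using that True pathsD(2)[OF w, of r]
        by (auto simp: S_def cyl2_def mem_Times_iff U_def)
    qed
    moreover have "\<omega> e \<notin> ?C" "0 \<le> e" "e \<le> T"
      using e(1) U pathsD(2)[OF w, of e] by (auto simp: S_def cyl2_def mem_Times_iff U_def)
    ultimately show ?thesis by (auto simp: exits_at_def)
  qed
  then show "exits_at ?C \<omega> (exit_real ?C \<omega>)" "exit_real ?C \<omega> \<le> T"
    using exit_real_eq by metis+
qed

lemma exit_point_in_closure:
  assumes w: "\<omega> \<in> paths" and e: "exits_at C \<omega> e" and 0: "\<omega> 0 \<in> closure C"
  shows "\<omega> e \<in> closure C"
proof (cases "e = 0")
  case False
  then have e0: "0 < e" using e by (simp add: exits_at_def)
  have "\<omega> ` closure {0..<e} \<subseteq> closure C"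
  proof (rule image_closure_subset)
    show "continuous_on (closure {0..<e}) \<omega>"
      by (rule continuous_on_subset[OF pathsD(1)[OF w]]) (use e0 in auto)
    show "\<omega> ` {0..<e} \<subseteq> closure C"
      using e closure_subset by (fastforce simp: exits_at_def)
  qed simp
  then show ?thesis using e0 by auto
qed (use 0 in simp)

text \<open>After leaving a smaller set the path still has to leave the larger one.\<close>

lemma exits_at_shift:
  assumes sub: "C' \<subseteq> C" and e': "exits_at C' \<omega> e'" and e: "exits_at C (path_shift e' \<omega>) e"
  shows "exits_at C \<omega> (e' + e)"
proof -
  have "\<omega> r \<in> C" if r: "0 \<le> r" "r < e' + e" for r
  proof (cases "r < e'")
    case True
    then show ?thesis using e' sub r by (auto simp: exits_at_def)
  next
    case False
    then have "0 \<le> r - e'" "r - e' < e" using r by auto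
    then have "path_shift e' \<omega> (r - e') \<in> C" using e unfolding exits_at_def by blast
    then show ?thesis using False by simp
  qed
  moreover have "\<omega> (e' + e) \<notin> C" using e e' by (auto simp: exits_at_def)
  ultimately show ?thesis using e e' by (auto simp: exits_at_def)
qed

text \<open>The event that the path has left the cylinder by time \<open>t\<close> depends on the path up to \<open>t\<close> only,
  without a look into the future: on \<open>[0, t]\<close> the distance to the axis reaches \<open>R\<close> iff it exceeds
  every \<open>R - 1 / (n + 1)\<close> at some rational time.\<close>

lemma exit_real_markov:
  fixes z :: "'d::finite pt"
  assumes T: "0 < T" and t: "0 \<le> t"
  shows "{\<omega> \<in> paths. exit_real (cyl2 T R z) \<omega> \<le> t} \<in> sets (path_filt t)"
proof -
  let ?C = "cyl2 T R z"
  let ?cl = "\<lambda>a. max 0 (min t a)"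
  define D where "D \<omega> a = dist (snd z) (snd (\<omega> (?cl a)))" for \<omega> :: "'d path" and a
  have iff: "exit_real ?C \<omega> \<le> t \<longleftrightarrow> \<omega> 0 \<notin> ?C \<or> fst z + T \<le> fst (\<omega> 0) + t \<or>
      (\<forall>n. \<exists>a\<in>\<rat>. R - 1 / real (Suc n) < D \<omega> a)" if w: "\<omega> \<in> paths" for \<omega> :: "'d path"
  proof -
    have cont: "continuous_on UNIV (D \<omega>)"
      unfolding D_def
      by (intro continuous_intros continuous_on_compose2[OF pathsD(1)[OF w]]) auto
    have rat: "(\<forall>n. \<exists>a\<in>\<rat>. R - 1 / real (Suc n) < D \<omega> a) \<longleftrightarrow> (\<exists>r\<in>{0..t}. R \<le> D \<omega> r)"
    proof
      assume L: "\<forall>n. \<exists>a\<in>\<rat>. R - 1 / real (Suc n) < D \<omega> a"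
      obtain r where r: "r \<in> {0..t}" "\<And>y. y \<in> {0..t} \<Longrightarrow> D \<omega> y \<le> D \<omega> r"
        using continuous_attains_sup[of "{0..t}" "D \<omega>"] t continuous_on_subset[OF cont] by auto
      have D: "R + - (1 / real (Suc n)) \<le> D \<omega> r" for n
      proof -
        obtain a where "R - 1 / real (Suc n) < D \<omega> a" using L by blast
        also have "D \<omega> a = D \<omega> (?cl a)" using t by (auto simp: D_def)
        also have "\<dots> \<le> D \<omega> r" using t by (intro r) auto
        finally show ?thesis by simp
      qed
      have "R \<le> D \<omega> r"
        using LIMSEQ_inverse_real_of_nat_add_minus[of R] D
        by (intro LIMSEQ_le_const2) (auto simp: inverse_eq_divide simp del: of_nat_Suc)
      then show "\<exists>r\<in>{0..t}. R \<le> D \<omega> r" using r by blast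
    next
      assume "\<exists>r\<in>{0..t}. R \<le> D \<omega> r"
      then obtain r where r: "R \<le> D \<omega> r" by blast
      show "\<forall>n. \<exists>a\<in>\<rat>. R - 1 / real (Suc n) < D \<omega> a"
      proof
        fix n
        have "open {a. R - 1 / real (Suc n) < D \<omega> a}"
          using cont by (intro open_Collect_less continuous_intros) auto
        moreover have "R - 1 / real (Suc n) < R" by simp
        with r have "r \<in> {a. R - 1 / real (Suc n) < D \<omega> a}" by (simp only: mem_Collect_eq)
        ultimately obtain \<epsilon> where \<epsilon>: "0 < \<epsilon>" "ball r \<epsilon> \<subseteq> {a. R - 1 / real (Suc n) < D \<omega> a}"
          by (meson openE)
        obtain a where "a \<in> \<rat>" "r < a" "a < r + \<epsilon>" using Rats_dense_in_real[of r "r + \<epsilon>"] \<epsilon> by auto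
        moreover from this have "a \<in> ball r \<epsilon>" by (simp add: dist_real_def)
        ultimately show "\<exists>a\<in>\<rat>. R - 1 / real (Suc n) < D \<omega> a" using \<epsilon>(2) by blast
      qed
    qed
    note ex = exits_cyl2[OF w T, of R z]
    have "exit_real ?C \<omega> \<le> t \<longleftrightarrow> (\<exists>r\<in>{0..t}. \<omega> r \<notin> ?C)"
      using ex(1) by (auto simp: exits_at_def not_less[symmetric])
    also have "\<dots> \<longleftrightarrow> \<omega> 0 \<notin> ?C \<or> fst z + T \<le> fst (\<omega> 0) + t \<or> (\<exists>r\<in>{0..t}. R \<le> D \<omega> r)"
    proof -
      have "\<omega> r \<notin> ?C \<longleftrightarrow> fst z + T \<le> fst (\<omega> 0) + r \<or> R \<le> D \<omega> r" if "\<omega> 0 \<in> ?C" "r \<in> {0..t}" for r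
        using that pathsD(2)[OF w, of r] by (auto simp: cyl2_def mem_Times_iff D_def)
      moreover have "fst z + T \<le> fst (\<omega> 0) + t \<longleftrightarrow> (\<exists>r\<in>{0..t}. fst z + T \<le> fst (\<omega> 0) + r)"
        using t by fastforce
      moreover have "\<omega> 0 \<notin> ?C \<Longrightarrow> (\<exists>r\<in>{0..t}. \<omega> r \<notin> ?C)" using t by auto
      ultimately show ?thesis by blast
    qed
    finally show ?thesis unfolding rat .
  qed
  have [measurable]: "(\<lambda>\<omega>. \<omega> (?cl a)) \<in> (path_filt t :: 'd path measure) \<rightarrow>\<^sub>M borel" for a
    by (rule measurable_eval_filt) (use t in auto)
  have [measurable]: "(\<lambda>\<omega>. \<omega> 0) \<in> (path_filt t :: 'd path measure) \<rightarrow>\<^sub>M borel"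
    by (rule measurable_eval_filt) (use t in auto)
  have [measurable]: "?C \<in> sets borel" unfolding cyl2_def by (auto intro!: borel_Times)
  have [measurable]: "(\<lambda>\<omega>. snd (\<omega> a) :: real ^ 'd) \<in> path_filt t \<rightarrow>\<^sub>M borel" 
      "(\<lambda>\<omega>. fst (\<omega> a)) \<in> (path_filt t :: 'd path measure) \<rightarrow>\<^sub>M borel"
    if "(\<lambda>\<omega>. \<omega> a) \<in> (path_filt t :: 'd path measure) \<rightarrow>\<^sub>M borel" for a
    using measurable_compose[OF that, of snd borel] measurable_compose[OF that, of fst borel]
    by (simp_all add: borel_measurable_continuous_onI continuous_on_fst continuous_on_snd)
  have [measurable]: "(\<lambda>\<omega>. D \<omega> a) \<in> (path_filt t :: 'd path measure) \<rightarrow>\<^sub>M borel" for a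
    unfolding D_def by measurable
  have "{\<omega> \<in> space (path_filt t). \<omega> 0 \<notin> ?C \<or> fst z + T \<le> fst (\<omega> 0) + t \<or>
      (\<forall>n. \<exists>a\<in>\<rat>. R - 1 / real (Suc n) < D \<omega> a)} \<in> sets (path_filt t)"
  proof (intro sets.sets_Collect_disj sets.sets_Collect_countable_All sets.sets_Collect_countable_Ex' countable_rat)
    show "{\<omega> \<in> space (path_filt t). \<omega> 0 \<notin> ?C} \<in> sets (path_filt t)" by measurable
    show "{\<omega> \<in> space (path_filt t). fst z + T \<le> fst (\<omega> 0) + t}
        \<in> sets (path_filt t :: 'd path measure)" by measurable
    show "{\<omega> \<in> space (path_filt t). R - 1 / real (Suc n) < D \<omega> a} \<in> sets (path_filt t)" for n a
      by measurable
  qed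
  also have "{\<omega> \<in> space (path_filt t). \<omega> 0 \<notin> ?C \<or> fst z + T \<le> fst (\<omega> 0) + t \<or>
      (\<forall>n. \<exists>a\<in>\<rat>. R - 1 / real (Suc n) < D \<omega> a)} = {\<omega> \<in> paths. exit_real ?C \<omega> \<le> t}"
    using iff by auto
  finally show ?thesis .
qed

lemma measurable_exit_real:
  fixes z :: "'d::finite pt"
  assumes T: "0 < T"
  shows "exit_real (cyl2 T R z) \<in> path_space \<rightarrow>\<^sub>M borel"
proof (rule borel_measurable_iff_le[THEN iffD2], rule allI)
  fix t :: real
  show "{\<omega> \<in> space path_space. exit_real (cyl2 T R z) \<omega> \<le> t} \<in> sets path_space"
  proof (cases "0 \<le> t")
    case True
    then show ?thesis using exit_real_markov[OF T True, of R z] sets_path_filt_subset[of t] by auto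
  next
    case False
    have "0 \<le> exit_real (cyl2 T R z) \<omega>" if "\<omega> \<in> paths" for \<omega>
      using exits_cyl2(1)[OF that T] by (simp add: exits_at_def)
    then have "{\<omega> \<in> space path_space. exit_real (cyl2 T R z) \<omega> \<le> t} = {}"
      using False by force
    then show ?thesis by (simp only: sets.empty_sets)
  qed
qed

section \<open>The strong Markov property for functionals of the whole future\<close>

text \<open>\<open>\<tau>\<close> is a Markov time of the uncompleted filtration and \<open>A\<close> an event of its past.\<close>

definition past_event :: "('d::finite path \<Rightarrow> real) \<Rightarrow> 'd path set \<Rightarrow> bool" where
  "past_event \<tau> A \<longleftrightarrow> (\<forall>\<omega>\<in>paths. 0 \<le> \<tau> \<omega>) \<and>
     (\<forall>t\<ge>0. {\<omega>\<in>paths. \<tau> \<omega> \<le> t} \<in> sets (path_filt t)) \<and>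
     A \<in> sets path_space \<and> (\<forall>t\<ge>0. {\<omega>\<in>A. \<tau> \<omega> \<le> t} \<in> sets (path_filt t))"

lemma past_event_subset: "past_event \<tau> A \<Longrightarrow> A \<subseteq> paths"
  unfolding past_event_def using sets.sets_into_space[of A path_space] by simp

lemma past_event_pos: "past_event \<tau> A \<Longrightarrow> \<omega> \<in> paths \<Longrightarrow> 0 \<le> \<tau> \<omega>"
  by (simp add: past_event_def)

lemma past_event_const:
  assumes "0 \<le> r" "A \<in> sets (path_filt r)"
  shows "past_event (\<lambda>_. r) (A :: 'd::finite path set)"
proof -
  have "{\<omega>\<in>A. r \<le> t} \<in> sets (path_filt t)" for t
  proof (cases "r \<le> t")
    case True
    then show ?thesis using subsetD[OF sets_path_filt_mono[OF True] assms(2)] by simp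
  qed simp
  moreover have "{\<omega>\<in>paths. r \<le> t} \<in> sets (path_filt t :: 'd path measure)" for t
    using sets.top[of "path_filt t :: 'd path measure"] by (cases "r \<le> t") auto
  ultimately show ?thesis
    using assms(1) subsetD[OF sets_path_filt_subset assms(2)] unfolding past_event_def by blast
qed

lemma past_event_measurable:
  assumes "past_event \<tau> A"
  shows "\<tau> \<in> path_space \<rightarrow>\<^sub>M borel"
proof (rule borel_measurable_iff_le[THEN iffD2], rule allI)
  fix t :: real
  show "{\<omega> \<in> space path_space. \<tau> \<omega> \<le> t} \<in> sets path_space"
  proof (cases "0 \<le> t")
    case True
    then show ?thesis using assms sets_path_filt_subset[of t] by (auto simp: past_event_def)
  next
    case False
    have "{\<omega> \<in> space path_space. \<tau> \<omega> \<le> t} = {}"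
      using False past_event_pos[OF assms] by force
    then show ?thesis by (simp only: sets.empty_sets)
  qed
qed

text \<open>Events observed a fixed time after \<open>\<tau>\<close> belong to the past of the later Markov time; this is
  progressive measurability.\<close>

lemma past_event_step:
  fixes A :: "'d::finite path set"
  assumes pe: "past_event \<tau> A" and r: "0 \<le> r" and \<Gamma>: "\<Gamma> \<in> sets borel"
  shows "past_event (\<lambda>\<omega>. \<tau> \<omega> + r) {\<omega>\<in>A. \<omega> (\<tau> \<omega> + r) \<in> \<Gamma>}"
proof -
  note pos = past_event_pos[OF pe]
  have le: "{\<omega>\<in>paths. \<tau> \<omega> \<le> a} \<in> sets (path_filt t)" if "a \<le> t" for a t
  proof (cases "0 \<le> a")
    case True
    then show ?thesis using pe sets_path_filt_mono[OF that] by (auto simp: past_event_def)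
  next
    case False
    have "{\<omega> \<in> paths. \<tau> \<omega> \<le> a} = {}"
      using False pos by force
    then show ?thesis by (simp only: sets.empty_sets)
  qed
  have A: "{\<omega>\<in>A. \<omega> (\<tau> \<omega> + r) \<in> \<Gamma> \<and> \<tau> \<omega> + r \<le> t} \<in> sets (path_filt t)" if t: "0 \<le> t" for t
  proof (cases "r \<le> t")
    case True
    define m where "m \<omega> = min (\<tau> \<omega>) (t - r)" for \<omega> :: "'d path"
    have mm: "m \<in> path_filt t \<rightarrow>\<^sub>M borel"
    proof (rule borel_measurable_iff_le[THEN iffD2], rule allI)
      fix a
      show "{\<omega> \<in> space (path_filt t). m \<omega> \<le> a} \<in> sets (path_filt t)"
      proof (cases "t - r \<le> a")
        case True
        then have "{\<omega> \<in> space (path_filt t). m \<omega> \<le> a} = space (path_filt t)" by (auto simp: m_def)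
        then show ?thesis by (simp only: sets.top)
      next
        case False
        then have "{\<omega> \<in> space (path_filt t). m \<omega> \<le> a} = {\<omega>\<in>paths. \<tau> \<omega> \<le> a}"
          by (auto simp: m_def min_le_iff_disj)
        then show ?thesis using le[of a t] False r by simp
      qed
    qed
    have [measurable]: "(\<lambda>\<omega>. \<omega> (max 0 (min t (m \<omega> + r)))) \<in> path_filt t \<rightarrow>\<^sub>M borel"
      by (rule measurable_eval_at_filt[OF t]) (use mm in \<open>auto intro!: borel_measurable_add\<close>)
    have "{\<omega>\<in>A. \<tau> \<omega> \<le> t - r} \<in> sets (path_filt (t - r))"
      using pe True by (simp add: past_event_def)
    then have "{\<omega>\<in>A. \<tau> \<omega> \<le> t - r} \<in> sets (path_filt t)"
      using sets_path_filt_mono[of "t - r" t] r by auto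
    moreover have "{\<omega>\<in>space (path_filt t). \<omega> (max 0 (min t (m \<omega> + r))) \<in> \<Gamma>} \<in> sets (path_filt t)"
      using \<Gamma> by measurable
    ultimately have "{\<omega>\<in>A. \<tau> \<omega> \<le> t - r} \<inter> {\<omega>\<in>space (path_filt t). \<omega> (max 0 (min t (m \<omega> + r))) \<in> \<Gamma>}
        \<in> sets (path_filt t)" by (rule sets.Int)
    also have "{\<omega>\<in>A. \<tau> \<omega> \<le> t - r} \<inter> {\<omega>\<in>space (path_filt t). \<omega> (max 0 (min t (m \<omega> + r))) \<in> \<Gamma>}
        = {\<omega>\<in>A. \<omega> (\<tau> \<omega> + r) \<in> \<Gamma> \<and> \<tau> \<omega> + r \<le> t}"
    proof -
      have "max 0 (min t (m \<omega> + r)) = \<tau> \<omega> + r" if "\<omega> \<in> A" "\<tau> \<omega> \<le> t - r" for \<omega>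
        using that pos[of \<omega>] past_event_subset[OF pe] r by (auto simp: m_def)
      then show ?thesis using past_event_subset[OF pe] by auto
    qed
    finally show ?thesis .
  next
    case False
    then have "{\<omega>\<in>A. \<omega> (\<tau> \<omega> + r) \<in> \<Gamma> \<and> \<tau> \<omega> + r \<le> t} = {}"
      using pos past_event_subset[OF pe] by force
    then show ?thesis by (simp only: sets.empty_sets)
  qed
  note past_event_measurable[OF pe, measurable]
  have [measurable]: "A \<in> sets path_space" using pe by (simp add: past_event_def)
  have ev: "(\<lambda>\<omega>. \<omega> (\<tau> \<omega> + r)) \<in> (path_space :: 'd path measure) \<rightarrow>\<^sub>M borel"
    by (rule measurable_eval_at) (use r pos in auto)
  have "A \<inter> ((\<lambda>\<omega>. \<omega> (\<tau> \<omega> + r)) -` \<Gamma> \<inter> space path_space) \<in> sets path_space"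
    using measurable_sets[OF ev \<Gamma>] by auto
  also have "A \<inter> ((\<lambda>\<omega>. \<omega> (\<tau> \<omega> + r)) -` \<Gamma> \<inter> space path_space) = {\<omega>\<in>A. \<omega> (\<tau> \<omega> + r) \<in> \<Gamma>}"
    using past_event_subset[OF pe] by auto
  finally show ?thesis
    using r pos le A unfolding past_event_def by (auto simp: le_diff_eq[symmetric])
qed

lemma finite_dim_event:
  assumes "finite I" "\<And>s. s \<in> I \<Longrightarrow> 0 \<le> \<kappa> s" "\<And>s. s \<in> I \<Longrightarrow> \<Gamma> s \<in> sets borel"
  shows "{\<omega>\<in>paths. \<forall>s\<in>I. \<omega> (\<kappa> s) \<in> \<Gamma> s} \<in> sets (path_space :: 'd::finite path measure)"
proof -
  have "{\<omega>\<in>space path_space. \<forall>s\<in>I. \<omega> (\<kappa> s) \<in> \<Gamma> s} \<in> sets (path_space :: 'd path measure)"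
  proof (rule sets.sets_Collect_finite_All[OF _ assms(1)])
    fix s assume s: "s \<in> I"
    have "(\<lambda>\<omega>. \<omega> (\<kappa> s)) -` \<Gamma> s \<inter> space path_space \<in> sets (path_space :: 'd path measure)"
      by (rule measurable_sets[OF measurable_eval]) (use assms s in auto)
    then show "{\<omega>\<in>space path_space. \<omega> (\<kappa> s) \<in> \<Gamma> s} \<in> sets (path_space :: 'd path measure)"
      by (simp add: vimage_def Int_def conj_commute)
  qed
  then show ?thesis by simp
qed

context
  fixes P :: "'d::finite pt \<Rightarrow> 'd path measure"
  assumes sm: "strong_markov path_filt P"
begin

lemma kernel_measurable: "P \<in> borel \<rightarrow>\<^sub>M prob_algebra path_space"
  using sm by (simp add: strong_markov_def markov_def)

lemma kernel_subprob: "P \<in> borel \<rightarrow>\<^sub>M subprob_algebra path_space"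
  by (rule measurable_prob_algebraD[OF kernel_measurable])

lemma sets_kernel [simp]: "sets (P z) = sets path_space"
  and prob_space_kernel: "prob_space (P z)"
  using measurable_space[OF kernel_measurable, of z] by (auto simp: space_prob_algebra)

lemma space_kernel [simp]: "space (P z) = paths"
  using sets_eq_imp_space_eq[OF sets_kernel] by simp

lemma kernel_start: "AE \<omega> in P z. \<omega> 0 = z"
  using sm unfolding strong_markov_def markov_def by blast

lemma measurable_kernel_emeasure:
  "E \<in> sets path_space \<Longrightarrow> (\<lambda>z. emeasure (P z) E) \<in> borel_measurable borel"
  by (rule measurable_compose[OF kernel_subprob measurable_emeasure_subprob_algebra])

lemma measurable_kernel_nn_integral:
  "\<Phi> \<in> borel_measurable path_space \<Longrightarrow> (\<lambda>z. \<integral>\<^sup>+\<omega>. \<Phi> \<omega> \<partial>P z) \<in> borel_measurable borel"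
  by (rule measurable_compose[OF kernel_subprob nn_integral_measurable_subprob_algebra])

lemma measurable_at_past_event:
  assumes "past_event \<tau> A" "0 \<le> s"
  shows "(\<lambda>\<omega>. \<omega> (\<tau> \<omega> + s)) \<in> path_space \<rightarrow>\<^sub>M (borel :: 'd pt measure)"
  by (rule measurable_eval_at)
    (use assms past_event_measurable[OF assms(1)] past_event_pos[OF assms(1)] in auto)

text \<open>The strong Markov property is assumed for events at one later time.  It says that two measures
  coincide, with which functions of the later position can be integrated.\<close>

lemma strong_markov_one_time:
  assumes pe: "past_event \<tau> A" and s: "0 \<le> s" and \<phi>: "\<phi> \<in> borel_measurable borel"
  shows "(\<integral>\<^sup>+\<omega>\<in>A. \<phi> (\<omega> (\<tau> \<omega> + s)) \<partial>P z) = (\<integral>\<^sup>+\<omega>\<in>A. (\<integral>\<^sup>+\<omega>'. \<phi> (\<omega>' s) \<partial>P (\<omega> (\<tau> \<omega>))) \<partial>P z)"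
proof -
  define D where "D = density (P z) (indicator A)"
  define N where "N y = distr (P y) borel (\<lambda>\<omega>. \<omega> s)" for y
  have A: "A \<in> sets (P z)" using pe by (simp add: past_event_def)
  have setsD: "sets D = sets path_space" and spaceD: "space D = paths" by (simp_all add: D_def)
  have spD: "space D \<noteq> {}" using prob_space.not_empty[OF prob_space_kernel[of z]] by (simp add: spaceD)
  have int_D: "(\<integral>\<^sup>+\<omega>. k \<omega> \<partial>D) = (\<integral>\<^sup>+\<omega>\<in>A. k \<omega> \<partial>P z)" if "k \<in> borel_measurable path_space" for k
    unfolding D_def using that A
    by (subst nn_integral_density) (auto simp: mult.commute cong: measurable_cong_sets)
  have ev: "(\<lambda>\<omega>. \<omega> (\<tau> \<omega> + s)) \<in> path_space \<rightarrow>\<^sub>M (borel :: 'd pt measure)"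
    by (rule measurable_at_past_event[OF pe s])
  have evD: "(\<lambda>\<omega>. \<omega> (\<tau> \<omega> + s)) \<in> D \<rightarrow>\<^sub>M borel"
    using ev by (simp add: measurable_cong_sets[OF setsD refl])
  have evs: "(\<lambda>\<omega>. \<omega> s) \<in> P y \<rightarrow>\<^sub>M borel" for y
    using measurable_eval[OF s] by (simp add: measurable_cong_sets[OF sets_kernel refl])
  have Nm: "N \<in> borel \<rightarrow>\<^sub>M subprob_algebra borel"
    unfolding N_def[abs_def] by (rule measurable_compose[OF kernel_subprob measurable_distr[OF measurable_eval[OF s]]])
  have ND: "(\<lambda>\<omega>. N (\<omega> (\<tau> \<omega>))) \<in> path_space \<rightarrow>\<^sub>M subprob_algebra borel"
    using measurable_compose[OF measurable_at_past_event[OF pe order_refl] Nm] by simp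
  then have ND': "(\<lambda>\<omega>. N (\<omega> (\<tau> \<omega>))) \<in> D \<rightarrow>\<^sub>M subprob_algebra borel"
    by (simp add: measurable_cong_sets[OF setsD refl])
  have "distr D borel (\<lambda>\<omega>. \<omega> (\<tau> \<omega> + s)) = D \<bind> (\<lambda>\<omega>. N (\<omega> (\<tau> \<omega>)))"
  proof (rule measure_eqI)
    show "sets (distr D borel (\<lambda>\<omega>. \<omega> (\<tau> \<omega> + s))) = sets (D \<bind> (\<lambda>\<omega>. N (\<omega> (\<tau> \<omega>))))"
      using spD by (subst sets_bind[where N=borel]) (simp_all add: N_def)
    fix \<Gamma> assume "\<Gamma> \<in> sets (distr D borel (\<lambda>\<omega>. \<omega> (\<tau> \<omega> + s)))"
    then have \<Gamma>: "\<Gamma> \<in> sets borel" by simp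
    have N\<Gamma>: "emeasure (N y) \<Gamma> = emeasure (P y) {\<omega>'\<in>paths. \<omega>' s \<in> \<Gamma>}" for y
      unfolding N_def emeasure_distr[OF evs \<Gamma>] by (rule arg_cong[where f="emeasure (P y)"]) auto
    have pre: "(\<lambda>\<omega>. \<omega> (\<tau> \<omega> + s)) -` \<Gamma> \<inter> paths \<in> sets (P z)"
      using measurable_sets[OF ev \<Gamma>] by simp
    have "emeasure (distr D borel (\<lambda>\<omega>. \<omega> (\<tau> \<omega> + s))) \<Gamma>
        = emeasure (P z) (A \<inter> ((\<lambda>\<omega>. \<omega> (\<tau> \<omega> + s)) -` \<Gamma> \<inter> paths))"
      unfolding emeasure_distr[OF evD \<Gamma>] spaceD unfolding D_def
      using nn_integral_indicator[OF sets.Int[OF A pre]] A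
      by (subst emeasure_density[OF _ pre]) (simp_all only: indicator_inter_arith borel_measurable_indicator)
    also have "A \<inter> ((\<lambda>\<omega>. \<omega> (\<tau> \<omega> + s)) -` \<Gamma> \<inter> paths)
        = {\<omega>\<in>A. ereal (\<tau> \<omega>) < \<infinity> \<and> \<omega> (real_of_ereal (ereal (\<tau> \<omega>)) + s) \<in> \<Gamma>}"
      using past_event_subset[OF pe] by auto
    also have "emeasure (P z) \<dots> = (\<integral>\<^sup>+ \<omega>\<in>{\<omega>\<in>A. ereal (\<tau> \<omega>) < \<infinity>}.
            emeasure (P (\<omega> (real_of_ereal (ereal (\<tau> \<omega>))))) {\<omega>'\<in>paths. \<omega>' s \<in> \<Gamma>} \<partial>P z)"
    proof -
      have "markov_time path_filt paths (\<lambda>\<omega>. ereal (\<tau> \<omega>))" "A \<in> sets path_space"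
        "\<forall>t\<ge>0. {\<omega> \<in> A. ereal (\<tau> \<omega>) \<le> ereal t} \<in> sets (path_filt t)"
        using pe by (simp_all add: markov_time_def past_event_def)
      then show ?thesis using sm s \<Gamma> unfolding strong_markov_def by blast
    qed
    also have "\<dots> = (\<integral>\<^sup>+\<omega>. emeasure (N (\<omega> (\<tau> \<omega>))) \<Gamma> \<partial>D)"
      using measurable_compose[OF ND measurable_emeasure_subprob_algebra[OF \<Gamma>]] by (simp add: int_D N\<Gamma>)
    also have "\<dots> = emeasure (D \<bind> (\<lambda>\<omega>. N (\<omega> (\<tau> \<omega>)))) \<Gamma>"
      by (rule emeasure_bind[OF spD ND' \<Gamma>, symmetric])
    finally show "emeasure (distr D borel (\<lambda>\<omega>. \<omega> (\<tau> \<omega> + s))) \<Gamma> = emeasure (D \<bind> (\<lambda>\<omega>. N (\<omega> (\<tau> \<omega>)))) \<Gamma>" .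
  qed
  moreover have "\<phi> \<in> borel_measurable (distr D borel (\<lambda>\<omega>. \<omega> (\<tau> \<omega> + s)))" using \<phi> by simp
  ultimately have "(\<integral>\<^sup>+\<omega>. \<phi> (\<omega> (\<tau> \<omega> + s)) \<partial>D) = (\<integral>\<^sup>+\<omega>. (\<integral>\<^sup>+y. \<phi> y \<partial>N (\<omega> (\<tau> \<omega>))) \<partial>D)"
    using nn_integral_distr[OF evD, of \<phi>] nn_integral_bind[OF \<phi> ND'] by simp
  moreover have "(\<integral>\<^sup>+y. \<phi> y \<partial>N x) = (\<integral>\<^sup>+\<omega>'. \<phi> (\<omega>' s) \<partial>P x)" for x
    unfolding N_def using \<phi> by (intro nn_integral_distr[OF evs]) simp
  ultimately show ?thesis
    using int_D[OF measurable_compose[OF ev \<phi>]]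
      int_D[OF measurable_compose[OF ND nn_integral_measurable_subprob_algebra[OF \<phi>]]] by simp
qed

text \<open>Finite-dimensional events of the future: the earliest observation time is split off, which
  turns the remaining ones into observations after a later Markov time.\<close>

lemma strong_markov_finite_dim:
  assumes "finite I" "\<And>s. s \<in> I \<Longrightarrow> c \<le> s" "past_event \<tau> A" "\<And>s. \<Gamma> s \<in> sets borel"
  shows "emeasure (P z) {\<omega>\<in>A. \<forall>s\<in>I. \<omega> (\<tau> \<omega> + (s - c)) \<in> \<Gamma> s} =
    (\<integral>\<^sup>+\<omega>\<in>A. emeasure (P (\<omega> (\<tau> \<omega>))) {\<omega>'\<in>paths. \<forall>s\<in>I. \<omega>' (s - c) \<in> \<Gamma> s} \<partial>P z)"
  using assms
proof (induction I arbitrary: c \<tau> A z rule: finite_linorder_min_induct)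
  case (empty c \<tau> A z)
  have "emeasure (P y) paths = 1" for y
    using prob_space.emeasure_space_1[OF prob_space_kernel[of y]] by simp
  moreover have "A \<in> sets (P z)" using empty by (simp add: past_event_def)
  ultimately show ?case by simp
next
  case (insert b I c \<tau> A z)
  define q where "q y = emeasure (P y) {\<omega>'\<in>paths. \<forall>s\<in>I. \<omega>' (s - b) \<in> \<Gamma> s}" for y
  have bc: "0 \<le> b - c" using insert.prems(1)[of b] by simp
  have bI: "b \<le> s" if "s \<in> I" for s using insert.hyps that by auto
  note \<Gamma> = insert.prems(3)
  have [measurable]: "q \<in> borel_measurable borel"
  proof -
    have "{\<omega>'\<in>paths. \<forall>s\<in>I. \<omega>' (s - b) \<in> \<Gamma> s} \<in> sets (path_space :: 'd path measure)"
      by (rule finite_dim_event) (use insert.hyps(1) bI \<Gamma> in auto)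
    then show ?thesis unfolding q_def by (rule measurable_kernel_emeasure)
  qed
  define \<phi> where "\<phi> y = indicator (\<Gamma> b) y * q y" for y
  have [measurable]: "\<Gamma> b \<in> sets borel" by (rule \<Gamma>)
  have \<phi>m: "\<phi> \<in> borel_measurable borel" unfolding \<phi>_def by measurable
  have step: "emeasure (P y) {\<omega>\<in>A'. \<forall>s\<in>insert b I. \<omega> (\<tau>' \<omega> + (s - c)) \<in> \<Gamma> s}
      = (\<integral>\<^sup>+\<omega>\<in>A'. \<phi> (\<omega> (\<tau>' \<omega> + (b - c))) \<partial>P y)" if pe: "past_event \<tau>' A'" for y \<tau>' A'
  proof -
    have "emeasure (P y) {\<omega>\<in>{\<omega>\<in>A'. \<omega> (\<tau>' \<omega> + (b - c)) \<in> \<Gamma> b}. \<forall>s\<in>I. \<omega> (\<tau>' \<omega> + (b - c) + (s - b)) \<in> \<Gamma> s}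
        = (\<integral>\<^sup>+\<omega>\<in>{\<omega>\<in>A'. \<omega> (\<tau>' \<omega> + (b - c)) \<in> \<Gamma> b}. q (\<omega> (\<tau>' \<omega> + (b - c))) \<partial>P y)"
      unfolding q_def
      by (rule insert.IH[OF _ _ \<Gamma>]) (use bI past_event_step[OF pe bc \<Gamma>] in auto)
    also have "\<dots> = (\<integral>\<^sup>+\<omega>\<in>A'. \<phi> (\<omega> (\<tau>' \<omega> + (b - c))) \<partial>P y)"
      by (rule nn_integral_cong) (auto simp: \<phi>_def indicator_def)
    also have "{\<omega>\<in>{\<omega>\<in>A'. \<omega> (\<tau>' \<omega> + (b - c)) \<in> \<Gamma> b}. \<forall>s\<in>I. \<omega> (\<tau>' \<omega> + (b - c) + (s - b)) \<in> \<Gamma> s}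
        = {\<omega>\<in>A'. \<forall>s\<in>insert b I. \<omega> (\<tau>' \<omega> + (s - c)) \<in> \<Gamma> s}" by (auto simp: algebra_simps)
    finally show ?thesis .
  qed
  have inner: "(\<integral>\<^sup>+\<omega>'. \<phi> (\<omega>' (b - c)) \<partial>P y)
      = emeasure (P y) {\<omega>'\<in>paths. \<forall>s\<in>insert b I. \<omega>' (s - c) \<in> \<Gamma> s}" for y
  proof -
    have "past_event (\<lambda>_. 0) (paths :: 'd path set)"
      by (rule past_event_const) (use sets.top[of "path_filt 0 :: 'd path measure"] in auto)
    from step[OF this, of y] have "emeasure (P y) {\<omega>'\<in>paths. \<forall>s\<in>insert b I. \<omega>' (s - c) \<in> \<Gamma> s}
        = (\<integral>\<^sup>+\<omega>'\<in>paths. \<phi> (\<omega>' (b - c)) \<partial>P y)" by simp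
    also have "\<dots> = (\<integral>\<^sup>+\<omega>'. \<phi> (\<omega>' (b - c)) \<partial>P y)"
      by (rule nn_integral_cong) simp
    finally show ?thesis by simp
  qed
  show ?case
    unfolding step[OF insert.prems(2)] strong_markov_one_time[OF insert.prems(2) bc \<phi>m] inner ..
qed

text \<open>The two measures agree on the finite-dimensional events, which are stable under intersections and
  generate the path space.\<close>

lemma strong_markov_law:
  assumes pe: "past_event \<tau> paths"
  shows "distr (P z) path_space (\<lambda>\<omega>. path_shift (\<tau> \<omega>) \<omega>) = P z \<bind> (\<lambda>\<omega>. P (\<omega> (\<tau> \<omega>)))"
proof (rule measure_eqI_generator_eq)
  define E where "E = {{\<omega>\<in>paths. \<forall>s\<in>I. \<omega> s \<in> \<Gamma> s} | I (\<Gamma> :: real \<Rightarrow> 'd pt set).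
     finite I \<and> I \<subseteq> {0..} \<and> (\<forall>s. \<Gamma> s \<in> sets borel)}"
  note pos = past_event_pos[OF pe]
  have nonempty: "space (P z) \<noteq> {}" by (rule prob_space.not_empty[OF prob_space_kernel])
  have ev0: "(\<lambda>\<omega>. \<omega> (\<tau> \<omega>)) \<in> path_space \<rightarrow>\<^sub>M (borel :: 'd pt measure)"
    using measurable_at_past_event[OF pe order_refl] by simp
  have N: "(\<lambda>\<omega>. P (\<omega> (\<tau> \<omega>))) \<in> P z \<rightarrow>\<^sub>M subprob_algebra path_space"
    using measurable_compose[OF ev0 kernel_subprob] by (simp cong: measurable_cong_sets)
  have S: "(\<lambda>\<omega>. path_shift (\<tau> \<omega>) \<omega>) \<in> P z \<rightarrow>\<^sub>M path_space"
    using measurable_path_shift[OF past_event_measurable[OF pe]] pos by (simp cong: measurable_cong_sets)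
  have E: "E \<subseteq> sets path_space"
  proof
    fix X assume "X \<in> E"
    then obtain I and \<Gamma> :: "real \<Rightarrow> 'd pt set" where X: "X = {\<omega>\<in>paths. \<forall>s\<in>I. \<omega> s \<in> \<Gamma> s}"
      "finite I" "I \<subseteq> {0..}" "\<forall>s. \<Gamma> s \<in> sets borel" by (auto simp: E_def)
    show "X \<in> sets path_space"
      unfolding X(1) by (rule finite_dim_event) (use X in auto)
  qed
  show "Int_stable E"
  proof (rule Int_stableI)
    fix X Y assume "X \<in> E" "Y \<in> E"
    then obtain I J and \<Gamma> \<Delta> :: "real \<Rightarrow> 'd pt set"
      where X: "X = {\<omega>\<in>paths. \<forall>s\<in>I. \<omega> s \<in> \<Gamma> s}" "finite I" "I \<subseteq> {0..}" "\<forall>s. \<Gamma> s \<in> sets borel"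
      and Y: "Y = {\<omega>\<in>paths. \<forall>s\<in>J. \<omega> s \<in> \<Delta> s}" "finite J" "J \<subseteq> {0..}" "\<forall>s. \<Delta> s \<in> sets borel"
      unfolding E_def by blast
    (* a time that belongs to one of the two sets only is not constrained by the other *)
    have "X \<inter> Y = {\<omega>\<in>paths. \<forall>s\<in>I \<union> J. \<omega> s \<in> (if s \<in> I then \<Gamma> s else UNIV) \<inter> (if s \<in> J then \<Delta> s else UNIV)}"
      unfolding X Y by auto
    moreover have "finite (I \<union> J)" using X Y by simp
    moreover have "I \<union> J \<subseteq> {0..}" using X Y by simp
    moreover have "\<forall>s. (if s \<in> I then \<Gamma> s else UNIV) \<inter> (if s \<in> J then \<Delta> s else UNIV) \<in> sets borel"
      using X Y by auto
    ultimately show "X \<inter> Y \<in> E"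
      unfolding E_def
      by (intro CollectI exI[of _ "I \<union> J"]
          exI[of _ "\<lambda>s. (if s \<in> I then \<Gamma> s else UNIV) \<inter> (if s \<in> J then \<Delta> s else UNIV)"] conjI)
  qed
  show "E \<subseteq> Pow paths" by (auto simp: E_def)
  have gen: "sets path_space = sigma_sets paths E"
  proof (rule antisym)
    show "sets path_space \<subseteq> sigma_sets paths E"
      unfolding sets_path_space
    proof (rule sigma_sets_mono', safe)
      fix s :: real and B :: "'d pt set" assume "0 \<le> s" "B \<in> sets borel"
      then show "(\<lambda>\<omega>. \<omega> s) -` B \<inter> paths \<in> E"
        unfolding E_def by (intro CollectI exI[of _ "{s}"] exI[of _ "\<lambda>_. B"]) auto
    qed
    show "sigma_sets paths E \<subseteq> sets path_space"
      using sets.sigma_sets_subset[OF E] by simp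
  qed
  show "sets (distr (P z) path_space (\<lambda>\<omega>. path_shift (\<tau> \<omega>) \<omega>)) = sigma_sets paths E"
    by (simp add: gen)
  show "sets (P z \<bind> (\<lambda>\<omega>. P (\<omega> (\<tau> \<omega>)))) = sigma_sets paths E"
    using sets_bind[OF sets_kernel nonempty] by (simp add: gen)
  show "range (\<lambda>_::nat. paths) \<subseteq> E"
    unfolding E_def by (auto intro!: exI[of _ "{}"] exI[of _ "\<lambda>_. UNIV"])
  show "(\<Union>i::nat. paths) = (paths :: 'd path set)" by simp
  show "emeasure (distr (P z) path_space (\<lambda>\<omega>. path_shift (\<tau> \<omega>) \<omega>)) paths \<noteq> \<infinity>"
  proof -
    interpret prob_space "distr (P z) path_space (\<lambda>\<omega>. path_shift (\<tau> \<omega>) \<omega>)"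
      by (rule prob_space.prob_space_distr[OF prob_space_kernel S])
    show ?thesis by simp
  qed
  fix X assume "X \<in> E"
  then obtain I and \<Gamma> :: "real \<Rightarrow> 'd pt set" where X: "X = {\<omega>\<in>paths. \<forall>s\<in>I. \<omega> s \<in> \<Gamma> s}"
    "finite I" "I \<subseteq> {0..}" "\<forall>s. \<Gamma> s \<in> sets borel" by (auto simp: E_def)
  have Xm: "X \<in> sets path_space" using E \<open>X \<in> E\<close> by auto
  have mem: "path_shift (\<tau> \<omega>) \<omega> \<in> X \<longleftrightarrow> (\<forall>s\<in>I. \<omega> (\<tau> \<omega> + (s - 0)) \<in> \<Gamma> s)"
    if w: "\<omega> \<in> paths" for \<omega>
  proof -
    have "path_shift (\<tau> \<omega>) \<omega> s = \<omega> (\<tau> \<omega> + (s - 0))" if "s \<in> I" for s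
      using X(3) that by auto
    then show ?thesis using path_shift_in_paths[OF w pos[OF w]] by (simp add: X(1))
  qed
  have "emeasure (distr (P z) path_space (\<lambda>\<omega>. path_shift (\<tau> \<omega>) \<omega>)) X
      = emeasure (P z) {\<omega>\<in>paths. \<forall>s\<in>I. \<omega> (\<tau> \<omega> + (s - 0)) \<in> \<Gamma> s}"
    unfolding emeasure_distr[OF S Xm]
    by (rule arg_cong[where f="emeasure (P z)"]) (use mem in auto)
  also have "\<dots> = (\<integral>\<^sup>+\<omega>\<in>paths. emeasure (P (\<omega> (\<tau> \<omega>))) {\<omega>'\<in>paths. \<forall>s\<in>I. \<omega>' (s - 0) \<in> \<Gamma> s} \<partial>P z)"
  proof (rule strong_markov_finite_dim[OF X(2) _ pe])
    show "0 \<le> s" if "s \<in> I" for s using X(3) that by auto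
    show "\<Gamma> s \<in> sets borel" for s using X(4) by blast
  qed
  also have "\<dots> = (\<integral>\<^sup>+\<omega>. emeasure (P (\<omega> (\<tau> \<omega>))) X \<partial>P z)"
    by (rule nn_integral_cong) (simp add: X(1))
  also have "\<dots> = emeasure (P z \<bind> (\<lambda>\<omega>. P (\<omega> (\<tau> \<omega>)))) X"
    by (rule emeasure_bind[OF nonempty N Xm, symmetric])
  finally show "emeasure (distr (P z) path_space (\<lambda>\<omega>. path_shift (\<tau> \<omega>) \<omega>)) X
      = emeasure (P z \<bind> (\<lambda>\<omega>. P (\<omega> (\<tau> \<omega>)))) X" .
qed

lemma strong_markov_nn_integral:
  assumes pe: "past_event \<tau> paths" and \<Phi>: "\<Phi> \<in> borel_measurable path_space"
  shows "(\<integral>\<^sup>+\<omega>. \<Phi> (path_shift (\<tau> \<omega>) \<omega>) \<partial>P z) = (\<integral>\<^sup>+\<omega>. (\<integral>\<^sup>+\<omega>'. \<Phi> \<omega>' \<partial>P (\<omega> (\<tau> \<omega>))) \<partial>P z)"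
proof -
  have S: "(\<lambda>\<omega>. path_shift (\<tau> \<omega>) \<omega>) \<in> P z \<rightarrow>\<^sub>M path_space"
    using measurable_path_shift[OF past_event_measurable[OF pe]] past_event_pos[OF pe]
    by (simp cong: measurable_cong_sets)
  have N: "(\<lambda>\<omega>. P (\<omega> (\<tau> \<omega>))) \<in> P z \<rightarrow>\<^sub>M subprob_algebra path_space"
    using measurable_compose[OF measurable_at_past_event[OF pe order_refl] kernel_subprob]
    by (simp cong: measurable_cong_sets)
  have "\<Phi> \<in> borel_measurable (distr (P z) path_space (\<lambda>\<omega>. path_shift (\<tau> \<omega>) \<omega>))"
    using \<Phi> by simp
  from nn_integral_distr[OF S this] show ?thesis
    using nn_integral_bind[OF \<Phi> N] strong_markov_law[OF pe, of z] by simp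
qed

lemma strong_markov_integral:
  fixes \<Phi> :: "'d path \<Rightarrow> real"
  assumes pe: "past_event \<tau> paths" and \<Phi>: "\<Phi> \<in> borel_measurable path_space"
    and b: "\<And>\<omega>. \<bar>\<Phi> \<omega>\<bar> \<le> K"
  shows "(\<integral>\<omega>. \<Phi> (path_shift (\<tau> \<omega>) \<omega>) \<partial>P z) = (\<integral>\<omega>. (\<integral>\<omega>'. \<Phi> \<omega>' \<partial>P (\<omega> (\<tau> \<omega>))) \<partial>P z)"
proof -
  have S: "(\<lambda>\<omega>. path_shift (\<tau> \<omega>) \<omega>) \<in> P z \<rightarrow>\<^sub>M path_space"
    using measurable_path_shift[OF past_event_measurable[OF pe]] past_event_pos[OF pe]
    by (simp cong: measurable_cong_sets)
  have N: "(\<lambda>\<omega>. P (\<omega> (\<tau> \<omega>))) \<in> P z \<rightarrow>\<^sub>M subprob_algebra path_space"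
    using measurable_compose[OF measurable_at_past_event[OF pe order_refl] kernel_subprob]
    by (simp cong: measurable_cong_sets)
  have fin: "finite_measure (P y)" for y
    using prob_space_kernel[of y] by (simp add: prob_space.finite_measure)
  show ?thesis
    unfolding integral_distr[OF S \<Phi>, symmetric] strong_markov_law[OF pe]
    by (rule integral_bind[OF \<Phi> _ N, where B=K and B'=1])
      (use b fin prob_space.emeasure_space_1[OF prob_space_kernel] in auto)
qed

end

section \<open>Occupation and exit functionals of a cylinder\<close>

text \<open>The integral of \<open>F\<close> along the path up to its exit from \<open>C\<close>, its expectation, and the expectation
  of a function at the exit point.  In these the clock is the time coordinate of the path itself, so
  that they are functions of the path alone and can be composed with \<^const>\<open>path_shift\<close>.\<close>

definition occupation :: "'d::finite pt set \<Rightarrow> ('d pt \<Rightarrow> ennreal) \<Rightarrow> 'd path \<Rightarrow> ennreal" where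
  "occupation C F \<omega> = (\<integral>\<^sup>+s. indicator {0..<exit_real C \<omega>} s * F (\<omega> s) \<partial>lborel)"

definition green_op ::
  "('d::finite pt \<Rightarrow> 'd path measure) \<Rightarrow> 'd pt set \<Rightarrow> ('d pt \<Rightarrow> ennreal) \<Rightarrow> 'd pt \<Rightarrow> ennreal" where
  "green_op P C F z = (\<integral>\<^sup>+\<omega>. occupation C F \<omega> \<partial>P z)"

definition exit_op ::
  "('d::finite pt \<Rightarrow> 'd path measure) \<Rightarrow> 'd pt set \<Rightarrow> ('d pt \<Rightarrow> real) \<Rightarrow> 'd pt \<Rightarrow> real" where
  "exit_op P C g z = (\<integral>\<omega>. g (\<omega> (exit_real C \<omega>)) \<partial>P z)"

lemma cyl2_borel [measurable]: "cyl2 T R z \<in> sets borel"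
  unfolding cyl2_def by (auto intro!: borel_Times)

lemma exit_real_nonneg: "\<omega> \<in> paths \<Longrightarrow> 0 < T \<Longrightarrow> 0 \<le> exit_real (cyl2 T R z) \<omega>"
  using exits_cyl2(1)[of \<omega> T R z] by (simp add: exits_at_def)

lemma past_event_exit:
  assumes "0 < T" shows "past_event (exit_real (cyl2 T R z)) (paths :: 'd::finite path set)"
  unfolding past_event_def
  using exit_real_markov[OF assms, of _ R z] exit_real_nonneg[OF _ assms, of _ R z]
    sets.top[of "path_space :: 'd path measure"]
  by (auto simp del: split_paired_All)

lemma measurable_exit_point:
  assumes "0 < T"
  shows "(\<lambda>\<omega>. \<omega> (exit_real (cyl2 T R z) \<omega>)) \<in> path_space \<rightarrow>\<^sub>M (borel :: 'd::finite pt measure)"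
  by (rule measurable_eval_at) (use measurable_exit_real[OF assms, of R z] exit_real_nonneg[OF _ assms, of _ R z] in auto)

lemma measurable_occupation:
  fixes F :: "'d::finite pt \<Rightarrow> ennreal"
  assumes T: "0 < T" and F: "F \<in> borel_measurable borel"
  shows "occupation (cyl2 T R z) F \<in> borel_measurable path_space"
proof -
  note [measurable] = measurable_exit_real[OF T, of R z] F
  have "(\<lambda>x. fst x (max 0 (snd x))) \<in> (path_space :: 'd path measure) \<Otimes>\<^sub>M borel \<rightarrow>\<^sub>M borel"
    by (rule measurable_eval_at) auto
  then have [measurable]: "(\<lambda>x. fst x (max 0 (snd x))) \<in> (path_space :: 'd path measure) \<Otimes>\<^sub>M lborel \<rightarrow>\<^sub>M borel"
    by (simp cong: measurable_cong_sets)
  have "(\<lambda>\<omega>. \<integral>\<^sup>+s. indicator {x. 0 \<le> snd x \<and> snd x < exit_real (cyl2 T R z) (fst x)} (\<omega>, s) *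
      F (fst (\<omega>, s) (max 0 (snd (\<omega>, s)))) \<partial>lborel) \<in> borel_measurable (path_space :: 'd path measure)"
    by (rule sigma_finite_measure.borel_measurable_nn_integral[OF sigma_finite_lborel]) measurable
  also have "(\<lambda>\<omega>. \<integral>\<^sup>+s. indicator {x. 0 \<le> snd x \<and> snd x < exit_real (cyl2 T R z) (fst x)} (\<omega>, s) *
      F (fst (\<omega>, s) (max 0 (snd (\<omega>, s)))) \<partial>lborel) = occupation (cyl2 T R z) F"
    unfolding occupation_def by (intro ext nn_integral_cong) (auto simp: indicator_def max_def)
  finally show ?thesis .
qed

text \<open>A path first spends its time in the smaller cylinder and then restarts, from its exit point,
  its way out of the larger one.\<close>

lemma exit_real_split:
  assumes w: "\<omega> \<in> paths" and T: "0 < T" "0 < T'" and sub: "cyl2 T' R' z' \<subseteq> cyl2 T R z"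
  shows "exit_real (cyl2 T R z) \<omega> = exit_real (cyl2 T' R' z') \<omega>
    + exit_real (cyl2 T R z) (path_shift (exit_real (cyl2 T' R' z') \<omega>) \<omega>)"
  by (rule exit_real_eq, rule exits_at_shift[OF sub exits_cyl2(1)[OF w T(2)]])
    (rule exits_cyl2(1)[OF path_shift_in_paths[OF w exit_real_nonneg[OF w T(2)]] T(1)])

lemma occupation_split:
  fixes F :: "'d::finite pt \<Rightarrow> ennreal"
  assumes w: "\<omega> \<in> paths" and T: "0 < T" "0 < T'" and sub: "cyl2 T' R' z' \<subseteq> cyl2 T R z"
    and F [measurable]: "F \<in> borel_measurable borel"
  shows "occupation (cyl2 T R z) F \<omega> = occupation (cyl2 T' R' z') F \<omega>
    + occupation (cyl2 T R z) F (path_shift (exit_real (cyl2 T' R' z') \<omega>) \<omega>)"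
proof -
  let ?C = "cyl2 T R z" and ?C' = "cyl2 T' R' z'"
  define a where "a = exit_real ?C' \<omega>"
  define \<omega>' where "\<omega>' = path_shift a \<omega>"
  define c where "c = exit_real ?C \<omega>'"
  have a0: "0 \<le> a" unfolding a_def by (rule exit_real_nonneg[OF w T(2)])
  have w': "\<omega>' \<in> paths" unfolding \<omega>'_def by (rule path_shift_in_paths[OF w a0])
  have c0: "0 \<le> c" unfolding c_def by (rule exit_real_nonneg[OF w' T(1)])
  have e: "exit_real ?C \<omega> = a + c"
    unfolding a_def c_def \<omega>'_def by (rule exit_real_split[OF w T sub])
  have ev: "(\<lambda>s. \<omega> (max 0 s)) \<in> borel_measurable borel"
    by (intro borel_measurable_continuous_onI continuous_on_compose2[OF pathsD(1)[OF w]])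
      (auto intro!: continuous_intros)
  have m: "(\<lambda>s. F (\<omega> (max 0 s))) \<in> borel_measurable borel"
    by (rule measurable_compose[OF ev F])
  have "occupation ?C F \<omega> = (\<integral>\<^sup>+s. indicator {0..<a} s * F (\<omega> (max 0 s))
      + indicator {a..<a + c} s * F (\<omega> (max 0 s)) \<partial>lborel)"
    unfolding occupation_def e using a0 c0
    by (intro nn_integral_cong) (auto simp: indicator_def)
  also have "\<dots> = (\<integral>\<^sup>+s. indicator {0..<a} s * F (\<omega> (max 0 s)) \<partial>lborel)
      + (\<integral>\<^sup>+s. indicator {a..<a + c} s * F (\<omega> (max 0 s)) \<partial>lborel)"
    using m by (intro nn_integral_add) auto
  also have "(\<integral>\<^sup>+s. indicator {0..<a} s * F (\<omega> (max 0 s)) \<partial>lborel) = occupation ?C' F \<omega>"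
    unfolding occupation_def a_def[symmetric]
    by (intro nn_integral_cong) (auto simp: indicator_def)
  also have "(\<integral>\<^sup>+s. indicator {a..<a + c} s * F (\<omega> (max 0 s)) \<partial>lborel)
      = (\<integral>\<^sup>+s. indicator {a..<a + c} s * F (\<omega> (max 0 s)) \<partial>distr lborel borel ((+) a))"
    by (simp only: lborel_distr_plus)
  also have "\<dots> = (\<integral>\<^sup>+s. indicator {a..<a + c} (a + s) * F (\<omega> (max 0 (a + s))) \<partial>lborel)"
    using m by (intro nn_integral_distr) auto
  also have "\<dots> = occupation ?C F \<omega>'"
    unfolding occupation_def c_def[symmetric] using a0
    by (intro nn_integral_cong) (auto simp: indicator_def \<omega>'_def)
  finally show ?thesis unfolding \<omega>'_def a_def .
qed

context
  fixes P :: "'d::finite pt \<Rightarrow> 'd path measure"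
  assumes sm: "strong_markov path_filt P"
begin

lemmas kernel = sets_kernel[OF sm] space_kernel[OF sm]

lemma measurable_kernel_iff: "f \<in> P z \<rightarrow>\<^sub>M N \<longleftrightarrow> f \<in> path_space \<rightarrow>\<^sub>M N"
  by (simp add: measurable_cong_sets[OF sets_kernel[OF sm] refl])

lemma measurable_green_op:
  "0 < T \<Longrightarrow> F \<in> borel_measurable borel \<Longrightarrow> green_op P (cyl2 T R z) F \<in> borel_measurable borel"
  unfolding green_op_def
  by (rule measurable_kernel_nn_integral[OF sm measurable_occupation])

lemma measurable_exit_op:
  fixes g :: "'d pt \<Rightarrow> real"
  assumes T: "0 < T" and g: "g \<in> borel_measurable borel"
  shows "exit_op P (cyl2 T R z) g \<in> borel_measurable borel"
  unfolding exit_op_def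
  by (rule measurable_compose[OF kernel_subprob[OF sm] integral_measurable_subprob_algebra])
    (rule measurable_compose[OF measurable_exit_point[OF T] g])

lemma exit_op_integrable:
  fixes g :: "'d pt \<Rightarrow> real"
  assumes T: "0 < T" and g: "g \<in> borel_measurable borel" and b: "\<And>y. \<bar>g y\<bar> \<le> K"
  shows "integrable (P y) (\<lambda>\<omega>. g (\<omega> (exit_real (cyl2 T R z) \<omega>)))"
proof -
  interpret prob_space "P y" by (rule prob_space_kernel[OF sm])
  have "(\<lambda>\<omega>. g (\<omega> (exit_real (cyl2 T R z) \<omega>))) \<in> borel_measurable (P y)"
    unfolding measurable_kernel_iff by (rule measurable_compose[OF measurable_exit_point[OF T] g])
  then show ?thesis by (rule integrable_const_bound[where B=K, rotated]) (simp add: b)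
qed

lemma AE_exit_point:
  assumes T: "0 < T" and y: "y \<in> closure (cyl2 T R z)"
  shows "AE \<omega> in P y. \<omega> (exit_real (cyl2 T R z) \<omega>) \<in> closure (cyl2 T R z)"
  using kernel_start[OF sm, of y] AE_space
proof eventually_elim
  case (elim \<omega>)
  then have w: "\<omega> \<in> paths" by (simp add: kernel)
  have "\<omega> 0 \<in> closure (cyl2 T R z)" using elim(1) y by simp
  then show ?case by (rule exit_point_in_closure[OF w exits_cyl2(1)[OF w T]])
qed

lemma exit_op_bound:
  fixes g :: "'d pt \<Rightarrow> real"
  assumes T: "0 < T" and y: "y \<in> closure (cyl2 T R z)"
    and g: "g \<in> borel_measurable borel" and b: "\<And>x. x \<in> closure (cyl2 T R z) \<Longrightarrow> \<bar>g x\<bar> \<le> K"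
  shows "\<bar>exit_op P (cyl2 T R z) g y\<bar> \<le> K"
proof -
  interpret prob_space "P y" by (rule prob_space_kernel[OF sm])
  have m: "(\<lambda>\<omega>. g (\<omega> (exit_real (cyl2 T R z) \<omega>))) \<in> borel_measurable (P y)"
    unfolding measurable_kernel_iff by (rule measurable_compose[OF measurable_exit_point[OF T] g])
  have AE: "AE \<omega> in P y. norm (g (\<omega> (exit_real (cyl2 T R z) \<omega>))) \<le> K"
    using AE_exit_point[OF T y] by eventually_elim (use b in auto)
  have "0 \<le> K" using b[OF y] by linarith
  have "norm (exit_op P (cyl2 T R z) g y) \<le> (\<integral>\<omega>. norm (g (\<omega> (exit_real (cyl2 T R z) \<omega>))) \<partial>P y)"
    unfolding exit_op_def by (rule integral_norm_bound)
  also have "\<dots> \<le> (\<integral>\<omega>. K \<partial>P y)"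
    using AE m \<open>0 \<le> K\<close> by (intro integral_mono_AE integrable_const_bound[where B=K]) auto
  finally show ?thesis by (simp add: prob_space)
qed

text \<open>From a point outside \<open>C\<close> the exit is immediate.  Hence the operators below are global functions,
  which equal \<open>0\<close> and the exit data, respectively, outside the cylinder.\<close>

lemma AE_exit_real_0:
  assumes T: "0 < T" and y: "y \<notin> cyl2 T R z"
  shows "AE \<omega> in P y. exit_real (cyl2 T R z) \<omega> = 0 \<and> \<omega> 0 = y"
  using kernel_start[OF sm, of y]
  by eventually_elim (use y in \<open>auto intro!: exit_real_eq simp: exits_at_def\<close>)

lemma exit_op_outside:
  assumes T: "0 < T" and y: "y \<notin> cyl2 T R z" and g: "g \<in> borel_measurable borel"
  shows "exit_op P (cyl2 T R z) g y = g y"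
proof -
  interpret prob_space "P y" by (rule prob_space_kernel[OF sm])
  have m: "(\<lambda>\<omega>. g (\<omega> (exit_real (cyl2 T R z) \<omega>))) \<in> borel_measurable (P y)"
    unfolding measurable_kernel_iff by (rule measurable_compose[OF measurable_exit_point[OF T] g])
  have "exit_op P (cyl2 T R z) g y = (\<integral>\<omega>. g y \<partial>P y)"
    unfolding exit_op_def
    by (rule integral_cong_AE) (use AE_exit_real_0[OF T y] m in \<open>auto elim: eventually_mono\<close>)
  then show ?thesis by (simp add: prob_space)
qed

lemma green_op_outside:
  assumes T: "0 < T" and y: "y \<notin> cyl2 T R z"
  shows "green_op P (cyl2 T R z) F y = 0"
proof -
  have "green_op P (cyl2 T R z) F y = (\<integral>\<^sup>+\<omega>. 0 \<partial>P y)"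
    unfolding green_op_def
    by (rule nn_integral_cong_AE)
      (use AE_exit_real_0[OF T y] in \<open>auto elim!: eventually_mono simp: occupation_def\<close>)
  then show ?thesis by simp
qed

text \<open>The exit point of the larger cylinder is the exit point of the path restarted when it leaves the
  smaller one, to which the strong Markov property applies.\<close>

lemma exit_op_tower:
  fixes g :: "'d pt \<Rightarrow> real"
  assumes T: "0 < T" "0 < T'" and sub: "cyl2 T' R' z' \<subseteq> cyl2 T R z"
    and g: "g \<in> borel_measurable borel" and b: "\<And>y. \<bar>g y\<bar> \<le> K"
  shows "exit_op P (cyl2 T R z) g y = exit_op P (cyl2 T' R' z') (exit_op P (cyl2 T R z) g) y"
proof -
  let ?C = "cyl2 T R z" and ?C' = "cyl2 T' R' z'"
  define \<Phi> where "\<Phi> \<omega> = g (\<omega> (exit_real ?C \<omega>))" for \<omega>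
  have m: "\<Phi> \<in> borel_measurable path_space"
    unfolding \<Phi>_def by (rule measurable_compose[OF measurable_exit_point[OF T(1)] g])
  have "\<Phi> (path_shift (exit_real ?C' \<omega>) \<omega>) = \<Phi> \<omega>" if w: "\<omega> \<in> paths" for \<omega>
  proof -
    have "0 \<le> exit_real ?C (path_shift (exit_real ?C' \<omega>) \<omega>)"
      by (intro exit_real_nonneg path_shift_in_paths w T)
    then show ?thesis unfolding \<Phi>_def exit_real_split[OF w T sub] by simp
  qed
  then have "exit_op P ?C g y = (\<integral>\<omega>. \<Phi> (path_shift (exit_real ?C' \<omega>) \<omega>) \<partial>P y)"
    unfolding exit_op_def \<Phi>_def[symmetric] by (intro Bochner_Integration.integral_cong) (auto simp: kernel)
  also have "\<dots> = (\<integral>\<omega>. (\<integral>\<omega>'. \<Phi> \<omega>' \<partial>P (\<omega> (exit_real ?C' \<omega>))) \<partial>P y)"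
    by (rule strong_markov_integral[OF sm past_event_exit[OF T(2)] m, where K=K]) (simp add: \<Phi>_def b)
  finally show ?thesis unfolding exit_op_def \<Phi>_def .
qed

lemma green_op_split:
  assumes T: "0 < T" "0 < T'" and sub: "cyl2 T' R' z' \<subseteq> cyl2 T R z"
    and F: "F \<in> borel_measurable borel"
  shows "green_op P (cyl2 T R z) F y = green_op P (cyl2 T' R' z') F y
    + (\<integral>\<^sup>+\<omega>. green_op P (cyl2 T R z) F (\<omega> (exit_real (cyl2 T' R' z') \<omega>)) \<partial>P y)"
proof -
  let ?C = "cyl2 T R z" and ?C' = "cyl2 T' R' z'"
  have s: "(\<lambda>\<omega>. path_shift (exit_real ?C' \<omega>) \<omega>) \<in> path_space \<rightarrow>\<^sub>M (path_space :: 'd path measure)"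
    by (rule measurable_path_shift[OF measurable_exit_real[OF T(2)]]) (rule exit_real_nonneg[OF _ T(2)])
  have "green_op P ?C F y = (\<integral>\<^sup>+\<omega>. occupation ?C' F \<omega> + occupation ?C F (path_shift (exit_real ?C' \<omega>) \<omega>) \<partial>P y)"
    unfolding green_op_def
    by (rule nn_integral_cong) (use occupation_split[OF _ T sub F] in \<open>auto simp: kernel\<close>)
  also have "\<dots> = green_op P ?C' F y + (\<integral>\<^sup>+\<omega>. occupation ?C F (path_shift (exit_real ?C' \<omega>) \<omega>) \<partial>P y)"
    unfolding green_op_def
    by (rule nn_integral_add)
      (use measurable_occupation[OF T(2) F] measurable_compose[OF s measurable_occupation[OF T(1) F]]
        in \<open>auto simp: measurable_kernel_iff\<close>)
  also have "(\<integral>\<^sup>+\<omega>. occupation ?C F (path_shift (exit_real ?C' \<omega>) \<omega>) \<partial>P y)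
      = (\<integral>\<^sup>+\<omega>. green_op P ?C F (\<omega> (exit_real ?C' \<omega>)) \<partial>P y)"
    unfolding green_op_def
    by (rule strong_markov_nn_integral[OF sm past_event_exit[OF T(2)] measurable_occupation[OF T(1) F]])
  finally show ?thesis .
qed

text \<open>The finite version.  It writes the continuation after the exit from the smaller cylinder as an
  exit operator, which later absorbs it into the exit data.\<close>

lemma green_op_split_real:
  assumes T: "0 < T" "0 < T'" and sub: "cyl2 T' R' z' \<subseteq> cyl2 T R z"
    and F: "F \<in> borel_measurable borel" and K: "\<And>y. green_op P (cyl2 T R z) F y \<le> ennreal K"
  shows "enn2real (green_op P (cyl2 T R z) F y) = enn2real (green_op P (cyl2 T' R' z') F y)
    + exit_op P (cyl2 T' R' z') (\<lambda>x. enn2real (green_op P (cyl2 T R z) F x)) y"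
proof -
  let ?C = "cyl2 T R z" and ?C' = "cyl2 T' R' z'"
  let ?V = "\<lambda>x. enn2real (green_op P ?C F x)"
  have fin: "green_op P ?C F x < \<infinity>" for x using K[of x] by (simp add: order_le_less_trans)
  have V: "green_op P ?C F x = ennreal (?V x)" for x using fin[of x] by (simp add: ennreal_enn2real)
  have Vb: "\<bar>?V x\<bar> \<le> max 0 K" for x
  proof -
    have "ennreal (?V x) \<le> ennreal (max 0 K)"
      using K[of x] unfolding V[symmetric] by (simp add: ennreal_max_0')
    then have "?V x \<le> max 0 K" by (subst (asm) ennreal_le_iff) auto
    then show ?thesis by simp
  qed
  have Vm: "?V \<in> borel_measurable borel"
    using measurable_green_op[OF T(1) F] by measurable
  have "(\<integral>\<^sup>+\<omega>. green_op P ?C F (\<omega> (exit_real ?C' \<omega>)) \<partial>P y)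
      = (\<integral>\<^sup>+\<omega>. ennreal (?V (\<omega> (exit_real ?C' \<omega>))) \<partial>P y)"
    by (rule nn_integral_cong) (rule V)
  also have "\<dots> = ennreal (exit_op P ?C' ?V y)"
    unfolding exit_op_def
    using nn_integral_eq_integral[OF exit_op_integrable[OF T(2) Vm Vb]] by simp
  finally have eq: "green_op P ?C F y = green_op P ?C' F y + ennreal (exit_op P ?C' ?V y)"
    using green_op_split[OF T sub F, of y] by simp
  then have "green_op P ?C' F y < \<infinity>" using fin[of y] by (simp add: less_top[symmetric])
  moreover have "0 \<le> exit_op P ?C' ?V y" unfolding exit_op_def by simp
  ultimately show ?thesis by (subst eq) (simp add: enn2real_plus)
qed

end

section \<open>Functionals of the process and of its completed laws\<close>

text \<open>An integrand that agrees with a measurable one almost everywhere is measurable for the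
  completion, whatever it is on the exceptional set.\<close>

lemma integral_completion_AE:
  fixes \<phi> \<psi> :: "'a \<Rightarrow> real"
  assumes \<phi>: "\<phi> \<in> borel_measurable M" and eq: "AE \<omega> in M. \<psi> \<omega> = \<phi> \<omega>"
  shows "(\<integral>\<omega>. \<psi> \<omega> \<partial>completion M) = (\<integral>\<omega>. \<phi> \<omega> \<partial>M)"
proof -
  have \<phi>': "\<phi> \<in> borel_measurable (completion M)" by (rule measurable_completion[OF \<phi>])
  have eq': "AE \<omega> in completion M. \<phi> \<omega> = \<psi> \<omega>"
    using AE_completion[OF eq] by eventually_elim simp
  have "\<psi> \<in> borel_measurable (completion M)"
  proof (rule measurableI)
    fix B :: "real set" assume "B \<in> sets borel"
    then have "\<phi> -` B \<inter> space (completion M) \<in> sets (completion M)"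
      by (rule measurable_sets[OF \<phi>'])
    moreover have "AE \<omega> in completion M. \<omega> \<in> \<phi> -` B \<inter> space (completion M) \<longleftrightarrow>
        \<omega> \<in> \<psi> -` B \<inter> space (completion M)"
      using eq' by eventually_elim auto
    ultimately show "\<psi> -` B \<inter> space (completion M) \<in> sets (completion M)"
      by (metis completion.in_sets_AE inf_le2)
  qed simp
  then have "(\<integral>\<omega>. \<psi> \<omega> \<partial>completion M) = (\<integral>\<omega>. \<phi> \<omega> \<partial>completion M)"
    using eq' \<phi>' by (intro integral_cong_AE) (auto elim: eventually_mono)
  then show ?thesis by (simp only: integral_completion[OF \<phi>])
qed

text \<open>Along paths that start at time \<open>t\<close> the clock \<open>t + r\<close> is the time coordinate of the path.\<close>

lemma path_exit_eq:
  assumes w: "\<omega> \<in> paths" and T: "0 < T" and t: "fst (\<omega> 0) = t"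
  shows "path_exit (cyl2 T R z) t \<omega> = ereal (exit_real (cyl2 T R z) \<omega>)"
    and "exit_point (cyl2 T R z) t \<omega> = \<omega> (exit_real (cyl2 T R z) \<omega>)"
proof -
  have pt: "(t + r, snd (\<omega> r)) = \<omega> r" if "0 \<le> r" for r
    using pathsD(2)[OF w that] t by (simp add: prod_eq_iff)
  have "path_exit (cyl2 T R z) t \<omega> = exit_time (cyl2 T R z) \<omega>"
    unfolding path_exit_def hit_time_def by (intro INF_cong) (auto simp: pt)
  then show e: "path_exit (cyl2 T R z) t \<omega> = ereal (exit_real (cyl2 T R z) \<omega>)"
    by (simp only: exit_time_eq[OF exits_cyl2(1)[OF w T]])
  show "exit_point (cyl2 T R z) t \<omega> = \<omega> (exit_real (cyl2 T R z) \<omega>)"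
    unfolding exit_point_def e using pt[OF exit_real_nonneg[OF w T]] by (simp add: Let_def)
qed

context
  fixes P :: "'d::finite pt \<Rightarrow> 'd path measure"
  assumes sm: "strong_markov path_filt P"
begin

lemma AE_start: "AE \<omega> in P y. \<omega> \<in> paths \<and> \<omega> 0 = y"
  using kernel_start[OF sm, of y] AE_space by eventually_elim (simp add: space_kernel[OF sm])

lemma expec_exit_point:
  assumes T: "0 < T" and y: "y \<in> closure (cyl2 T R z)"
    and v: "v' \<in> borel_measurable borel" "\<And>x. x \<in> closure (cyl2 T R z) \<Longrightarrow> v x = v' x"
  shows "expec P y (\<lambda>\<omega>. v (exit_point (cyl2 T R z) (fst y) \<omega>)) = exit_op P (cyl2 T R z) v' y"
  unfolding expec_def exit_op_def
proof (rule integral_completion_AE)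
  show "(\<lambda>\<omega>. v' (\<omega> (exit_real (cyl2 T R z) \<omega>))) \<in> borel_measurable (P y)"
    unfolding measurable_kernel_iff[OF sm] by (rule measurable_compose[OF measurable_exit_point[OF T] v(1)])
  show "AE \<omega> in P y. v (exit_point (cyl2 T R z) (fst y) \<omega>) = v' (\<omega> (exit_real (cyl2 T R z) \<omega>))"
    using AE_start[of y] AE_exit_point[OF sm T y]
    by eventually_elim (auto simp: path_exit_eq(2)[OF _ T] v(2))
qed

text \<open>Since \<^const>\<open>ennreal\<close> truncates at \<open>0\<close>, the two Green operators belong to the positive and the
  negative part of \<open>f\<close>.  Finiteness of both makes the time integral converge absolutely almost
  surely and gives its expectation.\<close>

lemma expec_occupation:
  fixes f f0 :: "'d pt \<Rightarrow> real"
  assumes T: "0 < T"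
    and f0: "f0 \<in> borel_measurable borel" "\<And>x. x \<in> cyl2 T R z \<Longrightarrow> f x = f0 x"
    and fin: "green_op P (cyl2 T R z) (\<lambda>x. ennreal (f0 x)) y < \<infinity>"
      "green_op P (cyl2 T R z) (\<lambda>x. ennreal (- f0 x)) y < \<infinity>"
  shows "expec P y (\<lambda>\<omega>. LINT s:{s. 0 \<le> s \<and> ereal s < path_exit (cyl2 T R z) (fst y) \<omega>}|lborel.
            f (fst y + s, snd (\<omega> s)))
    = enn2real (green_op P (cyl2 T R z) (\<lambda>x. ennreal (f0 x)) y)
      - enn2real (green_op P (cyl2 T R z) (\<lambda>x. ennreal (- f0 x)) y)"
proof -
  let ?C = "cyl2 T R z"
  let ?p = "occupation ?C (\<lambda>x. ennreal (f0 x))" and ?m = "occupation ?C (\<lambda>x. ennreal (- f0 x))"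
  have pm: "?p \<in> borel_measurable (P y)" "?m \<in> borel_measurable (P y)"
    unfolding measurable_kernel_iff[OF sm] using f0 by (auto intro!: measurable_occupation[OF T])
  have AEfin: "AE \<omega> in P y. ?p \<omega> \<noteq> \<infinity>" "AE \<omega> in P y. ?m \<omega> \<noteq> \<infinity>"
    using nn_integral_PInf_AE[OF pm(1)] nn_integral_PInf_AE[OF pm(2)] fin
    unfolding green_op_def by auto
  have real: "integrable (P y) (\<lambda>\<omega>. enn2real (k \<omega>)) \<and>
      (\<integral>\<omega>. enn2real (k \<omega>) \<partial>P y) = enn2real (\<integral>\<^sup>+\<omega>. k \<omega> \<partial>P y)"
    if k: "k \<in> borel_measurable (P y)" "AE \<omega> in P y. k \<omega> \<noteq> \<infinity>" "(\<integral>\<^sup>+\<omega>. k \<omega> \<partial>P y) < \<infinity>"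
    for k :: "'d path \<Rightarrow> ennreal"
  proof -
    have e: "(\<integral>\<^sup>+\<omega>. ennreal (enn2real (k \<omega>)) \<partial>P y) = (\<integral>\<^sup>+\<omega>. k \<omega> \<partial>P y)"
      by (rule nn_integral_cong_AE) (use k(2) in eventually_elim, auto simp: ennreal_enn2real_if)
    then show ?thesis using k
      by (auto intro!: integrableI_nonneg simp: integral_eq_nn_integral)
  qed
  have AE: "AE \<omega> in P y. (LINT s:{s. 0 \<le> s \<and> ereal s < path_exit ?C (fst y) \<omega>}|lborel.
      f (fst y + s, snd (\<omega> s))) = enn2real (?p \<omega>) - enn2real (?m \<omega>)"
    using AE_start[of y] AEfin
  proof eventually_elim
    case (elim \<omega>)
    then have w: "\<omega> \<in> paths" "\<omega> 0 = y" by auto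
    define e where "e = exit_real ?C \<omega>"
    define k where "k s = indicator {0..<e} s * f0 (\<omega> (max 0 s))" for s
    have ev: "(\<lambda>s. \<omega> (max 0 s)) \<in> borel_measurable borel"
      by (intro borel_measurable_continuous_onI continuous_on_compose2[OF pathsD(1)[OF w(1)]])
        (auto intro!: continuous_intros)
    have km: "k \<in> borel_measurable lborel"
      unfolding k_def using measurable_compose[OF ev f0(1)] by simp
    have kf: "indicator {s. 0 \<le> s \<and> ereal s < path_exit ?C (fst y) \<omega>} s *\<^sub>R f (fst y + s, snd (\<omega> s)) = k s" for s
    proof (cases "0 \<le> s \<and> s < e")
      case True
      then have "\<omega> s \<in> ?C" using exits_cyl2(1)[OF w(1) T, of R z] by (simp add: e_def exits_at_def)
      moreover have "(fst y + s, snd (\<omega> s)) = \<omega> s"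
        using True pathsD(2)[OF w(1), of s] w(2) by (simp add: prod_eq_iff)
      ultimately show ?thesis using True path_exit_eq(1)[OF w(1) T, of "fst y" R z] w(2)
        by (simp add: k_def e_def f0(2))
    next
      case False
      then show ?thesis using path_exit_eq(1)[OF w(1) T, of "fst y" R z] w(2)
        by (auto simp: k_def e_def indicator_def)
    qed
    have p: "(\<integral>\<^sup>+s. ennreal (k s) \<partial>lborel) = ?p \<omega>" and m: "(\<integral>\<^sup>+s. ennreal (- k s) \<partial>lborel) = ?m \<omega>"
      unfolding occupation_def k_def e_def by (auto intro!: nn_integral_cong simp: indicator_def)
    have "integrable lborel k" using km elim by (simp add: real_integrable_def p m)
    then have "(\<integral>s. k s \<partial>lborel) = enn2real (?p \<omega>) - enn2real (?m \<omega>)"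
      by (simp add: real_lebesgue_integral_def p m)
    then show ?case by (simp only: set_lebesgue_integral_def kf)
  qed
  have "expec P y (\<lambda>\<omega>. LINT s:{s. 0 \<le> s \<and> ereal s < path_exit ?C (fst y) \<omega>}|lborel.
            f (fst y + s, snd (\<omega> s))) = (\<integral>\<omega>. enn2real (?p \<omega>) - enn2real (?m \<omega>) \<partial>P y)"
    unfolding expec_def using pm by (intro integral_completion_AE AE) auto
  then show ?thesis
    using real[OF pm(1) AEfin(1)] real[OF pm(2) AEfin(2)] fin
    by (simp add: green_op_def)
qed

end

section \<open>The estimate of the time integral\<close>

lemma markov_diffusionD:
  assumes "markov_diffusion \<delta> p0 q0 h bb \<sigma> b P"
  shows "strong_markov path_filt P" "drift_bound p0 q0 h bb" "solves_sde \<sigma> b P"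
    "\<sigma> \<in> borel_measurable borel" "\<sigma> z \<in> S_delta \<delta>" "b \<in> borel_measurable borel" "norm (b z) \<le> h z"
    "markov path_filt_plus P"
  using assms unfolding markov_diffusion_def by blast+

lemma cyl_translate: "y + c \<in> cyl R (z + c) \<longleftrightarrow> y \<in> cyl R z"
  by (auto simp: cyl_def cyl2_def mem_Times_iff dist_norm algebra_simps)

lemma drift_bound_translate:
  fixes h :: "'d::finite pt \<Rightarrow> real"
  assumes h: "drift_bound p0 q0 h bb" and pq: "1 \<le> p0" "1 \<le> q0"
  shows "drift_bound p0 q0 (\<lambda>z. h (z + c)) bb"
proof -
  have [measurable]: "h \<in> borel_measurable borel" using h by (simp add: drift_bound_def)
  have m: "(\<lambda>z. h (z + c)) \<in> borel_measurable borel" by measurable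
  have "epow (Lpq_norm (ereal p0) (ereal q0) (cyl R z) (\<lambda>z. h (z + c))) q0 \<le> ennreal (bb R * R)"
    if "0 < R" for R z
  proof -
    have [measurable]: "cyl R z \<in> sets borel" by (simp add: cyl_def)
    have "Lpq_norm (ereal p0) (ereal q0) (cyl R z) (\<lambda>z. h (z + c))
        \<le> Lpq_norm (ereal p0) (ereal q0) (cyl R (z + c)) h"
      by (rule Lpq_norm_le_translate[where c=c])
        (use pq m in \<open>auto simp: cyl_translate indicator_def\<close>)
    then have "epow (Lpq_norm (ereal p0) (ereal q0) (cyl R z) (\<lambda>z. h (z + c))) q0
        \<le> epow (Lpq_norm (ereal p0) (ereal q0) (cyl R (z + c)) h) q0"
      by (rule epow_mono) (use pq in simp)
    also have "\<dots> \<le> ennreal (bb R * R)"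
      using h that by (cases "z + c") (auto simp: drift_bound_def)
    finally show ?thesis .
  qed
  then show ?thesis using h m unfolding drift_bound_def by blast
qed

context
  fixes P :: "'d::finite pt \<Rightarrow> 'd path measure"
  assumes sm: "strong_markov path_filt P"
begin

lemma completed_filt_gen: "sets (path_filt s) \<union> null_sets (completion (P z)) \<subseteq> Pow paths"
  using sets.space_closed[of "path_filt s :: 'd path measure"] sets.space_closed[of "completion (P z)"]
  by (auto simp: space_kernel[OF sm] null_sets_def)

lemma sets_completed_filt:
  "sets (completed_filt P z s) = sigma_sets paths (sets (path_filt s) \<union> null_sets (completion (P z)))"
  unfolding completed_filt_def by (rule sets_measure_of[OF completed_filt_gen])

lemma space_completed_filt': "space (completed_filt P z s) = paths"
  unfolding completed_filt_def by (rule space_measure_of[OF completed_filt_gen])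

lemma path_filt_le_completed: "sets (path_filt s) \<subseteq> sets (completed_filt P z s)"
  unfolding sets_completed_filt by auto

lemma completed_filt_le: "sets (completed_filt P z s) \<subseteq> sets (completion (P z))"
proof -
  have "sets (path_filt s) \<union> null_sets (completion (P z)) \<subseteq> sets (completion (P z))"
    using sets_path_filt_subset[of s] sets_kernel[OF sm, of z] by (auto simp: null_sets_def)
  from sets.sigma_sets_subset[OF this] show ?thesis
    unfolding sets_completed_filt by (simp add: space_kernel[OF sm])
qed

lemma filtered_completed:
  "filtered_complete_prob_space (completion (P z)) (completed_filt P z)"
proof -
  have "sets (completed_filt P z s) \<subseteq> sets (completed_filt P z t)" if "s \<le> t" for s t
    unfolding sets_completed_filt using sets_path_filt_mono[OF that] by (intro sigma_sets_mono') auto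
  moreover have "subalgebra (completion (P z)) (completed_filt P z t)" for t
    unfolding subalgebra_def using completed_filt_le by (simp add: space_completed_filt' space_kernel[OF sm])
  moreover have "null_sets (completion (P z)) \<subseteq> sets (completed_filt P z t)" for t
    unfolding sets_completed_filt by auto
  ultimately show ?thesis
    unfolding filtered_complete_prob_space_def
    using prob_space.prob_space_completion[OF prob_space_kernel[OF sm]]
      completion.complete_measure_axioms by auto
qed

lemma measurable_adapted_coefficient:
  fixes a :: "'d pt \<Rightarrow> 'b::topological_space"
  assumes a: "a \<in> borel \<rightarrow>\<^sub>M borel"
  shows "measurable_adapted (completion (P z)) (completed_filt P z) (\<lambda>r \<omega>. a (t + r, snd (\<omega> r)))"
proof -
  have "(\<lambda>y. snd (snd y)) \<in> (borel :: real measure) \<Otimes>\<^sub>M (borel :: 'd pt measure) \<rightarrow>\<^sub>M borel"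
    by (rule measurable_compose[OF measurable_snd])
      (intro borel_measurable_continuous_onI continuous_on_snd continuous_on_id)
  moreover have "(\<lambda>y. t + fst y) \<in> (borel :: real measure) \<Otimes>\<^sub>M (borel :: 'd pt measure) \<rightarrow>\<^sub>M borel"
    by simp
  ultimately have "(\<lambda>y. (t + fst y, snd (snd y)))
      \<in> (borel :: real measure) \<Otimes>\<^sub>M (borel :: 'd pt measure) \<rightarrow>\<^sub>M borel"
    by (intro borel_measurable_Pair)
  from measurable_compose[OF this a]
  have a': "(\<lambda>y. a (t + fst y, snd (snd y))) \<in> (borel :: real measure) \<Otimes>\<^sub>M (borel :: 'd pt measure) \<rightarrow>\<^sub>M borel"
    by simp
  have "(\<lambda>\<omega>. a (t + r, snd (\<omega> r))) \<in> borel_measurable (completed_filt P z r)" if r: "0 \<le> r" for r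
  proof -
    have "(\<lambda>\<omega>. \<omega> r) \<in> (path_filt r :: 'd path measure) \<rightarrow>\<^sub>M borel"
      by (rule measurable_eval_filt[OF r order_refl])
    then have "(\<lambda>\<omega>. \<omega> r) \<in> completed_filt P z r \<rightarrow>\<^sub>M borel"
      by (rule measurable_mono[THEN subsetD, rotated 4])
        (auto simp: space_completed_filt' path_filt_le_completed)
    from measurable_compose[OF measurable_Pair[OF measurable_const[of r] this] a']
    show ?thesis by simp
  qed
  moreover have "(\<lambda>(r, \<omega>). a (t + r, snd (\<omega> r)))
      \<in> borel_measurable (restrict_space borel {0..} \<Otimes>\<^sub>M completion (P z))"
  proof -
    let ?N = "restrict_space borel {0::real..} \<Otimes>\<^sub>M completion (P z)"
    have r: "fst \<in> ?N \<rightarrow>\<^sub>M borel"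
      by (rule measurable_compose[OF measurable_fst]) (rule measurable_restrict_space1, simp)
    have id: "(\<lambda>\<omega>. \<omega>) \<in> completion (P z) \<rightarrow>\<^sub>M path_space"
      by (rule measurable_completion) (simp add: measurable_kernel_iff[OF sm])
    have "(\<lambda>x. snd x (fst x)) \<in> ?N \<rightarrow>\<^sub>M borel"
      by (rule measurable_eval_at[OF measurable_compose[OF measurable_snd id] r])
        (auto simp: space_pair_measure space_restrict_space)
    from measurable_compose[OF measurable_Pair[OF r this] a']
    show ?thesis by (simp add: case_prod_beta)
  qed
  ultimately show ?thesis unfolding measurable_adapted_def by blast
qed

end

text \<open>Centered at its starting point, the Markov process is a diffusion-type process whose drift is
  dominated by a translate of \<open>h\<close>.\<close>

lemma diffusion_type_of_markov:
  fixes h :: "'d::finite pt \<Rightarrow> real"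
  assumes md: "markov_diffusion \<delta> p0 q0 h bb \<sigma> b P"
  shows "diffusion_type \<delta> (\<lambda>z. h (z + (t, x))) (completion (P (t, x))) (\<lambda>r \<omega>. snd (\<omega> r) - x)"
proof -
  note D = markov_diffusionD[OF md]
  let ?M = "completion (P (t, x))" and ?F = "completed_filt P (t, x)"
  obtain w J where w: "wiener ?M ?F w"
    and J: "ito_integral ?M ?F w (\<lambda>r \<omega>. \<sigma> (t + r, snd (\<omega> r))) J"
    and AE: "AE \<omega> in ?M. \<forall>s\<ge>0. fst (\<omega> s) = t + s \<and>
           set_integrable lborel {0..s} (\<lambda>r. b (t + r, snd (\<omega> r))) \<and>
           snd (\<omega> s) = x + J s \<omega> + (LINT r:{0..s}|lborel. b (t + r, snd (\<omega> r)))"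
    using D(3) unfolding solves_sde_def by blast
  have "AE \<omega> in ?M. \<forall>s\<ge>0. set_integrable lborel {0..s} (\<lambda>r. b (t + r, snd (\<omega> r))) \<and>
           snd (\<omega> s) - x = J s \<omega> + (LINT r:{0..s}|lborel. b (t + r, snd (\<omega> r)))"
    using AE by eventually_elim (auto simp: algebra_simps)
  moreover have "norm (b (t + r, snd (\<omega> r))) \<le> h ((r, snd (\<omega> r) - x) + (t, x))" for r \<omega>
    using D(7)[of "(t + r, snd (\<omega> r))"] by (simp add: add.commute)
  ultimately show ?thesis
    unfolding diffusion_type_def
    using filtered_completed[OF D(1)] w J D(5)
      measurable_adapted_coefficient[OF D(1) D(4)] measurable_adapted_coefficient[OF D(1) D(6)]
    by (intro exI[of _ ?F] exI[of _ w] exI[of _ "\<lambda>r \<omega>. \<sigma> (t + r, snd (\<omega> r))"]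
        exI[of _ "\<lambda>r \<omega>. b (t + r, snd (\<omega> r))"] exI[of _ J]) blast
qed

text \<open>The estimate of time integrals in small cylinders that characterizes \<open>d\<^sub>0\<close>, with its constant
  \<open>K\<close>; \<open>e\<close> is the exponent of the radius.\<close>

definition time_integral_estimate ::
  "'d::finite itself \<Rightarrow> real \<Rightarrow> real \<Rightarrow> real \<Rightarrow> real \<Rightarrow> real \<Rightarrow> real \<Rightarrow> real \<Rightarrow> ereal \<Rightarrow> ereal \<Rightarrow> real \<Rightarrow> real \<Rightarrow> bool"
  where
  "time_integral_estimate _ \<delta> p0 q0 Nb Ru Rb B p q e K \<longleftrightarrow>
     (\<forall>(h :: 'd pt \<Rightarrow> real) bb (M :: 'd path measure) x.
          drift_bound p0 q0 h bb \<longrightarrow> Nb * bb Ru < 1 \<longrightarrow> bb Rb = B \<longrightarrow>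
          diffusion_type \<delta> h M x \<longrightarrow>
          (\<forall>R\<in>{0<..Rb}. \<forall>y. \<forall>f \<in> borel_measurable (restrict_space borel (cyl R (0, 0))).
             (\<forall>z\<in>cyl R (0, 0). 0 \<le> f z) \<longrightarrow>
             (\<integral>\<^sup>+ \<omega>. (\<integral>\<^sup>+ t\<in>{t. 0 \<le> t \<and> ereal t < tau x R y \<omega>}.
                  ennreal (f (t, y + x t \<omega>)) \<partial>lborel) \<partial>M)
             \<le> ennreal (K * R powr e) * Lpq_norm p q (cyl R (0, 0)) f))"

text \<open>The estimate for diffusion-type processes concerns cylinders whose clock starts with the process,
  whereas here the process may start at \<open>(t, x)\<close> in the middle of \<open>C = cyl R z0\<close>.  The part of \<open>C\<close>
  after time \<open>t\<close> lies in the cylinder of radius \<open>R\<close> based at \<open>(t, snd z0)\<close>, so that the exit from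
  this one is not earlier; extending the integrand by \<open>0\<close> outside \<open>C\<close> changes nothing before the exit
  from \<open>C\<close> and does not increase the norm.\<close>

lemma green_op_bound:
  fixes P :: "'d::finite pt \<Rightarrow> 'd path measure" and h F :: "'d pt \<Rightarrow> real"
  assumes est: "time_integral_estimate TYPE('d) \<delta> p0 q0 Nb Ru Rb B p q e K"
    and md: "markov_diffusion \<delta> p0 q0 h bb \<sigma> b P" and bb: "Nb * bb Ru < 1" "bb Rb = B"
    and pq0: "1 \<le> p0" "1 \<le> q0" and pq: "1 \<le> p" "p \<noteq> \<infinity>" "1 \<le> q"
    and R: "0 < R" "R \<le> Rb" and F: "F \<in> borel_measurable borel" "\<And>y. 0 \<le> F y"
    and z: "z \<in> cyl R z0"
  shows "green_op P (cyl R z0) (\<lambda>y. ennreal (F y)) z \<le> ennreal (K * R powr e) * Lpq_norm p q (cyl R z0) F"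
proof -
  note D = markov_diffusionD[OF md]
  obtain t x where tx: "z = (t, x)" by (cases z)
  define c where "c = (t, snd z0)"
  define y0 where "y0 = x - snd z0"
  define f where "f y = F (y + c) * indicator (cyl R z0) (y + c)" for y
  have T: "0 < R\<^sup>2" using R by simp
  have tz: "fst z0 \<le> t" using z by (simp add: tx cyl_def cyl2_def mem_Times_iff)
  have [measurable]: "cyl R y \<in> sets borel" for y :: "'d pt" by (simp add: cyl_def)
  have fm: "f \<in> borel_measurable borel" unfolding f_def using F(1) by measurable
  have sub: "(r, v) \<in> cyl R (0, 0)" if "(r, v) + c \<in> cyl R z0" "0 \<le> r" for r v
    using that tz by (auto simp: cyl_def cyl2_def c_def mem_Times_iff dist_norm norm_minus_commute)
  have "green_op P (cyl R z0) (\<lambda>y. ennreal (F y)) z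
      \<le> (\<integral>\<^sup>+\<omega>. (\<integral>\<^sup>+ r\<in>{r. 0 \<le> r \<and> ereal r < tau (\<lambda>r \<omega>. snd (\<omega> r) - x) R y0 \<omega>}.
          ennreal (f (r, y0 + (snd (\<omega> r) - x))) \<partial>lborel) \<partial>P z)"
    unfolding green_op_def
  proof (rule nn_integral_mono_AE)
    show "AE \<omega> in P z. occupation (cyl R z0) (\<lambda>y. ennreal (F y)) \<omega>
      \<le> (\<integral>\<^sup>+ r\<in>{r. 0 \<le> r \<and> ereal r < tau (\<lambda>r \<omega>. snd (\<omega> r) - x) R y0 \<omega>}.
          ennreal (f (r, y0 + (snd (\<omega> r) - x))) \<partial>lborel)"
      using AE_start[OF D(1), of z]
    proof eventually_elim
      case (elim \<omega>)
      then have w: "\<omega> \<in> paths" "\<omega> 0 = z" by auto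
      define s where "s = exit_real (cyl R z0) \<omega>"
      have s: "exits_at (cyl R z0) \<omega> s"
        unfolding s_def cyl_def by (rule exits_cyl2(1)[OF w(1) T])
      have pt: "(r, y0 + (snd (\<omega> r) - x)) + c = \<omega> r" if "0 \<le> r" for r
        using pathsD(2)[OF w(1) that] w(2) by (simp add: c_def y0_def prod_eq_iff tx)
      have in_cyl: "(r, y0 + (snd (\<omega> r) - x)) \<in> cyl R (0, 0)" if "0 \<le> r" "r < s" for r
        using sub[of r "y0 + (snd (\<omega> r) - x)"] that s by (simp only: pt) (simp add: exits_at_def)
      have "ereal s \<le> tau (\<lambda>r \<omega>. snd (\<omega> r) - x) R y0 \<omega>"
        unfolding tau_def hit_time_def
        by (rule INF_greatest) (use in_cyl in \<open>force simp: not_less[symmetric]\<close>)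
      then have "ereal r < tau (\<lambda>r \<omega>. snd (\<omega> r) - x) R y0 \<omega>" if "r < s" for r
        using that by (meson ereal_less_eq(3) less_ereal.simps(1) less_le_trans)
      moreover have "f (r, y0 + (snd (\<omega> r) - x)) = F (\<omega> r)" if "0 \<le> r" "r < s" for r
        using that s by (simp add: f_def pt exits_at_def del: add_Pair)
      ultimately show ?case
        unfolding occupation_def s_def[symmetric]
        by (intro nn_integral_mono) (auto simp: indicator_def)
    qed
  qed
  also have "\<dots> = (\<integral>\<^sup>+\<omega>. (\<integral>\<^sup>+ r\<in>{r. 0 \<le> r \<and> ereal r < tau (\<lambda>r \<omega>. snd (\<omega> r) - x) R y0 \<omega>}.
          ennreal (f (r, y0 + (snd (\<omega> r) - x))) \<partial>lborel) \<partial>completion (P z))"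
    by (simp only: nn_integral_completion)
  also have "\<dots> \<le> ennreal (K * R powr e) * Lpq_norm p q (cyl R (0, 0)) f"
  proof (rule est[unfolded time_integral_estimate_def, rule_format])
    show "drift_bound p0 q0 (\<lambda>y. h (y + (t, x))) bb"
      by (rule drift_bound_translate[OF D(2) pq0])
    show "diffusion_type \<delta> (\<lambda>y. h (y + (t, x))) (completion (P z)) (\<lambda>r \<omega>. snd (\<omega> r) - x)"
      unfolding tx by (rule diffusion_type_of_markov[OF md])
    show "f \<in> borel_measurable (restrict_space borel (cyl R (0, 0)))"
      by (rule measurable_restrict_space1[OF fm])
  qed (use bb R F(2) in \<open>auto simp: f_def\<close>)
  also have "\<dots> \<le> ennreal (K * R powr e) * Lpq_norm p q (cyl R z0) F"
  proof (rule mult_left_mono[OF Lpq_norm_le_translate[OF pq, where c=c]])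
    show "(\<lambda>z. indicator (cyl R (0, 0)) z * f z) \<in> borel_measurable borel" using fm by measurable
    show "indicator (cyl R (0, 0)) y * \<bar>f y\<bar> \<le> indicator (cyl R z0) (y + c) * \<bar>F (y + c)\<bar>" for y
      by (simp add: f_def indicator_def)
  qed simp
  finally show ?thesis .
qed

section \<open>Transport of a stochastic equation along an isomorphism\<close>

text \<open>The laws of a process and of its translate are isomorphic as filtered probability spaces.  Wiener
  processes and stochastic integrals pass from one to the other by composition with the isomorphism.\<close>

locale filtered_isomorphism =
  fixes M :: "'a measure" and M' :: "'b measure" and F :: "real \<Rightarrow> 'a measure" and F' :: "real \<Rightarrow> 'b measure"
    and \<phi> :: "'b \<Rightarrow> 'a" and \<psi> :: "'a \<Rightarrow> 'b"
  assumes M: "prob_space M" and M': "prob_space M'"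
    and \<phi>: "\<phi> \<in> M' \<rightarrow>\<^sub>M M" "distr M' M \<phi> = M" and \<psi>: "\<psi> \<in> M \<rightarrow>\<^sub>M M'" "distr M M' \<psi> = M'"
    and inv: "\<And>x. x \<in> space M \<Longrightarrow> \<phi> (\<psi> x) = x" "\<And>y. y \<in> space M' \<Longrightarrow> \<psi> (\<phi> y) = y"
    and F\<phi>: "\<And>t. 0 \<le> t \<Longrightarrow> \<phi> \<in> F' t \<rightarrow>\<^sub>M F t" and F\<psi>: "\<And>t. 0 \<le> t \<Longrightarrow> \<psi> \<in> F t \<rightarrow>\<^sub>M F' t"
    and sub: "\<And>t. 0 \<le> t \<Longrightarrow> subalgebra M (F t)" "\<And>t. 0 \<le> t \<Longrightarrow> subalgebra M' (F' t)"
begin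

text \<open>One inequality suffices for convergence to \<open>0\<close>, and it holds also for the integrands in the
  definition of the stochastic integral, which are not known to be measurable.\<close>

lemma nn_integral_transport: "(\<integral>\<^sup>+y. G (\<phi> y) \<partial>M') \<le> (\<integral>\<^sup>+x. G x \<partial>M)"
proof -
  have "(\<integral>\<^sup>+y. G (\<phi> y) \<partial>M') \<le> (\<integral>\<^sup>+x. G (\<phi> (\<psi> x)) \<partial>M)"
    using nn_integral_distr_le[OF \<psi>(1), of "\<lambda>y. G (\<phi> y)"] unfolding \<psi>(2) .
  also have "\<dots> = (\<integral>\<^sup>+x. G x \<partial>M)" by (rule nn_integral_cong) (simp add: inv)
  finally show ?thesis .
qed

lemma AE_transport: "AE x in M. Q x \<Longrightarrow> AE y in M'. Q (\<phi> y)"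
  using AE_distrD[OF \<phi>(1), of Q] unfolding \<phi>(2) .

lemma measure_transport: "B \<in> sets M \<Longrightarrow> measure M' (\<phi> -` B \<inter> space M') = measure M B"
  using measure_distr[OF \<phi>(1), of B] unfolding \<phi>(2) by simp

text \<open>Every event of the second filtration comes from the first one; this carries the independence of
  the increments over.\<close>

lemma sets_transport:
  assumes "0 \<le> t" "A \<in> sets (F' t)" obtains B where "B \<in> sets (F t)" "A = \<phi> -` B \<inter> space M'"
proof -
  have sp: "space (F t) = space M" "space (F' t) = space M'" using sub[OF assms(1)] by (auto simp: subalgebra_def)
  have "\<psi> -` A \<inter> space M \<in> sets (F t)"
    using measurable_sets[OF F\<psi>[OF assms(1)] assms(2)] sp by simp
  moreover have "A = \<phi> -` (\<psi> -` A \<inter> space M) \<inter> space M'"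
    using sets.sets_into_space[OF assms(2)] sp inv(2) measurable_space[OF \<phi>(1)] by auto
  ultimately show ?thesis by (rule that)
qed

lemma wiener_transport:
  fixes w :: "real \<Rightarrow> 'a \<Rightarrow> real ^ 'd::finite"
  assumes w: "wiener M F w"
  shows "wiener M' F' (\<lambda>t y. w t (\<phi> y))"
proof -
  interpret M: prob_space M by (rule M)
  interpret M': prob_space M' by (rule M')
  have meas: "w t \<in> borel_measurable (F t)" if "0 \<le> t" for t using w that by (simp add: wiener_def)
  have incr: "M'.indep_set (sets (F' s)) {(\<lambda>y. w t (\<phi> y) - w s (\<phi> y)) -` B \<inter> space M' | B. B \<in> sets borel} \<and>
        distributed M' lborel (\<lambda>y. w t (\<phi> y) - w s (\<phi> y))
          (\<lambda>v. ennreal (\<Prod>i\<in>UNIV. normal_density 0 (sqrt (t - s)) (v $ i)))"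
    if st: "0 \<le> s" "s < t" for s t
  proof
    let ?X = "\<lambda>x. w t x - w s x"
    let ?f = "\<lambda>v::real^'d. ennreal (\<Prod>i\<in>UNIV. normal_density 0 (sqrt (t - s)) (v $ i))"
    have ind: "M.indep_set (sets (F s)) {?X -` B \<inter> space M | B. B \<in> sets borel}"
      and dist: "distributed M lborel ?X ?f"
      using w st by (auto simp: wiener_def)
    have X: "?X \<in> M \<rightarrow>\<^sub>M borel" using distributed_measurable[OF dist] by simp
    have X': "(\<lambda>y. ?X (\<phi> y)) \<in> M' \<rightarrow>\<^sub>M borel" by (rule measurable_compose[OF \<phi>(1) X])
    show "M'.indep_set (sets (F' s)) {(\<lambda>y. w t (\<phi> y) - w s (\<phi> y)) -` B \<inter> space M' | B. B \<in> sets borel}"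
      unfolding M'.indep_sets2_eq
    proof (intro conjI ballI)
      show "sets (F' s) \<subseteq> M'.events" using sub(2)[OF st(1)] by (simp add: subalgebra_def)
      show "{(\<lambda>y. w t (\<phi> y) - w s (\<phi> y)) -` B \<inter> space M' | B. B \<in> sets borel} \<subseteq> M'.events"
        using measurable_sets[OF X'] by auto
      fix a b assume a: "a \<in> sets (F' s)" and b: "b \<in> {(\<lambda>y. w t (\<phi> y) - w s (\<phi> y)) -` B \<inter> space M' | B. B \<in> sets borel}"
      obtain A where A: "A \<in> sets (F s)" "a = \<phi> -` A \<inter> space M'"
        by (rule sets_transport[OF st(1) a])
      obtain B where B: "B \<in> sets borel" "b = (\<lambda>y. w t (\<phi> y) - w s (\<phi> y)) -` B \<inter> space M'"
        using b by auto
      let ?B = "?X -` B \<inter> space M"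
      have b: "b = \<phi> -` ?B \<inter> space M'" using measurable_space[OF \<phi>(1)] by (auto simp: B)
      have A': "A \<in> sets M" using A(1) sub(1)[OF st(1)] by (auto simp: subalgebra_def)
      have B': "?B \<in> sets M" by (rule measurable_sets[OF X B(1)])
      have "a \<inter> b = \<phi> -` (A \<inter> ?B) \<inter> space M'" unfolding A b by auto
      then have "M'.prob (a \<inter> b) = M.prob (A \<inter> ?B)"
        using measure_transport[of "A \<inter> ?B"] A' B' by simp
      also have "\<dots> = M.prob A * M.prob ?B"
        using ind A(1) B(1) unfolding M.indep_sets2_eq by blast
      also have "\<dots> = M'.prob a * M'.prob b"
        using measure_transport[OF A'] measure_transport[OF B'] by (simp only: A(2) b)
      finally show "M'.prob (a \<inter> b) = M'.prob a * M'.prob b" .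
    qed
    have "distr M' lborel (\<lambda>y. ?X (\<phi> y)) = distr (distr M' M \<phi>) lborel ?X"
      using X by (subst distr_distr[OF _ \<phi>(1)]) (auto simp: comp_def)
    also have "\<dots> = density lborel ?f" unfolding \<phi>(2) using dist by (simp add: distributed_def)
    finally show "distributed M' lborel (\<lambda>y. w t (\<phi> y) - w s (\<phi> y)) ?f"
      using dist X' by (simp add: distributed_def)
  qed
  have "AE y in M'. w 0 (\<phi> y) = 0 \<and> continuous_on {0..} (\<lambda>t. w t (\<phi> y))"
    by (rule AE_transport) (use w in \<open>simp add: wiener_def\<close>)
  moreover have "\<forall>t\<ge>0. (\<lambda>y. w t (\<phi> y)) \<in> borel_measurable (F' t)"
    using measurable_compose[OF F\<phi> meas] by blast
  ultimately show ?thesis using incr unfolding wiener_def by blast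
qed

lemma ito_integral_transport:
  fixes w :: "real \<Rightarrow> 'a \<Rightarrow> real ^ 'd::finite"
  assumes J: "ito_integral M F w \<sigma> J"
    and \<sigma>': "\<And>s y. 0 \<le> s \<Longrightarrow> y \<in> space M' \<Longrightarrow> \<sigma>' s y = \<sigma> s (\<phi> y)"
  shows "ito_integral M' F' (\<lambda>t y. w t (\<phi> y)) \<sigma>' (\<lambda>t y. J t (\<phi> y))"
proof -
  have meas: "J t \<in> borel_measurable (F t)" if "0 \<le> t" for t using J that by (simp add: ito_integral_def)
  obtain n r \<xi> where st: "\<And>j::nat. step_process M F (n j) (r j) (\<xi> j)"
    and c1: "\<And>T. 0 \<le> T \<Longrightarrow> (\<lambda>j. \<integral>\<^sup>+ \<omega>. (\<integral>\<^sup>+ s\<in>{0..T}.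
             ennreal ((norm (step_value (n j) (r j) (\<xi> j) s \<omega> - \<sigma> s \<omega>))\<^sup>2) \<partial>lborel) \<partial>M) \<longlonglongrightarrow> 0"
    and c2: "\<And>t. 0 \<le> t \<Longrightarrow> (\<lambda>j. \<integral>\<^sup>+ \<omega>.
             ennreal ((norm (step_integral (n j) (r j) (\<xi> j) w t \<omega> - J t \<omega>))\<^sup>2) \<partial>M) \<longlonglongrightarrow> 0"
    using J unfolding ito_integral_def by blast
  define \<xi>' where "\<xi>' j k y = \<xi> j k (\<phi> y)" for j k y
  have r0: "0 \<le> r j k" if "k \<le> n j" for j k
    using that
  proof (induction k)
    case 0 then show ?case using st[of j] by (simp add: step_process_def)
  next
    case (Suc k)
    then have "0 \<le> r j k" "r j k \<le> r j (Suc k)" using st[of j] by (auto simp: step_process_def)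
    then show ?case by simp
  qed
  have st': "step_process M' F' (n j) (r j) (\<xi>' j)" for j
  proof -
    have "\<xi>' j k \<in> borel_measurable (F' (r j k)) \<and> bounded (\<xi>' j k ` space M')" if k: "k < n j" for k
    proof
      have m: "\<xi> j k \<in> borel_measurable (F (r j k))" and b: "bounded (\<xi> j k ` space M)"
        using st[of j] k by (auto simp: step_process_def)
      have "0 \<le> r j k" using k by (intro r0) simp
      from measurable_compose[OF F\<phi>[OF this] m]
      show "\<xi>' j k \<in> borel_measurable (F' (r j k))" by (simp add: \<xi>'_def[abs_def])
      show "bounded (\<xi>' j k ` space M')"
        using measurable_space[OF \<phi>(1)] by (intro bounded_subset[OF b]) (auto simp: \<xi>'_def)
    qed
    then show ?thesis using st[of j] by (auto simp: step_process_def)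
  qed
  have v: "step_value (n j) (r j) (\<xi>' j) s y = step_value (n j) (r j) (\<xi> j) s (\<phi> y)" for j s y
    by (simp add: step_value_def \<xi>'_def)
  have i: "step_integral (n j) (r j) (\<xi>' j) (\<lambda>t y. w t (\<phi> y)) t y
      = step_integral (n j) (r j) (\<xi> j) w t (\<phi> y)" for j t y
    by (simp add: step_integral_def \<xi>'_def)
  have "(\<lambda>j. \<integral>\<^sup>+ y. (\<integral>\<^sup>+ s\<in>{0..T}.
             ennreal ((norm (step_value (n j) (r j) (\<xi>' j) s y - \<sigma>' s y))\<^sup>2) \<partial>lborel) \<partial>M') \<longlonglongrightarrow> 0"
    if T: "0 \<le> T" for T
  proof -
    define E where "E j x = (\<integral>\<^sup>+ s\<in>{0..T}.
        ennreal ((norm (step_value (n j) (r j) (\<xi> j) s x - \<sigma> s x))\<^sup>2) \<partial>lborel)" for j x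
    have "(\<lambda>j. \<integral>\<^sup>+ y. E j (\<phi> y) \<partial>M') \<longlonglongrightarrow> 0"
      by (rule tendsto_sandwich[OF _ _ tendsto_const c1[OF T, folded E_def]])
        (auto intro!: always_eventually nn_integral_transport)
    moreover have "(\<integral>\<^sup>+ y. (\<integral>\<^sup>+ s\<in>{0..T}.
             ennreal ((norm (step_value (n j) (r j) (\<xi>' j) s y - \<sigma>' s y))\<^sup>2) \<partial>lborel) \<partial>M')
         = (\<integral>\<^sup>+ y. E j (\<phi> y) \<partial>M')" for j
      unfolding E_def by (intro nn_integral_cong) (auto simp: v \<sigma>' indicator_def intro!: nn_integral_cong)
    ultimately show ?thesis by simp
  qed
  moreover have "(\<lambda>j. \<integral>\<^sup>+ y.
             ennreal ((norm (step_integral (n j) (r j) (\<xi>' j) (\<lambda>t y. w t (\<phi> y)) t y - J t (\<phi> y)))\<^sup>2) \<partial>M')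
      \<longlonglongrightarrow> 0" if t: "0 \<le> t" for t
  proof (rule tendsto_sandwich[OF _ _ tendsto_const c2[OF t]])
    show "\<forall>\<^sub>F j in sequentially. (\<integral>\<^sup>+ y.
             ennreal ((norm (step_integral (n j) (r j) (\<xi>' j) (\<lambda>t y. w t (\<phi> y)) t y - J t (\<phi> y)))\<^sup>2) \<partial>M')
       \<le> (\<integral>\<^sup>+ \<omega>. ennreal ((norm (step_integral (n j) (r j) (\<xi> j) w t \<omega> - J t \<omega>))\<^sup>2) \<partial>M)"
      unfolding i by (intro always_eventually allI nn_integral_transport)
  qed simp
  moreover have "AE y in M'. continuous_on {0..} (\<lambda>t. J t (\<phi> y))"
    by (rule AE_transport) (use J in \<open>simp add: ito_integral_def\<close>)
  moreover have "\<forall>t\<ge>0. (\<lambda>y. J t (\<phi> y)) \<in> borel_measurable (F' t)"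
    using measurable_compose[OF F\<phi> meas] by blast
  ultimately show ?thesis unfolding ito_integral_def using st' by blast
qed

end

section \<open>Translations of the Markov process\<close>

definition translate_path :: "'d::finite pt \<Rightarrow> 'd path \<Rightarrow> 'd path" where
  "translate_path c \<omega> = (\<lambda>s\<in>{0..}. \<omega> s + c)"

text \<open>The process started at \<open>z + c\<close> is moved back by \<open>c\<close>; it then starts at \<open>z\<close> and solves the equation
  with the coefficients \<open>\<sigma> (\<cdot> + c)\<close>, \<open>b (\<cdot> + c)\<close>.\<close>

definition translate_law ::
  "'d::finite pt \<Rightarrow> ('d pt \<Rightarrow> 'd path measure) \<Rightarrow> 'd pt \<Rightarrow> 'd path measure" where
  "translate_law c P z = distr (P (z + c)) path_space (translate_path (- c))"

lemma translate_path_apply [simp]: "0 \<le> s \<Longrightarrow> translate_path c \<omega> s = \<omega> s + c"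
  by (simp add: translate_path_def)

lemma translate_path_in_paths: "\<omega> \<in> paths \<Longrightarrow> translate_path c \<omega> \<in> paths"
proof -
  assume w: "\<omega> \<in> paths"
  have "continuous_on {0..} (\<lambda>s. \<omega> s + c)"
    by (intro continuous_intros pathsD(1)[OF w])
  then have "continuous_on {0..} (translate_path c \<omega>)"
    by (rule continuous_on_eq) simp
  moreover have "fst (translate_path c \<omega> s) = fst (translate_path c \<omega> 0) + s" if "0 \<le> s" for s
    using pathsD(2)[OF w that] that by simp
  moreover have "translate_path c \<omega> \<in> extensional {0..}" by (simp add: translate_path_def)
  ultimately show ?thesis unfolding paths_def by blast
qed

lemma translate_path_inverse:
  assumes "\<omega> \<in> paths" shows "translate_path (- c) (translate_path c \<omega>) = \<omega>"
proof
  fix s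
  show "translate_path (- c) (translate_path c \<omega>) s = \<omega> s"
    using pathsD(3)[OF assms] by (cases "0 \<le> s") (auto simp: translate_path_def extensional_def)
qed

lemma translate_path_inverse': "\<omega> \<in> paths \<Longrightarrow> translate_path c (translate_path (- c) \<omega>) = \<omega>"
  using translate_path_inverse[of \<omega> "- c"] by simp

lemma measurable_translate_path:
  "translate_path c \<in> path_space \<rightarrow>\<^sub>M (path_space :: 'd::finite path measure)"
  by (rule measurable_into_path_space)
    (auto intro!: translate_path_in_paths borel_measurable_add measurable_eval)

lemma measurable_translate_path_filt:
  "translate_path c \<in> path_filt t \<rightarrow>\<^sub>M (path_filt t :: 'd::finite path measure)"
  by (rule measurable_into_path_filt)
    (auto intro!: translate_path_in_paths borel_measurable_add measurable_eval_filt)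

lemma path_filt_plus_gen: "(\<Inter>s\<in>{t<..}. sets (path_filt s)) \<subseteq> Pow (paths :: 'd::finite path set)"
proof -
  have "sets (path_filt (t + 1)) \<subseteq> Pow (paths :: 'd path set)"
    using sets.space_closed[of "path_filt (t + 1) :: 'd path measure"] by simp
  moreover have "(\<Inter>s\<in>{t<..}. sets (path_filt s)) \<subseteq> sets (path_filt (t + 1) :: 'd path measure)"
    by (rule INF_lower) simp
  ultimately show ?thesis by (rule order_trans[rotated])
qed

lemma space_path_filt_plus: "space (path_filt_plus t) = (paths :: 'd::finite path set)"
  unfolding path_filt_plus_def by (rule space_measure_of[OF path_filt_plus_gen])

lemma sets_path_filt_plus:
  "sets (path_filt_plus t) = sigma_sets (paths :: 'd::finite path set) (\<Inter>s\<in>{t<..}. sets (path_filt s))"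
  unfolding path_filt_plus_def by (rule sets_measure_of[OF path_filt_plus_gen])

lemma sets_path_filt_plus_subset: "sets (path_filt_plus t) \<subseteq> sets (path_space :: 'd::finite path measure)"
proof -
  have "(\<Inter>s\<in>{t<..}. sets (path_filt s)) \<subseteq> sets (path_filt (t + 1) :: 'd path measure)"
    by (rule INF_lower) simp
  also have "\<dots> \<subseteq> sets path_space" by (rule sets_path_filt_subset)
  finally show ?thesis
    unfolding sets_path_filt_plus using sets.sigma_sets_subset[of _ "path_space :: 'd path measure"] by simp
qed

lemma measurable_translate_path_filt_plus:
  "translate_path c \<in> path_filt_plus t \<rightarrow>\<^sub>M (path_filt_plus t :: 'd::finite path measure)"
proof -
  have "translate_path c -` A \<inter> paths \<in> sets (path_filt_plus t)"
    if A: "A \<in> (\<Inter>s\<in>{t<..}. sets (path_filt s))" for A :: "'d path set"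
  proof -
    have "translate_path c -` A \<inter> paths \<in> sets (path_filt s)" if "t < s" for s
      using measurable_sets[OF measurable_translate_path_filt, of A s c] A that by auto
    then show ?thesis unfolding sets_path_filt_plus by (intro sigma_sets.Basic) auto
  qed
  then have "translate_path c \<in> path_filt_plus t \<rightarrow>\<^sub>M sigma paths (\<Inter>s\<in>{t<..}. sets (path_filt s))"
    by (intro measurable_measure_of path_filt_plus_gen)
      (auto simp: space_path_filt_plus translate_path_in_paths)
  then show ?thesis unfolding path_filt_plus_def[of t, symmetric] .
qed

context
  fixes P :: "'d::finite pt \<Rightarrow> 'd path measure" and c :: "'d pt"
  assumes sm: "strong_markov path_filt P"
begin

lemma measurable_translate_kernel: "translate_path a \<in> P z \<rightarrow>\<^sub>M path_space"
  unfolding measurable_kernel_iff[OF sm] by (rule measurable_translate_path)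

lemma sets_translate_law [simp]: "sets (translate_law c P z) = sets path_space"
  and space_translate_law [simp]: "space (translate_law c P z) = paths"
  by (simp_all add: translate_law_def)

lemma prob_space_translate_law: "prob_space (translate_law c P z)"
  unfolding translate_law_def
  by (rule prob_space.prob_space_distr[OF prob_space_kernel[OF sm] measurable_translate_kernel])

lemma measurable_translate_law: "translate_law c P \<in> borel \<rightarrow>\<^sub>M prob_algebra path_space"
proof -
  have "(\<lambda>z. P (z + c)) \<in> borel \<rightarrow>\<^sub>M prob_algebra path_space"
    by (rule measurable_compose[OF _ kernel_measurable[OF sm]]) simp
  from measurable_compose[OF this measurable_distr_prob_space[OF measurable_translate_path]]
  show ?thesis by (simp add: translate_law_def[abs_def])
qed

lemma emeasure_translate_law:
  "A \<in> sets path_space \<Longrightarrow>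
    emeasure (translate_law c P z) A = emeasure (P (z + c)) (translate_path (- c) -` A \<inter> paths)"
  unfolding translate_law_def
  by (subst emeasure_distr[OF measurable_translate_kernel]) (auto simp: space_kernel[OF sm])

lemma translate_law_start: "AE \<omega> in translate_law c P z. \<omega> 0 = z"
proof -
  have "(\<lambda>\<omega>. \<omega> 0) -` {z} \<inter> space path_space \<in> sets (path_space :: 'd path measure)"
    by (rule measurable_sets[OF measurable_eval]) auto
  then have "{\<omega> \<in> space path_space. \<omega> 0 = z} \<in> sets (path_space :: 'd path measure)"
    by (simp add: vimage_def Int_def conj_commute)
  moreover have "AE \<omega> in P (z + c). translate_path (- c) \<omega> 0 = z"
    using kernel_start[OF sm, of "z + c"] by eventually_elim simp
  ultimately show ?thesis
    unfolding translate_law_def by (subst AE_distr_iff[OF measurable_translate_kernel]) auto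
qed

text \<open>Both sides of the Markov identities for the translated process are those of the original one
  at translated data; \<open>r\<close> is the time of restart.\<close>

lemma translate_identity:
  fixes \<Gamma> :: "'d pt set"
  assumes A: "A \<in> sets path_space" and r: "r \<in> path_space \<rightarrow>\<^sub>M borel" "\<And>\<omega>. \<omega> \<in> paths \<Longrightarrow> 0 \<le> r \<omega>"
    and s: "0 \<le> s" and \<Gamma>: "\<Gamma> \<in> sets borel"
  defines "S \<equiv> translate_path (- c)"
  defines "A' \<equiv> S -` A \<inter> paths" and "\<Gamma>' \<equiv> (\<lambda>y. y - c) -` \<Gamma>"
  assumes eq: "emeasure (P (z + c)) {\<omega>\<in>A'. \<omega> (r (S \<omega>) + s) \<in> \<Gamma>'} =
    (\<integral>\<^sup>+ \<omega>\<in>A'. emeasure (P (\<omega> (r (S \<omega>)))) {\<omega>'\<in>paths. \<omega>' s \<in> \<Gamma>'} \<partial>P (z + c))"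
  shows "emeasure (translate_law c P z) {\<omega>\<in>A. \<omega> (r \<omega> + s) \<in> \<Gamma>} =
    (\<integral>\<^sup>+ \<omega>\<in>A. emeasure (translate_law c P (\<omega> (r \<omega>))) {\<omega>'\<in>paths. \<omega>' s \<in> \<Gamma>} \<partial>translate_law c P z)"
proof -
  have Spaths: "S \<omega> \<in> paths" if "\<omega> \<in> paths" for \<omega> unfolding S_def by (rule translate_path_in_paths[OF that])
  have A_sub: "A \<subseteq> paths" using sets.sets_into_space[OF A] by simp
  have S_ev: "S \<omega> a = \<omega> a - c" if "0 \<le> a" for \<omega> a using that by (simp add: S_def)
  have one: "{\<omega>'\<in>paths. \<omega>' s \<in> \<Gamma>} \<in> sets (path_space :: 'd path measure)"
    using finite_dim_event[of "{s}" "\<lambda>_. s" "\<lambda>_. \<Gamma>"] s \<Gamma> by simp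
  have ev: "(\<lambda>\<omega>. \<omega> (r \<omega> + s)) \<in> (path_space :: 'd path measure) \<rightarrow>\<^sub>M borel"
    by (rule measurable_eval_at) (use r s in \<open>auto intro!: borel_measurable_add\<close>)
  have ev0: "(\<lambda>\<omega>. \<omega> (r \<omega>)) \<in> (path_space :: 'd path measure) \<rightarrow>\<^sub>M borel"
    by (rule measurable_eval_at) (use r in auto)
  have "A \<inter> ((\<lambda>\<omega>. \<omega> (r \<omega> + s)) -` \<Gamma> \<inter> space path_space) \<in> sets path_space"
    using A measurable_sets[OF ev \<Gamma>] by (rule sets.Int)
  also have "A \<inter> ((\<lambda>\<omega>. \<omega> (r \<omega> + s)) -` \<Gamma> \<inter> space path_space) = {\<omega>\<in>A. \<omega> (r \<omega> + s) \<in> \<Gamma>}"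
    using A_sub by auto
  finally have "emeasure (translate_law c P z) {\<omega>\<in>A. \<omega> (r \<omega> + s) \<in> \<Gamma>}
      = emeasure (P (z + c)) (S -` {\<omega>\<in>A. \<omega> (r \<omega> + s) \<in> \<Gamma>} \<inter> paths)"
    unfolding S_def by (rule emeasure_translate_law)
  also have "S -` {\<omega>\<in>A. \<omega> (r \<omega> + s) \<in> \<Gamma>} \<inter> paths = {\<omega>\<in>A'. \<omega> (r (S \<omega>) + s) \<in> \<Gamma>'}"
    using r(2)[OF Spaths] s by (auto simp: A'_def \<Gamma>'_def S_ev)
  also note eq
  also have "(\<integral>\<^sup>+ \<omega>\<in>A'. emeasure (P (\<omega> (r (S \<omega>)))) {\<omega>'\<in>paths. \<omega>' s \<in> \<Gamma>'} \<partial>P (z + c))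
      = (\<integral>\<^sup>+ \<omega>. emeasure (translate_law c P (S \<omega> (r (S \<omega>)))) {\<omega>'\<in>paths. \<omega>' s \<in> \<Gamma>} * indicator A (S \<omega>) \<partial>P (z + c))"
  proof (rule nn_integral_cong)
    fix \<omega> assume "\<omega> \<in> space (P (z + c))"
    then have w: "\<omega> \<in> paths" by (simp add: space_kernel[OF sm])
    have "emeasure (translate_law c P (S \<omega> (r (S \<omega>)))) {\<omega>'\<in>paths. \<omega>' s \<in> \<Gamma>}
        = emeasure (P (\<omega> (r (S \<omega>)))) (S -` {\<omega>'\<in>paths. \<omega>' s \<in> \<Gamma>} \<inter> paths)"
      using emeasure_translate_law[OF one, of "S \<omega> (r (S \<omega>))"] r(2)[OF Spaths[OF w]]
      by (simp add: S_ev S_def[symmetric])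
    also have "S -` {\<omega>'\<in>paths. \<omega>' s \<in> \<Gamma>} \<inter> paths = {\<omega>'\<in>paths. \<omega>' s \<in> \<Gamma>'}"
      using Spaths s by (auto simp: \<Gamma>'_def S_ev)
    finally show "emeasure (P (\<omega> (r (S \<omega>)))) {\<omega>'\<in>paths. \<omega>' s \<in> \<Gamma>'} * indicator A' \<omega>
      = emeasure (translate_law c P (S \<omega> (r (S \<omega>)))) {\<omega>'\<in>paths. \<omega>' s \<in> \<Gamma>} * indicator A (S \<omega>)"
      using w by (simp add: A'_def indicator_def)
  qed
  also have "\<dots> = (\<integral>\<^sup>+ \<omega>\<in>A. emeasure (translate_law c P (\<omega> (r \<omega>))) {\<omega>'\<in>paths. \<omega>' s \<in> \<Gamma>} \<partial>translate_law c P z)"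
    unfolding translate_law_def[of c P z] S_def
  proof (rule nn_integral_distr[OF measurable_translate_kernel, symmetric])
    have "(\<lambda>y. emeasure (translate_law c P y) {\<omega>'\<in>paths. \<omega>' s \<in> \<Gamma>}) \<in> borel_measurable borel"
      by (rule measurable_compose[OF measurable_prob_algebraD[OF measurable_translate_law]
            measurable_emeasure_subprob_algebra[OF one]])
    from measurable_compose[OF ev0 this]
    have "(\<lambda>\<omega>. emeasure (translate_law c P (\<omega> (r \<omega>))) {\<omega>'\<in>paths. \<omega>' s \<in> \<Gamma>} * indicator A \<omega>)
        \<in> borel_measurable path_space"
      using A by (intro borel_measurable_times_ennreal borel_measurable_indicator) auto
    then show "(\<lambda>\<omega>. emeasure (translate_law c P (\<omega> (r \<omega>))) {\<omega>'\<in>paths. \<omega>' s \<in> \<Gamma>} * indicator A \<omega>)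
        \<in> borel_measurable (distr (P (z + c)) path_space (translate_path (- c)))" by simp
  qed
  finally show ?thesis .
qed

lemma vimage_diff_borel: "\<Gamma> \<in> sets borel \<Longrightarrow> (\<lambda>y. y - c) -` \<Gamma> \<in> sets borel"
  using measurable_sets[of "\<lambda>y. y - c" borel borel \<Gamma>] by simp

lemma markov_translate:
  fixes F :: "real \<Rightarrow> 'd path measure"
  assumes mk: "markov F P" and sub: "\<And>t. sets (F t) \<subseteq> sets path_space" and sp: "\<And>t. space (F t) = paths"
    and tr: "\<And>t. translate_path (- c) \<in> F t \<rightarrow>\<^sub>M F t"
  shows "markov F (translate_law c P)"
  unfolding markov_def
proof (intro conjI allI impI ballI)
  show "translate_law c P \<in> borel \<rightarrow>\<^sub>M prob_algebra path_space" by (rule measurable_translate_law)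
  show "AE \<omega> in translate_law c P z. \<omega> 0 = z" for z by (rule translate_law_start)
  fix z t s A and \<Gamma> :: "'d pt set"
  assume ts: "(0::real) \<le> t" "(0::real) \<le> s" and A: "A \<in> sets (F t)" and \<Gamma>: "\<Gamma> \<in> sets borel"
  have A': "translate_path (- c) -` A \<inter> paths \<in> sets (F t)"
    using measurable_sets[OF tr A] by (simp add: sp)
  have "emeasure (P (z + c)) {\<omega> \<in> translate_path (- c) -` A \<inter> paths. \<omega> (t + s) \<in> (\<lambda>y. y - c) -` \<Gamma>} =
    (\<integral>\<^sup>+ \<omega>\<in>translate_path (- c) -` A \<inter> paths.
      emeasure (P (\<omega> t)) {\<omega>'\<in>paths. \<omega>' s \<in> (\<lambda>y. y - c) -` \<Gamma>} \<partial>P (z + c))"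
    using mk ts A' vimage_diff_borel[OF \<Gamma>] unfolding markov_def by blast
  then show "emeasure (translate_law c P z) {\<omega>\<in>A. \<omega> (t + s) \<in> \<Gamma>} =
    (\<integral>\<^sup>+ \<omega>\<in>A. emeasure (translate_law c P (\<omega> t)) {\<omega>'\<in>paths. \<omega>' s \<in> \<Gamma>} \<partial>translate_law c P z)"
    by (rule translate_identity[where r="\<lambda>_. t", rotated 5]) (use A sub ts \<Gamma> in auto)
qed

text \<open>A Markov time \<open>T\<close> of the translated process is the Markov time \<open>T\<close> of the translated path for the
  original one.\<close>

lemma strong_markov_translate: "strong_markov path_filt (translate_law c P)"
  unfolding strong_markov_def
proof (intro conjI allI impI ballI)
  show "markov path_filt (translate_law c P)"
  proof (rule markov_translate)
    show "markov path_filt P" using sm by (simp only: strong_markov_def)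
  qed (simp_all add: sets_path_filt_subset measurable_translate_path_filt)
  fix z s A and T :: "'d path \<Rightarrow> ereal" and \<Gamma> :: "'d pt set"
  assume s: "(0::real) \<le> s" and A: "A \<in> sets path_space" and \<Gamma>: "\<Gamma> \<in> sets borel"
    and T: "markov_time path_filt paths T"
    and AT: "\<forall>t\<ge>0. {\<omega>\<in>A. T \<omega> \<le> ereal t} \<in> sets (path_filt t)"
  define S where "S = translate_path (- c)"
  define A1 where "A1 = {\<omega>\<in>A. T \<omega> < \<infinity>}"
  define r where "r \<omega> = real_of_ereal (T \<omega>)" for \<omega>
  have Spaths: "S \<omega> \<in> paths" if "\<omega> \<in> paths" for \<omega> unfolding S_def by (rule translate_path_in_paths[OF that])
  have Sm: "S -` E \<inter> paths \<in> sets (path_filt t)" if "E \<in> sets (path_filt t)" for E t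
    using measurable_sets[OF measurable_translate_path_filt that, of "- c"] by (simp add: S_def)
  have Tpos: "0 \<le> T \<omega>" if "\<omega> \<in> paths" for \<omega> using T that by (simp add: markov_time_def)
  have Tle: "{\<omega>\<in>paths. T \<omega> \<le> ereal t} \<in> sets (path_filt t)" if "0 \<le> t" for t
    using T that by (simp add: markov_time_def)
  have real_le: "x < \<infinity> \<longleftrightarrow> (\<exists>n::nat. x \<le> ereal (real n))" if "0 \<le> x" for x :: ereal
    using that by (cases x) (auto intro: real_arch_simple)
  have A_sub: "A \<subseteq> paths" using sets.sets_into_space[OF A] by simp
  have "{\<omega>\<in>A. T \<omega> \<le> ereal (real n)} \<in> sets path_space" for n
    using AT sets_path_filt_subset[of "real n"] by auto
  then have "(\<Union>n. {\<omega>\<in>A. T \<omega> \<le> ereal (real n)}) \<in> sets path_space" by auto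
  also have "(\<Union>n. {\<omega>\<in>A. T \<omega> \<le> ereal (real n)}) = A1"
    using A_sub real_le Tpos by (auto simp: A1_def)
  finally have A1: "A1 \<in> sets path_space" .
  have rm: "r \<in> path_space \<rightarrow>\<^sub>M borel"
  proof (rule borel_measurable_iff_le[THEN iffD2], rule allI)
    fix a
    show "{\<omega> \<in> space path_space. r \<omega> \<le> a} \<in> sets path_space"
    proof (cases "0 \<le> a")
      case True
      have m: "{\<omega>\<in>paths. T \<omega> \<le> ereal t} \<in> sets path_space" if "0 \<le> t" for t
        using Tle[OF that] sets_path_filt_subset[of t] by auto
      have "paths - (\<Union>n. {\<omega>\<in>paths. T \<omega> \<le> ereal (real n)}) \<in> sets (path_space :: 'd path measure)"
        using m sets.top[of "path_space :: 'd path measure"] by (intro sets.Diff) auto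
      with m[OF True] have "{\<omega>\<in>paths. T \<omega> \<le> ereal a} \<union> (paths - (\<Union>n. {\<omega>\<in>paths. T \<omega> \<le> ereal (real n)}))
          \<in> sets path_space" by (rule sets.Un)
      also have "{\<omega>\<in>paths. T \<omega> \<le> ereal a} \<union> (paths - (\<Union>n. {\<omega>\<in>paths. T \<omega> \<le> ereal (real n)}))
          = {\<omega> \<in> space path_space. r \<omega> \<le> a}"
      proof -
        have "T \<omega> \<le> ereal a \<or> \<not> T \<omega> < \<infinity> \<longleftrightarrow> r \<omega> \<le> a" if "\<omega> \<in> paths" for \<omega>
          using Tpos[OF that] True unfolding r_def by (cases "T \<omega>") auto
        then show ?thesis using real_le[OF Tpos] by auto
      qed
      finally show ?thesis .
    next
      case False
      have "0 \<le> r \<omega>" if "\<omega> \<in> paths" for \<omega>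
        using Tpos[OF that] by (simp add: r_def real_of_ereal_pos)
      then have "{\<omega> \<in> space path_space. r \<omega> \<le> a} = {}" using False by force
      then show ?thesis by (simp only: sets.empty_sets)
    qed
  qed
  have "markov_time path_filt paths (\<lambda>\<omega>. T (S \<omega>))"
  proof -
    have "{\<omega>\<in>paths. T (S \<omega>) \<le> ereal t} = S -` {\<omega>\<in>paths. T \<omega> \<le> ereal t} \<inter> paths" for t
      using Spaths by auto
    then show ?thesis unfolding markov_time_def using Tpos[OF Spaths] Sm[OF Tle] by simp
  qed
  moreover have "S -` A \<inter> paths \<in> sets path_space"
    using measurable_sets[OF measurable_translate_path A, of "- c"] by (simp add: S_def)
  moreover have "\<forall>t\<ge>0. {\<omega> \<in> S -` A \<inter> paths. T (S \<omega>) \<le> ereal t} \<in> sets (path_filt t)"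
  proof (intro allI impI)
    fix t :: real assume "0 \<le> t"
    then have "S -` {\<omega>\<in>A. T \<omega> \<le> ereal t} \<inter> paths \<in> sets (path_filt t)" using AT by (intro Sm) simp
    also have "S -` {\<omega>\<in>A. T \<omega> \<le> ereal t} \<inter> paths = {\<omega> \<in> S -` A \<inter> paths. T (S \<omega>) \<le> ereal t}" by auto
    finally show "{\<omega> \<in> S -` A \<inter> paths. T (S \<omega>) \<le> ereal t} \<in> sets (path_filt t)" .
  qed
  ultimately have "emeasure (P (z + c)) {\<omega>\<in>S -` A \<inter> paths. T (S \<omega>) < \<infinity> \<and>
        \<omega> (real_of_ereal (T (S \<omega>)) + s) \<in> (\<lambda>y. y - c) -` \<Gamma>} =
      (\<integral>\<^sup>+ \<omega>\<in>{\<omega>\<in>S -` A \<inter> paths. T (S \<omega>) < \<infinity>}.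
          emeasure (P (\<omega> (real_of_ereal (T (S \<omega>))))) {\<omega>'\<in>paths. \<omega>' s \<in> (\<lambda>y. y - c) -` \<Gamma>} \<partial>P (z + c))"
    using sm s vimage_diff_borel[OF \<Gamma>] unfolding strong_markov_def by blast
  moreover have "{\<omega>\<in>S -` A \<inter> paths. T (S \<omega>) < \<infinity> \<and> \<omega> (real_of_ereal (T (S \<omega>)) + s) \<in> (\<lambda>y. y - c) -` \<Gamma>}
      = {\<omega>\<in>S -` A1 \<inter> paths. \<omega> (r (S \<omega>) + s) \<in> (\<lambda>y. y - c) -` \<Gamma>}"
    "{\<omega>\<in>S -` A \<inter> paths. T (S \<omega>) < \<infinity>} = S -` A1 \<inter> paths"
    by (auto simp: A1_def r_def)
  ultimately have "emeasure (P (z + c)) {\<omega>\<in>S -` A1 \<inter> paths. \<omega> (r (S \<omega>) + s) \<in> (\<lambda>y. y - c) -` \<Gamma>} =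
      (\<integral>\<^sup>+ \<omega>\<in>S -` A1 \<inter> paths. emeasure (P (\<omega> (r (S \<omega>)))) {\<omega>'\<in>paths. \<omega>' s \<in> (\<lambda>y. y - c) -` \<Gamma>} \<partial>P (z + c))"
    by (simp only: r_def)
  then have "emeasure (translate_law c P z) {\<omega>\<in>A1. \<omega> (r \<omega> + s) \<in> \<Gamma>} =
    (\<integral>\<^sup>+ \<omega>\<in>A1. emeasure (translate_law c P (\<omega> (r \<omega>))) {\<omega>'\<in>paths. \<omega>' s \<in> \<Gamma>} \<partial>translate_law c P z)"
    unfolding S_def
    by (rule translate_identity[OF A1 rm _ s \<Gamma>, rotated]) (simp add: r_def Tpos real_of_ereal_pos)
  moreover have "{\<omega>\<in>A1. \<omega> (r \<omega> + s) \<in> \<Gamma>} = {\<omega>\<in>A. T \<omega> < \<infinity> \<and> \<omega> (real_of_ereal (T \<omega>) + s) \<in> \<Gamma>}"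
    by (auto simp: A1_def r_def)
  ultimately show "emeasure (translate_law c P z) {\<omega>\<in>A. T \<omega> < \<infinity> \<and> \<omega> (real_of_ereal (T \<omega>) + s) \<in> \<Gamma>} =
        (\<integral>\<^sup>+ \<omega>\<in>{\<omega>\<in>A. T \<omega> < \<infinity>}.
            emeasure (translate_law c P (\<omega> (real_of_ereal (T \<omega>)))) {\<omega>'\<in>paths. \<omega>' s \<in> \<Gamma>} \<partial>translate_law c P z)"
    by (simp only: A1_def r_def)
qed

lemma translate_law_inverse: "P (z + c) = distr (translate_law c P z) path_space (translate_path c)"
proof -
  have "distr (translate_law c P z) path_space (translate_path c)
      = distr (P (z + c)) path_space (\<lambda>\<omega>. translate_path c (translate_path (- c) \<omega>))"
    unfolding translate_law_def
    by (subst distr_distr[OF measurable_translate_path measurable_translate_kernel]) (simp add: comp_def)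
  also have "\<dots> = distr (P (z + c)) (P (z + c)) (\<lambda>\<omega>. \<omega>)"
    by (rule distr_cong) (auto simp: translate_path_inverse' kernel[OF sm])
  finally show ?thesis by (simp add: distr_id2)
qed

text \<open>Null sets, completions and the augmented filtrations correspond because the translations by \<open>c\<close>
  and \<open>- c\<close> are measure preserving in both directions.\<close>

lemma filtered_isomorphism_translate:
  "filtered_isomorphism (completion (P (z + c))) (completion (translate_law c P z))
     (completed_filt P (z + c)) (completed_filt (translate_law c P) z)
     (translate_path c) (translate_path (- c))"
proof -
  note sm' = strong_markov_translate
  have map: "\<psi> \<in> completion Q1 \<rightarrow>\<^sub>M completion Q2 \<and> distr (completion Q1) (completion Q2) \<psi> = completion Q2"
    if \<psi>: "\<psi> \<in> path_space \<rightarrow>\<^sub>M path_space" and Q1: "sets Q1 = sets path_space" and Q2: "Q2 = distr Q1 path_space \<psi>"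
    for Q1 Q2 :: "'d path measure" and \<psi>
  proof -
    have s2: "sets Q2 = sets path_space" by (simp add: Q2)
    have "\<psi> \<in> Q1 \<rightarrow>\<^sub>M Q2" using \<psi> by (simp add: measurable_cong_sets[OF Q1 s2])
    then have \<psi>': "\<psi> \<in> completion Q1 \<rightarrow>\<^sub>M Q2" by (rule measurable_completion)
    have "distr (completion Q1) Q2 \<psi> = distr Q1 Q2 \<psi>" by (rule distr_completion) fact
    also have "\<dots> = distr Q1 path_space \<psi>" by (rule distr_cong) (simp_all add: s2)
    also note Q2[symmetric]
    finally have eq: "distr (completion Q1) Q2 \<psi> = Q2" .
    have "\<psi> \<in> completion Q1 \<rightarrow>\<^sub>M completion Q2"
      by (rule completion.measurable_completion2[OF \<psi>']) (simp add: eq)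
    moreover have "completion (distr (completion Q1) Q2 \<psi>) = distr (completion Q1) (completion Q2) \<psi>"
      by (rule completion.completion_distr_eq[OF \<psi>']) (simp add: eq)
    ultimately show ?thesis by (simp add: eq)
  qed
  have filt: "\<psi> \<in> completed_filt P1 z1 t \<rightarrow>\<^sub>M completed_filt P2 z2 t"
    if s1: "strong_markov path_filt P1" and s2: "strong_markov path_filt P2"
      and c: "\<psi> \<in> completion (P1 z1) \<rightarrow>\<^sub>M completion (P2 z2)"
        "distr (completion (P1 z1)) (completion (P2 z2)) \<psi> = completion (P2 z2)"
      and f: "\<psi> \<in> path_filt t \<rightarrow>\<^sub>M path_filt t"
    for P1 P2 :: "'d pt \<Rightarrow> 'd path measure" and \<psi> z1 z2 t
    unfolding completed_filt_def[of P2]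
  proof (rule measurable_measure_of[OF completed_filt_gen[OF s2]])
    show "\<psi> \<in> space (completed_filt P1 z1 t) \<rightarrow> paths"
      using measurable_space[OF f] by (auto simp: space_completed_filt'[OF s1])
    fix A assume "A \<in> sets (path_filt t) \<union> null_sets (completion (P2 z2))"
    then show "\<psi> -` A \<inter> space (completed_filt P1 z1 t) \<in> sets (completed_filt P1 z1 t)"
    proof
      assume "A \<in> sets (path_filt t)"
      then show ?thesis
        using measurable_sets[OF f] path_filt_le_completed[OF s1, of t z1]
        by (auto simp: space_completed_filt'[OF s1])
    next
      assume "A \<in> null_sets (completion (P2 z2))"
      then have "A \<in> null_sets (distr (completion (P1 z1)) (completion (P2 z2)) \<psi>)" by (simp only: c(2))
      then have "\<psi> -` A \<inter> space (completion (P1 z1)) \<in> null_sets (completion (P1 z1))"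
        using c(1) by (simp add: null_sets_distr_iff)
      then show ?thesis
        unfolding sets_completed_filt[OF s1]
        by (intro sigma_sets.Basic) (simp add: space_completed_filt'[OF s1] space_kernel[OF s1])
    qed
  qed
  note m1 = map[OF measurable_translate_path sets_kernel[OF sm] translate_law_def[of c P z]]
  note m2 = map[OF measurable_translate_path sets_translate_law translate_law_inverse]
  have sub: "subalgebra (completion (P' y)) (completed_filt P' y t)"
    if "strong_markov path_filt P'" "0 \<le> t" for P' :: "'d pt \<Rightarrow> 'd path measure" and y t
    using filtered_completed[OF that(1), of y] that(2) by (simp add: filtered_complete_prob_space_def)
  show ?thesis
  proof (rule filtered_isomorphism.intro)
    show "prob_space (completion (P (z + c)))" "prob_space (completion (translate_law c P z))"
      by (simp_all add: prob_space.prob_space_completion prob_space_kernel[OF sm] prob_space_translate_law)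
    show "translate_path c \<in> completed_filt (translate_law c P) z t \<rightarrow>\<^sub>M completed_filt P (z + c) t" for t
      by (rule filt[OF sm' sm conjunct1[OF m2] conjunct2[OF m2] measurable_translate_path_filt])
    show "translate_path (- c) \<in> completed_filt P (z + c) t \<rightarrow>\<^sub>M completed_filt (translate_law c P) z t" for t
      by (rule filt[OF sm sm' conjunct1[OF m1] conjunct2[OF m1] measurable_translate_path_filt])
    show "subalgebra (completion (P (z + c))) (completed_filt P (z + c) t)"
      "subalgebra (completion (translate_law c P z)) (completed_filt (translate_law c P) z t)"
      if "0 \<le> t" for t
      using sub[OF sm that] sub[OF sm' that] by blast+
  qed (simp_all add: conjunct1[OF m1] conjunct2[OF m1] conjunct1[OF m2] conjunct2[OF m2]
      space_kernel[OF sm] translate_path_inverse translate_path_inverse')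
qed

lemma solves_sde_translate:
  assumes sde: "solves_sde \<sigma> b P"
  shows "solves_sde (\<lambda>y. \<sigma> (y + c)) (\<lambda>y. b (y + c)) (translate_law c P)"
  unfolding solves_sde_def
proof (intro allI)
  fix t and x :: "real ^ 'd"
  obtain a e where c: "c = (a, e)" by (cases c)
  have zc: "(t, x) + c = (t + a, x + e)" by (simp add: c)
  interpret I: filtered_isomorphism "completion (P ((t, x) + c))" "completion (translate_law c P (t, x))"
    "completed_filt P ((t, x) + c)" "completed_filt (translate_law c P) (t, x)"
    "translate_path c" "translate_path (- c)"
    by (rule filtered_isomorphism_translate)
  obtain w J where w: "wiener (completion (P ((t, x) + c))) (completed_filt P ((t, x) + c)) w"
    and J: "ito_integral (completion (P ((t, x) + c))) (completed_filt P ((t, x) + c)) w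
       (\<lambda>r \<omega>. \<sigma> (t + a + r, snd (\<omega> r))) J"
    and AE: "AE \<omega> in completion (P ((t, x) + c)). \<forall>s\<ge>0.
           fst (\<omega> s) = t + a + s \<and>
           set_integrable lborel {0..s} (\<lambda>r. b (t + a + r, snd (\<omega> r))) \<and>
           snd (\<omega> s) = x + e + J s \<omega> + (LINT r:{0..s}|lborel. b (t + a + r, snd (\<omega> r)))"
    using sde unfolding solves_sde_def zc by blast
  have bs: "b (t + a + r, snd (translate_path c \<omega> r)) = b ((t + r, snd (\<omega> r)) + c)" if "0 \<le> r" for r \<omega>
    using that by (simp add: c algebra_simps)
  have "AE \<omega> in completion (translate_law c P (t, x)). \<forall>s\<ge>0.
           fst (\<omega> s) = t + s \<and>
           set_integrable lborel {0..s} (\<lambda>r. b ((t + r, snd (\<omega> r)) + c)) \<and>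
           snd (\<omega> s) = x + J s (translate_path c \<omega>) + (LINT r:{0..s}|lborel. b ((t + r, snd (\<omega> r)) + c))"
    using I.AE_transport[OF AE]
  proof eventually_elim
    case (elim \<omega>)
    show ?case
    proof (intro allI impI)
      fix s :: real assume s: "0 \<le> s"
      have f: "(\<lambda>r. indicat_real {0..s} r *\<^sub>R b (t + a + r, snd (translate_path c \<omega> r)))
          = (\<lambda>r. indicat_real {0..s} r *\<^sub>R b ((t + r, snd (\<omega> r)) + c))"
        by (rule ext) (simp add: bs indicator_def del: add_Pair translate_path_apply)
      show "fst (\<omega> s) = t + s \<and>
           set_integrable lborel {0..s} (\<lambda>r. b ((t + r, snd (\<omega> r)) + c)) \<and>
           snd (\<omega> s) = x + J s (translate_path c \<omega>) + (LINT r:{0..s}|lborel. b ((t + r, snd (\<omega> r)) + c))"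
        using elim[rule_format, OF s] s
        unfolding set_integrable_def set_lebesgue_integral_def f
        by (simp add: c algebra_simps)
    qed
  qed
  moreover have "ito_integral (completion (translate_law c P (t, x))) (completed_filt (translate_law c P) (t, x))
      (\<lambda>s \<omega>. w s (translate_path c \<omega>)) (\<lambda>r \<omega>. \<sigma> ((t + r, snd (\<omega> r)) + c)) (\<lambda>s \<omega>. J s (translate_path c \<omega>))"
    by (rule I.ito_integral_transport[OF J]) (simp add: c algebra_simps)
  ultimately show "\<exists>w J.
        wiener (completion (translate_law c P (t, x))) (completed_filt (translate_law c P) (t, x)) w \<and>
        ito_integral (completion (translate_law c P (t, x))) (completed_filt (translate_law c P) (t, x)) w
          (\<lambda>r \<omega>. \<sigma> ((t + r, snd (\<omega> r)) + c)) J \<and>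
        (AE \<omega> in completion (translate_law c P (t, x)). \<forall>s\<ge>0.
           fst (\<omega> s) = t + s \<and>
           set_integrable lborel {0..s} (\<lambda>r. b ((t + r, snd (\<omega> r)) + c)) \<and>
           snd (\<omega> s) = x + J s \<omega> + (LINT r:{0..s}|lborel. b ((t + r, snd (\<omega> r)) + c)))"
    using I.wiener_transport[OF w] by blast
qed

end

lemma markov_diffusion_translate:
  fixes h :: "'d::finite pt \<Rightarrow> real"
  assumes md: "markov_diffusion \<delta> p0 q0 h bb \<sigma> b P" and pq: "1 \<le> p0" "1 \<le> q0"
  shows "markov_diffusion \<delta> p0 q0 (\<lambda>y. h (y + c)) bb (\<lambda>y. \<sigma> (y + c)) (\<lambda>y. b (y + c)) (translate_law c P)"
proof -
  note D = markov_diffusionD[OF md]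
  have "(\<lambda>y. \<sigma> (y + c)) \<in> borel_measurable borel" "(\<lambda>y. b (y + c)) \<in> borel_measurable borel"
    using measurable_compose[OF _ D(4), of "\<lambda>y. y + c" borel] measurable_compose[OF _ D(6), of "\<lambda>y. y + c" borel]
    by simp_all
  moreover have "markov path_filt_plus (translate_law c P)"
    by (rule markov_translate[OF D(1,8) sets_path_filt_plus_subset space_path_filt_plus
          measurable_translate_path_filt_plus])
  ultimately show ?thesis
    unfolding markov_diffusion_def
    using drift_bound_translate[OF D(2) pq] D(5,7) strong_markov_translate[OF D(1)]
      solves_sde_translate[OF D(1,3)] by blast
qed

section \<open>Caloric functions and the decomposition of the solution\<close>

lemma closure_cyl2:
  "0 < T \<Longrightarrow> 0 < R \<Longrightarrow> closure (cyl2 T R z) = {fst z .. fst z + T} \<times> cball (snd z) R"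
  unfolding cyl2_def by (simp add: closure_Times)

text \<open>Cylinders are recovered from their closures, as the interior of a closed ball is the open one.\<close>

lemma cyl2_subset_of_closure:
  fixes z z' :: "'d::finite pt"
  assumes sub: "closure (cyl2 T' R' z') \<subseteq> closure (cyl2 T R z)" and pos: "0 < T'" "0 < R'" "0 < T" "0 < R"
  shows "cyl2 T' R' z' \<subseteq> cyl2 T R z"
proof -
  have "{fst z' .. fst z' + T'} \<times> cball (snd z') R' \<subseteq> {fst z .. fst z + T} \<times> cball (snd z) R"
    using sub pos by (simp add: closure_cyl2)
  moreover have "{fst z' .. fst z' + T'} \<noteq> {}" "cball (snd z') R' \<noteq> {}" using pos by auto
  ultimately have t: "{fst z' .. fst z' + T'} \<subseteq> {fst z .. fst z + T}"
    and c: "cball (snd z') R' \<subseteq> cball (snd z) R"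
    unfolding times_subset_iff by blast+
  have "ball (snd z') R' \<subseteq> ball (snd z) R" using interior_mono[OF c] by simp
  moreover have "{fst z' ..< fst z' + T'} \<subseteq> {fst z ..< fst z + T}" using t pos by auto
  ultimately show ?thesis unfolding cyl2_def by blast
qed

text \<open>The mean value property on a smaller cylinder is the tower property of the exit operators.\<close>

lemma caloric_exit_op:
  fixes v :: "'d::finite pt \<Rightarrow> real"
  assumes sm: "strong_markov path_filt P" and T: "0 < T" "0 < R"
    and v: "v \<in> borel_measurable borel" "\<And>y. \<bar>v y\<bar> \<le> K"
  shows "caloric P (closure (cyl2 T R z)) (exit_op P (cyl2 T R z) v)"
  unfolding caloric_def
proof (intro conjI allI impI ballI, safe)
  let ?C = "cyl2 T R z"
  note m = measurable_exit_op[OF sm T(1) v(1), of R z]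
  show "exit_op P ?C v \<in> borel_measurable (restrict_space borel (closure ?C))"
    by (rule measurable_restrict_space1[OF m])
  show "bounded (exit_op P ?C v ` closure ?C)"
  proof (rule boundedI)
    fix x assume "x \<in> exit_op P ?C v ` closure ?C"
    then obtain y where y: "y \<in> closure ?C" "x = exit_op P ?C v y" by blast
    show "norm x \<le> K" using exit_op_bound[OF sm T(1) y(1) v] y(2) by simp
  qed
  fix z' T' R' t x
  assume T': "0 < T'" "0 < R'" and sub: "closure (cyl2 T' R' z') \<subseteq> closure ?C" and y: "(t, x) \<in> cyl2 T' R' z'"
  have sub': "cyl2 T' R' z' \<subseteq> ?C" by (rule cyl2_subset_of_closure[OF sub T' T])
  have "exit_op P ?C v (t, x) = exit_op P (cyl2 T' R' z') (exit_op P ?C v) (t, x)"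
    by (rule exit_op_tower[OF sm T(1) T'(1) sub' v])
  also have "\<dots> = expec P (t, x) (\<lambda>\<omega>. exit_op P ?C v (exit_point (cyl2 T' R' z') (fst (t, x)) \<omega>))"
    using y closure_subset[of "cyl2 T' R' z'"]
    by (intro expec_exit_point[OF sm T'(1) _ m, symmetric]) auto
  finally show "exit_op P ?C v (t, x) = expec P (t, x) (\<lambda>\<omega>. exit_op P ?C v (exit_point (cyl2 T' R' z') t \<omega>))"
    by simp
qed

lemma exit_op_translate:
  fixes v :: "'d::finite pt \<Rightarrow> real"
  assumes sm: "strong_markov path_filt P" and T: "0 < T" and v: "v \<in> borel_measurable borel"
  shows "exit_op (translate_law c P) (cyl2 T R z) (\<lambda>y. v (y + c)) y = exit_op P (cyl2 T R (z + c)) v (y + c)"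
proof -
  let ?C = "cyl2 T R z" and ?C' = "cyl2 T R (z + c)"
  let ?S = "translate_path (- c)"
  have C: "x - c \<in> ?C \<longleftrightarrow> x \<in> ?C'" for x
    by (auto simp: cyl2_def mem_Times_iff dist_norm algebra_simps)
  have e: "?S \<omega> (exit_real ?C (?S \<omega>)) + c = \<omega> (exit_real ?C' \<omega>)" if w: "\<omega> \<in> paths" for \<omega>
  proof -
    have ex: "exits_at ?C' \<omega> (exit_real ?C' \<omega>)" by (rule exits_cyl2(1)[OF w T])
    then have "exits_at ?C (?S \<omega>) (exit_real ?C' \<omega>)" unfolding exits_at_def by (simp add: C)
    then have "exit_real ?C (?S \<omega>) = exit_real ?C' \<omega>" by (rule exit_real_eq)
    then show ?thesis using ex by (simp add: exits_at_def)
  qed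
  have "exit_op (translate_law c P) ?C (\<lambda>y. v (y + c)) y
      = (\<integral>\<omega>. v (?S \<omega> (exit_real ?C (?S \<omega>)) + c) \<partial>P (y + c))"
    unfolding exit_op_def translate_law_def
  proof (rule integral_distr[OF measurable_translate_kernel[OF sm]])
    have "(\<lambda>y. v (y + c)) \<in> borel_measurable borel" using measurable_compose[OF _ v, of "\<lambda>y. y + c"] by simp
    then show "(\<lambda>\<omega>. v (\<omega> (exit_real ?C \<omega>) + c)) \<in> borel_measurable path_space"
      by (rule measurable_compose[OF measurable_exit_point[OF T]])
  qed
  also have "\<dots> = exit_op P ?C' v (y + c)"
    unfolding exit_op_def
    by (rule Bochner_Integration.integral_cong) (simp_all add: e space_kernel[OF sm])
  finally show ?thesis .
qed

text \<open>The value function of the cylinder \<open>C\<close> for a right-hand side \<open>f\<close> and exit data \<open>g\<close>, given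
  on the whole space.\<close>

definition value_fun ::
  "('d::finite pt \<Rightarrow> 'd path measure) \<Rightarrow> 'd pt set \<Rightarrow> ('d pt \<Rightarrow> real) \<Rightarrow> ('d pt \<Rightarrow> real) \<Rightarrow> 'd pt \<Rightarrow> real" where
  "value_fun P C f g z = enn2real (green_op P C (\<lambda>y. ennreal (f y)) z)
     - enn2real (green_op P C (\<lambda>y. ennreal (- f y)) z) + exit_op P C g z"

context
  fixes P :: "'d::finite pt \<Rightarrow> 'd path measure" and f g :: "'d pt \<Rightarrow> real" and T R K Kg :: real and z :: "'d pt"
  assumes sm: "strong_markov path_filt P" and T: "0 < T"
    and f: "f \<in> borel_measurable borel"
    and K: "\<And>y. green_op P (cyl2 T R z) (\<lambda>y. ennreal (f y)) y \<le> ennreal K"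
      "\<And>y. green_op P (cyl2 T R z) (\<lambda>y. ennreal (- f y)) y \<le> ennreal K"
    and g: "g \<in> borel_measurable borel" "\<And>y. \<bar>g y\<bar> \<le> Kg"
begin

lemma green_real_bound:
  assumes "\<And>y. green_op P (cyl2 T R z) F y \<le> ennreal K"
  shows "\<bar>enn2real (green_op P (cyl2 T R z) F y)\<bar> \<le> max 0 K"
proof -
  have "green_op P (cyl2 T R z) F y \<le> ennreal (max 0 K)"
    using assms[of y] by (simp add: ennreal_max_0')
  from enn2real_mono[OF this ennreal_less_top] have "enn2real (green_op P (cyl2 T R z) F y) \<le> max 0 K"
    by (subst (asm) enn2real_ennreal) simp_all
  then show ?thesis by simp
qed

lemma exit_op_bound_all: "\<bar>exit_op P (cyl2 T R z) g y\<bar> \<le> Kg"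
proof (cases "y \<in> closure (cyl2 T R z)")
  case True
  then show ?thesis by (rule exit_op_bound[OF sm T _ g])
next
  case False
  then have "y \<notin> cyl2 T R z" using closure_subset by blast
  then show ?thesis using exit_op_outside[OF sm T _ g(1)] g(2) by simp
qed

lemma value_fun_bound: "\<bar>value_fun P (cyl2 T R z) f g y\<bar> \<le> 2 * max 0 K + Kg"
  unfolding value_fun_def
  using green_real_bound[OF K(1), of y] green_real_bound[OF K(2), of y] exit_op_bound_all[of y] by linarith

lemma measurable_value_fun: "value_fun P (cyl2 T R z) f g \<in> borel_measurable borel"
proof -
  have [measurable]: "green_op P (cyl2 T R z) (\<lambda>y. ennreal (f y)) \<in> borel_measurable borel"
    "green_op P (cyl2 T R z) (\<lambda>y. ennreal (- f y)) \<in> borel_measurable borel"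
    "exit_op P (cyl2 T R z) g \<in> borel_measurable borel"
    using f by (auto intro!: measurable_green_op[OF sm T] measurable_exit_op[OF sm T g(1)])
  show ?thesis unfolding value_fun_def by measurable
qed

text \<open>In a smaller cylinder the solution is the time integral over this cylinder plus the caloric function
  with the solution itself as exit data.\<close>

lemma value_fun_split:
  assumes T': "0 < T'" and sub: "cyl2 T' R' z' \<subseteq> cyl2 T R z"
  shows "value_fun P (cyl2 T R z) f g y = enn2real (green_op P (cyl2 T' R' z') (\<lambda>y. ennreal (f y)) y)
     - enn2real (green_op P (cyl2 T' R' z') (\<lambda>y. ennreal (- f y)) y)
     + exit_op P (cyl2 T' R' z') (value_fun P (cyl2 T R z) f g) y"
proof -
  let ?C = "cyl2 T R z" and ?C' = "cyl2 T' R' z'"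
  let ?G = "\<lambda>f x. enn2real (green_op P ?C (\<lambda>y. ennreal (f y)) x)" and ?m = "\<lambda>x. - f x"
  have fm: "(\<lambda>y. ennreal (f y)) \<in> borel_measurable borel" "(\<lambda>y. ennreal (- f y)) \<in> borel_measurable borel"
    using f by auto
  have Gm: "(\<lambda>x. ?G f x) \<in> borel_measurable borel" "(\<lambda>x. ?G ?m x) \<in> borel_measurable borel"
    using measurable_green_op[OF sm T fm(1), of R z] measurable_green_op[OF sm T fm(2), of R z] by measurable
  have Em: "exit_op P ?C g \<in> borel_measurable borel" by (rule measurable_exit_op[OF sm T g(1)])
  note int = exit_op_integrable[OF sm T' Gm(1) green_real_bound[OF K(1)], of y R' z']
    exit_op_integrable[OF sm T' Gm(2) green_real_bound[OF K(2)], of y R' z']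
    exit_op_integrable[OF sm T' Em exit_op_bound_all, of y R' z']
  have "exit_op P ?C' (value_fun P ?C f g) y
      = exit_op P ?C' (\<lambda>x. ?G f x) y - exit_op P ?C' (\<lambda>x. ?G ?m x) y + exit_op P ?C' (exit_op P ?C g) y"
    unfolding value_fun_def exit_op_def[of P ?C'] using int by simp
  moreover have "?G f y = enn2real (green_op P ?C' (\<lambda>y. ennreal (f y)) y) + exit_op P ?C' (\<lambda>x. ?G f x) y"
    by (rule green_op_split_real[OF sm T T' sub fm(1) K(1)])
  moreover have "?G ?m y = enn2real (green_op P ?C' (\<lambda>y. ennreal (- f y)) y) + exit_op P ?C' (\<lambda>x. ?G ?m x) y"
    by (rule green_op_split_real[OF sm T T' sub fm(2) K(2)])
  moreover have "exit_op P ?C g y = exit_op P ?C' (exit_op P ?C g) y"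
    by (rule exit_op_tower[OF sm T T' sub g])
  ultimately show ?thesis unfolding value_fun_def[of P ?C f g y] by simp
qed

lemma solution_eq_value_fun:
  assumes y: "y \<in> closure (cyl2 T R z)"
    and f': "\<And>x. x \<in> cyl2 T R z \<Longrightarrow> f' x = f x" and g': "\<And>x. x \<in> closure (cyl2 T R z) \<Longrightarrow> g' x = g x"
  shows "solution P (cyl2 T R z) f' g' y = value_fun P (cyl2 T R z) f g y"
  unfolding solution_def value_fun_def
  using K[of y] by (subst expec_occupation[OF sm T f f'], simp_all add: order_le_less_trans)
    (rule expec_exit_point[OF sm T y g(1) g'])

end

section \<open>Optimizing the radius\<close>

text \<open>The error \<open>r\<^bsup>\<kappa>/p\<^esup>\<close> of the time integral and the oscillation \<open>(\<rho>/r)\<^bsup>a\<^esup>\<close> of the caloric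
  part balance for \<open>2 r = R (\<rho>/R)\<^bsup>\<theta>\<^esup>\<close>, \<open>\<theta> = a p / (a p + \<kappa>)\<close>; both are then of the order
  \<open>(\<rho>/R)\<^bsup>\<beta>\<^esup>\<close>.  This radius exceeds \<open>\<rho>\<close> unless \<open>\<rho>/R\<close> is bounded away from \<open>0\<close>.\<close>

lemma optimal_radius:
  fixes a \<kappa> p A B S L R \<rho> osc :: real
  assumes a: "0 < a" "a \<le> 1" and \<kappa>: "0 < \<kappa>" and p: "0 < p" and nonneg: "0 \<le> A" "0 \<le> B" "0 \<le> S" "0 \<le> L"
    and R: "0 < R" and \<rho>: "0 < \<rho>" and triv: "osc \<le> 2 * S"
    and main: "\<And>r. 0 < r \<Longrightarrow> r \<le> R / 2 \<Longrightarrow> \<rho> < r \<Longrightarrow>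
      osc \<le> A * (r powr (- a) * \<rho> powr a) * S + B * (2 * r) powr (\<kappa> / p) * L"
  defines "\<beta> \<equiv> a * \<kappa> / (a * p + \<kappa>)"
  shows "osc \<le> (4 + 2 * A + B) * (R powr (- \<beta>) * \<rho> powr \<beta>) * (S + R powr (\<kappa> / p) * L)"
proof -
  define X where "X = \<rho> / R"
  define \<theta> where "\<theta> = a * p / (a * p + \<kappa>)"
  define \<eta> where "\<eta> = \<kappa> / (a * p + \<kappa>)"
  have den: "0 < a * p + \<kappa>" using a \<kappa> p by (simp add: add_pos_pos)
  have X: "0 < X" using R \<rho> by (simp add: X_def)
  have \<theta>\<eta>: "\<theta> + \<eta> = 1" "0 < \<theta>" "0 < \<eta>"
    using den a p \<kappa> by (simp_all add: \<theta>_def \<eta>_def add_divide_distrib[symmetric])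
  have \<beta>: "\<eta> * a = \<beta>" "\<theta> * (\<kappa> / p) = \<beta>"
    using p by (simp_all add: \<eta>_def \<theta>_def \<beta>_def mult.commute)
  have X\<beta>: "R powr (- \<beta>) * \<rho> powr \<beta> = X powr \<beta>"
    using R \<rho> by (simp add: X_def powr_divide powr_minus_divide)
  have Lk: "0 \<le> R powr (\<kappa> / p) * L" using nonneg by simp
  have X\<beta>0: "0 \<le> X powr \<beta>" by simp
  show ?thesis
  proof (cases "X powr \<eta> < 1 / 2")
    case False
    have "(1 / 2) powr 1 \<le> (1 / 2 :: real) powr a" using a by (intro powr_mono') auto
    also have "\<dots> \<le> (X powr \<eta>) powr a" using False a by (intro powr_mono2) auto
    also have "\<dots> = X powr \<beta>" by (simp add: powr_powr \<beta>)
    finally have half: "1 / 2 \<le> X powr \<beta>" by simp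
    have "osc \<le> 2 * S" by (rule triv)
    also have "\<dots> \<le> (4 * X powr \<beta>) * S" using half nonneg by (intro mult_right_mono) auto
    also have "\<dots> \<le> ((4 + 2 * A + B) * X powr \<beta>) * (S + R powr (\<kappa> / p) * L)"
      using nonneg Lk by (intro mult_mono mult_right_mono) auto
    finally show ?thesis unfolding X\<beta> .
  next
    case True
    define r where "r = R / 2 * X powr \<theta>"
    have "X < 1"
    proof (rule ccontr)
      assume "\<not> X < 1"
      then have "1 \<le> X powr \<eta>" using \<theta>\<eta> by (intro ge_one_powr_ge_zero) auto
      then show False using True by simp
    qed
    then have "X powr \<theta> \<le> 1" using X \<theta>\<eta> by (intro powr_le1) auto
    then have rR: "r \<le> R / 2" using R by (simp add: r_def)
    have r0: "0 < r" using R X by (simp add: r_def)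
    have XX: "X = X powr \<theta> * X powr \<eta>" using X \<theta>\<eta> by (simp add: powr_add[symmetric])
    have "X powr \<theta> * X powr \<eta> < X powr \<theta> * (1 / 2)" using True X by (intro mult_strict_left_mono) auto
    then have "R * X < R * (X powr \<theta> * (1 / 2))" using XX R by (intro mult_strict_left_mono) auto
    then have \<rho>r: "\<rho> < r" using R by (simp add: X_def r_def)
    have "\<rho> / r = 2 * X powr \<eta>"
    proof -
      have "\<rho> = R * X" using R by (simp add: X_def)
      also have "\<dots> = 2 * X powr \<eta> * r" by (subst XX) (simp add: r_def)
      finally show ?thesis using r0 by simp
    qed
    then have "r powr (- a) * \<rho> powr a = (2 * X powr \<eta>) powr a"
      using r0 \<rho> by (simp add: powr_divide[symmetric] powr_minus_divide)
    also have "\<dots> = 2 powr a * X powr \<beta>" by (simp add: powr_mult powr_powr \<beta>)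
    also have "\<dots> \<le> 2 * X powr \<beta>"
    proof -
      have "2 powr a \<le> (2 :: real) powr 1" using a by (intro powr_mono) auto
      then show ?thesis by (intro mult_right_mono) auto
    qed
    finally have 1: "r powr (- a) * \<rho> powr a \<le> 2 * X powr \<beta>" .
    have 2: "(2 * r) powr (\<kappa> / p) = R powr (\<kappa> / p) * X powr \<beta>"
      using R by (simp add: r_def powr_mult powr_powr \<beta>(2)[symmetric])
    have "osc \<le> A * (r powr (- a) * \<rho> powr a) * S + B * (2 * r) powr (\<kappa> / p) * L"
      by (rule main[OF r0 rR \<rho>r])
    also have "\<dots> \<le> A * (2 * X powr \<beta>) * S + B * (R powr (\<kappa> / p) * X powr \<beta>) * L"
      unfolding 2 using 1 nonneg by (intro add_mono mult_right_mono mult_left_mono) auto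
    also have "\<dots> = X powr \<beta> * (2 * A * S + B * (R powr (\<kappa> / p) * L))" by (simp add: algebra_simps)
    also have "\<dots> \<le> X powr \<beta> * ((4 + 2 * A + B) * S + (4 + 2 * A + B) * (R powr (\<kappa> / p) * L))"
      using nonneg Lk by (intro mult_left_mono add_mono mult_right_mono) auto
    finally show ?thesis unfolding X\<beta> by (simp add: algebra_simps)
  qed
qed

section \<open>The Hoelder estimate of the solution\<close>

lemma exponent_relation:
  assumes p: "1 \<le> p" and q: "1 \<le> q" and eq: "ereal d0 / p + 1 / q = 1"
  shows "1 - d0 * recip p - recip q = 0"
proof -
  have r: "recip s = (if s = \<infinity> then 0 else 1 / real_of_ereal s)" if "1 \<le> s" for s
    using that by (cases s) (auto simp: recip_def one_ereal_def)
  show ?thesis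
    using p q eq unfolding r[OF p] r[OF q]
    by (cases p; cases q) (auto simp: one_ereal_def zero_ereal_def)
qed

lemma rho_eq_0: "rho z1 z2 = 0 \<longleftrightarrow> z1 = z2"
proof -
  have "rho z1 z2 = 0 \<longleftrightarrow> norm (snd z1 - snd z2) = 0 \<and> sqrt \<bar>fst z1 - fst z2\<bar> = 0"
    unfolding rho_def by (rule add_nonneg_eq_0_iff) auto
  then show ?thesis by (auto simp: prod_eq_iff)
qed

lemma rho_nonneg: "0 \<le> rho z1 z2"
  by (simp add: rho_def)

lemma rho_commute: "rho z1 z2 = rho z2 z1"
  by (simp add: rho_def norm_minus_commute abs_minus_commute)

lemma mem_cyl: "y \<in> cyl R z \<longleftrightarrow>
    fst z \<le> fst y \<and> fst y < fst z + R\<^sup>2 \<and> norm (snd y - snd z) < R"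
  by (auto simp: cyl_def cyl2_def mem_Times_iff dist_norm norm_minus_commute)

lemma cyl_subset_double:
  assumes R: "0 < R" shows "cyl R (0, 0) \<subseteq> (cyl (2 * R) (0, 0) :: 'd::finite pt set)"
proof
  fix y :: "'d pt" assume "y \<in> cyl R (0, 0)"
  moreover have "R\<^sup>2 \<le> (2 * R)\<^sup>2" using R by (intro power_mono) auto
  ultimately show "y \<in> cyl (2 * R) (0, 0)" using R by (auto simp: mem_cyl)
qed

lemma abs_le_sup_abs: "z \<in> A \<Longrightarrow> ennreal \<bar>u z\<bar> \<le> sup_abs A u"
  unfolding sup_abs_def by (rule SUP_upper)

definition caloric_hoelder_estimate ::
  "'d::finite itself \<Rightarrow> real \<Rightarrow> real \<Rightarrow> real \<Rightarrow> real \<Rightarrow> real \<Rightarrow> real \<Rightarrow> real \<Rightarrow> real \<Rightarrow> real \<Rightarrow> bool" where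
  "caloric_hoelder_estimate _ \<delta> p0 q0 Nb Ru Rb B a N \<longleftrightarrow>
     (\<forall>(h :: 'd pt \<Rightarrow> real) bb \<sigma> b P.
        markov_diffusion \<delta> p0 q0 h bb \<sigma> b P \<longrightarrow> Nb * bb Ru < 1 \<longrightarrow> bb Rb = B \<longrightarrow>
        (\<forall>R\<in>{0<..Rb}. \<forall>u. caloric P (closure (cyl (2 * R) (0, 0))) u \<longrightarrow>
           (\<forall>z1\<in>cyl R (0, 0). \<forall>z2\<in>cyl R (0, 0).
              ennreal \<bar>u z1 - u z2\<bar> \<le>
              ennreal (N * R powr (- a) * rho z1 z2 powr a) * sup_abs (closure (cyl (2 * R) (0, 0))) u)))"

text \<open>For two points at distance less than \<open>r\<close> the solution is split in the cylinder \<open>C\<close> of radius \<open>2 r\<close>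
  based at the earlier one: \<open>D\<close> is the time integral over \<open>C\<close> and \<open>w\<close> the caloric part.\<close>

lemma solution_hoelder:
  fixes P :: "'d::finite pt \<Rightarrow> 'd path measure" and h f g :: "'d pt \<Rightarrow> real" and p q :: ereal
  assumes est: "time_integral_estimate TYPE('d) \<delta> p0 q0 Nb Ru Rb B p q (\<kappa> / p') K"
    and hoelder: "caloric_hoelder_estimate TYPE('d) \<delta> p0 q0 Nb Ru Rb B a N"
    and md: "markov_diffusion \<delta> p0 q0 h bb \<sigma> b P" and bb: "Nb * bb Ru < 1" "bb Rb = B"
    and pq0: "1 \<le> p0" "1 \<le> q0" and p: "p = ereal p'" "1 \<le> p'" and q: "1 \<le> q"
    and a: "0 < a" "a \<le> 1" and \<kappa>: "0 < \<kappa>" and R: "0 < R" "R \<le> Rb / 2"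
    and g: "g \<in> borel_measurable (restrict_space borel (closure (cyl (2 * R) (0, 0))))"
      "bounded (g ` closure (cyl (2 * R) (0, 0)))"
    and f: "f \<in> Lpq p q (cyl (2 * R) (0, 0))"
    and z: "z1 \<in> cyl R (0, 0)" "z2 \<in> cyl R (0, 0)" "fst z1 \<le> fst z2"
  defines "u \<equiv> solution P (cyl (2 * R) (0, 0)) f g" and "\<beta> \<equiv> a * \<kappa> / (a * p' + \<kappa>)"
  shows "ennreal \<bar>u z1 - u z2\<bar> \<le>
    ennreal ((4 + 2 * max 0 N + 2 * max 0 K) * R powr (- \<beta>) * rho z1 z2 powr \<beta>) *
      (sup_abs (closure (cyl (2 * R) (0, 0))) u
        + ennreal (R powr (\<kappa> / p')) * Lpq_norm p q (cyl (2 * R) (0, 0)) f)"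
proof (cases "z1 = z2")
  case False
  note sm = markov_diffusionD(1)[OF md]
  let ?Q = "cyl (2 * R) (0, 0) :: 'd pt set"
  have pq: "1 \<le> p" "p \<noteq> \<infinity>" using p by (auto simp: one_ereal_def)
  have cyl: "cyl r y = cyl2 (r\<^sup>2) r y" for r and y :: "'d pt" by (simp add: cyl_def)
  have [measurable]: "cyl r y \<in> sets borel" for r and y :: "'d pt" by (simp add: cyl)
  have TQ: "0 < (2 * R)\<^sup>2" using R by simp
  define f0 where "f0 y = indicator ?Q y * f y" for y
  define g0 where "g0 y = indicator (closure ?Q) y * g y" for y
  define L where "L = enn2real (Lpq_norm p q ?Q f)"
  have fL: "f \<in> borel_measurable (restrict_space borel ?Q)" "Lpq_norm p q ?Q f < \<infinity>"
    using f by (auto simp: Lpq_def)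
  have L: "Lpq_norm p q ?Q f = ennreal L" "0 \<le> L"
    using fL(2) by (simp_all add: L_def ennreal_enn2real)
  have f0m: "f0 \<in> borel_measurable borel"
    using fL(1) unfolding f0_def by (subst (asm) borel_measurable_restrict_space_iff) auto
  have g0m: "g0 \<in> borel_measurable borel"
    using g(1) unfolding g0_def by (subst (asm) borel_measurable_restrict_space_iff) auto
  obtain Kg where Kg: "\<And>y. y \<in> closure ?Q \<Longrightarrow> \<bar>g y\<bar> \<le> Kg" using g(2) by (auto simp: bounded_iff)
  have g0b: "\<bar>g0 y\<bar> \<le> max 0 Kg" for y using Kg[of y] by (auto simp: g0_def indicator_def)
  (* the signs e = 1 and e = -1 give the positive and the negative part of f *)
  have parts: "green_op P (cyl r c) (\<lambda>y. ennreal (e * f0 y)) y \<le> ennreal (max 0 K * r powr (\<kappa> / p') * L)"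
    if r: "0 < r" "r \<le> Rb" and c: "cyl r c \<subseteq> ?Q" and e: "\<bar>e\<bar> = 1" for r c e y
  proof (cases "y \<in> cyl r c")
    case True
    let ?F = "\<lambda>y. max 0 (e * f0 y)"
    have Fm: "?F \<in> borel_measurable borel" using f0m by measurable
    have "green_op P (cyl r c) (\<lambda>y. ennreal (e * f0 y)) y = green_op P (cyl r c) (\<lambda>y. ennreal (?F y)) y"
      by (simp add: ennreal_max_0')
    also have "\<dots> \<le> ennreal (K * r powr (\<kappa> / p')) * Lpq_norm p q (cyl r c) ?F"
      by (rule green_op_bound[OF est md bb pq0 pq q r Fm _ True]) simp
    also have "\<dots> \<le> ennreal (max 0 K * r powr (\<kappa> / p')) * Lpq_norm p q ?Q f"
    proof (rule mult_mono[OF _ Lpq_norm_le_translate[OF pq q, where c=0]])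
      show "ennreal (K * r powr (\<kappa> / p')) \<le> ennreal (max 0 K * r powr (\<kappa> / p'))"
        by (intro ennreal_leI mult_right_mono) auto
      show "(\<lambda>z. indicator (cyl r c) z * ?F z) \<in> borel_measurable borel" using Fm by measurable
      have "\<bar>e * t\<bar> = \<bar>t\<bar>" for t using e by (simp add: abs_mult)
      then have "\<bar>max 0 (e * t)\<bar> \<le> \<bar>t\<bar>" for t by (smt (verit))
      then show "indicator (cyl r c) z * \<bar>?F z\<bar> \<le> indicator ?Q (z + 0) * \<bar>f (z + 0)\<bar>" for z
        using c by (auto simp: f0_def indicator_def)
    qed auto
    also have "\<dots> = ennreal (max 0 K * r powr (\<kappa> / p') * L)"
      unfolding L(1) using L(2) by (simp add: ennreal_mult)
    finally show ?thesis .
  next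
    case False
    then show ?thesis using green_op_outside[OF sm, of "r\<^sup>2" y r c] r(1) by (simp add: cyl)
  qed
  define KQ where "KQ = max 0 K * (2 * R) powr (\<kappa> / p') * L"
  have KQ: "green_op P (cyl2 ((2 * R)\<^sup>2) (2 * R) (0, 0)) (\<lambda>y. ennreal (f0 y)) y \<le> ennreal KQ"
    "green_op P (cyl2 ((2 * R)\<^sup>2) (2 * R) (0, 0)) (\<lambda>y. ennreal (- f0 y)) y \<le> ennreal KQ" for y
    using parts[of "2 * R" "(0, 0)" 1 y] parts[of "2 * R" "(0, 0)" "- 1" y] R
    by (simp_all add: cyl KQ_def)
  define v where "v = value_fun P ?Q f0 g0"
  have uv: "u y = v y" if "y \<in> closure ?Q" for y
    unfolding u_def v_def cyl
    by (rule solution_eq_value_fun[OF sm TQ f0m KQ g0m g0b])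
      (use that in \<open>auto simp: cyl f0_def g0_def\<close>)
  have vm: "v \<in> borel_measurable borel"
    unfolding v_def cyl by (rule measurable_value_fun[OF sm TQ f0m KQ g0m g0b])
  define Kv where "Kv = 2 * max 0 KQ + max 0 Kg"
  have vb: "\<bar>v y\<bar> \<le> Kv" for y
    unfolding v_def cyl Kv_def by (rule value_fun_bound[OF sm TQ f0m KQ g0m g0b])
  define S where "S = enn2real (sup_abs (closure ?Q) u)"
  have "sup_abs (closure ?Q) u \<le> ennreal Kv"
    unfolding sup_abs_def by (rule SUP_least) (auto simp: uv intro!: ennreal_leI vb)
  then have S: "sup_abs (closure ?Q) u = ennreal S" "0 \<le> S"
    by (simp_all add: S_def ennreal_enn2real order_le_less_trans)
  have uS: "\<bar>v y\<bar> \<le> S" if "y \<in> closure ?Q" for y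
  proof -
    have "ennreal \<bar>u y\<bar> \<le> sup_abs (closure ?Q) u" by (rule abs_le_sup_abs[OF that])
    then show ?thesis using S by (simp add: uv[OF that] ennreal_le_iff)
  qed
  have sub: "cyl R (0, 0) \<subseteq> ?Q" by (rule cyl_subset_double[OF R(1)])
  have zQ: "z1 \<in> closure ?Q" "z2 \<in> closure ?Q" using z sub closure_subset by blast+
  have \<rho>: "0 < rho z1 z2" using rho_nonneg[of z1 z2] rho_eq_0[of z1 z2] False by linarith
  have "\<bar>v z1 - v z2\<bar> \<le> (4 + 2 * max 0 N + 2 * max 0 K) * (R powr (- \<beta>) * rho z1 z2 powr \<beta>)
      * (S + R powr (\<kappa> / p') * L)"
    unfolding \<beta>_def
  proof (rule optimal_radius[OF a \<kappa> _ _ _ S(2) L(2) R(1) \<rho>])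
    show "0 < p'" "0 \<le> max 0 N" "0 \<le> 2 * max 0 K" using p by auto
    show "\<bar>v z1 - v z2\<bar> \<le> 2 * S" using uS[OF zQ(1)] uS[OF zQ(2)] by linarith
    fix r assume r: "0 < r" "r \<le> R / 2" "rho z1 z2 < r"
    (* a cylinder extends into the future only, so it is based at the earlier point *)
    let ?C = "cyl (2 * r) z1"
    have TC: "0 < (2 * r)\<^sup>2" using r by simp
    have CQ: "?C \<subseteq> ?Q"
    proof
      fix y assume y: "y \<in> ?C"
      have "(2 * r)\<^sup>2 \<le> R\<^sup>2" using r by (intro power_mono) auto
      moreover have "norm (snd y) \<le> norm (snd y - snd z1) + norm (snd z1)"
        using norm_triangle_ineq[of "snd y - snd z1" "snd z1"] by simp
      moreover have "0 \<le> R\<^sup>2" "(2 * R)\<^sup>2 = 4 * R\<^sup>2" by (simp_all add: power2_eq_square)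
      ultimately show "y \<in> ?Q" using y z(1) r R by (auto simp: mem_cyl)
    qed
    have z2C: "z2 - z1 \<in> cyl r (0, 0)" "0 \<in> cyl r (0 :: real, 0 :: real ^ 'd)"
    proof -
      have "sqrt \<bar>fst z1 - fst z2\<bar> < r" "norm (snd z2 - snd z1) < r"
        using r(3) unfolding rho_def by (smt (verit) norm_ge_zero norm_minus_commute real_sqrt_ge_zero abs_ge_zero)+
      moreover from this have "(sqrt \<bar>fst z1 - fst z2\<bar>)\<^sup>2 < r\<^sup>2" by (intro power_strict_mono) auto
      ultimately show "z2 - z1 \<in> cyl r (0, 0)" using z(3) by (simp add: mem_cyl)
    qed (use r in \<open>simp add: mem_cyl\<close>)
    have in_C: "y + z1 \<in> ?C" if "y \<in> cyl r (0, 0)" for y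
    proof -
      have "r\<^sup>2 \<le> (2 * r)\<^sup>2" using r by (intro power_mono) auto
      then show ?thesis using that r by (auto simp: mem_cyl)
    qed
    have zC: "z1 \<in> ?C" "z2 \<in> ?C" using in_C[OF z2C(1)] in_C[OF z2C(2)] by simp_all
    define w where "w = exit_op P ?C v"
    define D where "D y = enn2real (green_op P ?C (\<lambda>y. ennreal (f0 y)) y)
       - enn2real (green_op P ?C (\<lambda>y. ennreal (- f0 y)) y)" for y
    have split: "v y = D y + w y" for y
      unfolding D_def w_def unfolding v_def cyl
      by (rule value_fun_split[OF sm TQ f0m KQ g0m g0b TC]) (use CQ in \<open>simp add: cyl\<close>)
    have D: "\<bar>D y\<bar> \<le> max 0 K * (2 * r) powr (\<kappa> / p') * L" for y
    proof -
      have r2: "0 < 2 * r" "2 * r \<le> Rb" using r R by auto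
      have nn: "0 \<le> max 0 K * (2 * r) powr (\<kappa> / p') * L" using L by simp
      have "enn2real (green_op P ?C (\<lambda>y. ennreal (e * f0 y)) y) \<le> max 0 K * (2 * r) powr (\<kappa> / p') * L"
        if "\<bar>e\<bar> = 1" for e
        using enn2real_mono[OF parts[OF r2 CQ that, of y]] nn by simp
      from this[of 1] this[of "- 1"]
      have "enn2real (green_op P ?C (\<lambda>y. ennreal (f0 y)) y) \<le> max 0 K * (2 * r) powr (\<kappa> / p') * L"
        "enn2real (green_op P ?C (\<lambda>y. ennreal (- f0 y)) y) \<le> max 0 K * (2 * r) powr (\<kappa> / p') * L"
        by simp_all
      then show ?thesis unfolding D_def abs_le_iff
        using enn2real_nonneg[of "green_op P ?C (\<lambda>y. ennreal (f0 y)) y"]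
          enn2real_nonneg[of "green_op P ?C (\<lambda>y. ennreal (- f0 y)) y"] by linarith
    qed
    (* the Hoelder estimate of caloric functions concerns cylinders based at the origin *)
    let ?P' = "translate_law z1 P"
    define w' where "w' y = w (y + z1)" for y
    have w'_eq: "w' = exit_op ?P' (cyl (2 * r) (0, 0)) (\<lambda>y. v (y + z1))"
      using exit_op_translate[OF sm TC vm, of z1 "2 * r" "(0, 0)"]
      by (auto simp: w'_def w_def cyl zero_prod_def[symmetric])
    have "caloric ?P' (closure (cyl (2 * r) (0, 0))) w'"
      unfolding w'_eq cyl
    proof (rule caloric_exit_op[OF strong_markov_translate[OF sm] TC, where K=Kv])
      show "(\<lambda>y. v (y + z1)) \<in> borel_measurable borel"
        using measurable_compose[OF _ vm, of "\<lambda>y. y + z1" borel] by simp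
    qed (use r vb in auto)
    from hoelder[unfolded caloric_hoelder_estimate_def, rule_format,
        OF markov_diffusion_translate[OF md pq0, of z1] bb _ this z2C(2,1)]
    have "ennreal \<bar>w' 0 - w' (z2 - z1)\<bar> \<le> ennreal (N * r powr (- a) * rho 0 (z2 - z1) powr a) *
        sup_abs (closure (cyl (2 * r) (0, 0))) w'" using r R by simp
    also have "rho 0 (z2 - z1) = rho z1 z2"
      by (simp add: rho_def norm_minus_commute abs_minus_commute)
    also have "sup_abs (closure (cyl (2 * r) (0, 0))) w' \<le> ennreal S"
      unfolding sup_abs_def
    proof (rule SUP_least, rule ennreal_leI)
      fix y :: "'d pt" assume y: "y \<in> closure (cyl (2 * r) (0, 0))"
      have "\<bar>v (x + z1)\<bar> \<le> S" if x: "x \<in> closure (cyl2 ((2 * r)\<^sup>2) (2 * r) (0, 0))" for x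
      proof -
        have "x + z1 \<in> closure ?C"
          using x r by (auto simp: cyl closure_cyl2 mem_Times_iff dist_norm norm_minus_commute)
        then show ?thesis using uS closure_mono[OF CQ] by blast
      qed
      then show "\<bar>w' y\<bar> \<le> S"
        unfolding w'_eq cyl
        using measurable_compose[OF _ vm, of "\<lambda>y. y + z1" borel] y
        by (intro exit_op_bound[OF strong_markov_translate[OF sm] TC]) (auto simp: cyl)
    qed
    finally have "ennreal \<bar>w' 0 - w' (z2 - z1)\<bar> \<le> ennreal (N * r powr (- a) * rho z1 z2 powr a) * ennreal S"
      by (simp add: mult_left_mono)
    also have "\<dots> \<le> ennreal (max 0 N * (r powr (- a) * rho z1 z2 powr a)) * ennreal S"
      by (intro mult_right_mono ennreal_leI) (auto simp: mult.assoc intro!: mult_right_mono)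
    also have "\<dots> = ennreal (max 0 N * (r powr (- a) * rho z1 z2 powr a) * S)"
      using S(2) by (subst ennreal_mult[symmetric]) auto
    finally have "\<bar>w' 0 - w' (z2 - z1)\<bar> \<le> max 0 N * (r powr (- a) * rho z1 z2 powr a) * S"
      using S(2) by (subst (asm) ennreal_le_iff) auto
    then have "\<bar>w z1 - w z2\<bar> \<le> max 0 N * (r powr (- a) * rho z1 z2 powr a) * S"
      by (simp add: w'_def)
    then show "\<bar>v z1 - v z2\<bar> \<le> max 0 N * (r powr (- a) * rho z1 z2 powr a) * S
        + 2 * max 0 K * (2 * r) powr (\<kappa> / p') * L"
      using D[of z1] D[of z2] unfolding split by (simp add: algebra_simps)
  qed
  then have "ennreal \<bar>u z1 - u z2\<bar> \<le> ennreal ((4 + 2 * max 0 N + 2 * max 0 K) * R powr (- \<beta>) * rho z1 z2 powr \<beta>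
      * (S + R powr (\<kappa> / p') * L))"
    by (simp only: uv[OF zQ(1)] uv[OF zQ(2)] mult.assoc ennreal_leI)
  also have "\<dots> = ennreal ((4 + 2 * max 0 N + 2 * max 0 K) * R powr (- \<beta>) * rho z1 z2 powr \<beta>)
      * (ennreal S + ennreal (R powr (\<kappa> / p')) * ennreal L)"
    using S(2) L(2) by (subst ennreal_mult) (auto simp: ennreal_mult ennreal_plus)
  finally show ?thesis by (simp only: S(1) L(1))
qed simp

theorem theorem4p6:
  fixes \<delta> p0 q0 Ru Rb B d0 \<alpha>0 :: real
    and xi :: "real \<Rightarrow> real" and Nb :: "real \<Rightarrow> real \<Rightarrow> real"
    and p q :: ereal
  assumes "2 \<le> CARD('d::finite)"
    and "0 < \<delta>" and "\<delta> < 1"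
    and "admissible_exponents TYPE('d) p0 q0"
    and "basic_constants TYPE('d) xi Nb"
    and "0 < Ru" and "Ru \<le> Rb"
    and "d0_constant TYPE('d) \<delta> p0 q0 (xi \<delta>) (Nb p0 \<delta>) Ru d0"
    and "alpha0_constant TYPE('d) \<delta> p0 q0 (Nb p0 \<delta>) Ru Rb B \<alpha>0"
    and "1 \<le> p" and "1 \<le> q" and "ereal d0 / p + 1 / q = 1"
  shows "\<exists>N::real. \<forall>(h :: 'd pt \<Rightarrow> real) bb \<sigma> b P.
    markov_diffusion \<delta> p0 q0 h bb \<sigma> b P \<longrightarrow> Nb p0 \<delta> * bb Ru < 1 \<longrightarrow> bb Rb = B \<longrightarrow>
    (\<forall>R\<in>{0<..Rb / 2}. \<forall>f g.
       g \<in> borel_measurable (restrict_space borel (closure (cyl (2 * R) (0, 0)))) \<longrightarrow>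
       bounded (g ` closure (cyl (2 * R) (0, 0))) \<longrightarrow>
       f \<in> Lpq p q (cyl (2 * R) (0, 0)) \<longrightarrow>
       (let u = solution P (cyl (2 * R) (0, 0)) f g;
            \<beta> = holder_exponent (real CARD('d)) d0 \<alpha>0 p in
        \<forall>z1\<in>cyl R (0, 0). \<forall>z2\<in>cyl R (0, 0).
          ennreal \<bar>u z1 - u z2\<bar> \<le>
          ennreal (N * R powr (- \<beta>) * rho z1 z2 powr \<beta>) *
            (sup_abs (closure (cyl (2 * R) (0, 0))) u +
             ennreal (R powr ((2 * d0 - real CARD('d)) * recip p)) *
               Lpq_norm p q (cyl (2 * R) (0, 0)) f)))"
proof (cases "p = \<infinity>")
  case True
  have triv: "ennreal \<bar>u z1 - u z2\<bar> \<le> ennreal (2 * R powr (- 0) * rho z1 z2 powr 0) *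
      (sup_abs (closure (cyl (2 * R) (0, 0))) u + E)"
    if R: "0 < R" and z: "z1 \<in> cyl R (0, 0)" "z2 \<in> cyl R (0, 0)"
    for u :: "'d pt \<Rightarrow> real" and E R z1 z2
  proof (cases "z1 = z2")
    case False
    let ?S = "sup_abs (closure (cyl (2 * R) (0, 0))) u"
    have "z1 \<in> closure (cyl (2 * R) (0, 0))" "z2 \<in> closure (cyl (2 * R) (0, 0))"
      using cyl_subset_double[OF R] z closure_subset[of "cyl (2 * R) (0, 0) :: 'd pt set"] by auto
    then have S: "ennreal \<bar>u z1\<bar> \<le> ?S" "ennreal \<bar>u z2\<bar> \<le> ?S"
      by (simp_all add: abs_le_sup_abs)
    have "ennreal \<bar>u z1 - u z2\<bar> \<le> ennreal \<bar>u z1\<bar> + ennreal \<bar>u z2\<bar>"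
      by (subst ennreal_plus[symmetric]) (auto simp del: ennreal_plus intro!: ennreal_leI)
    also have "\<dots> \<le> ?S + ?S" by (rule add_mono[OF S])
    also have "\<dots> \<le> (?S + E) + (?S + E)" by (intro add_mono) simp_all
    also have "\<dots> = 2 * (?S + E)" by (simp only: mult_2)
    finally show ?thesis using R False by (simp add: rho_eq_0 powr_zero_eq_one)
  qed simp
  show ?thesis
    unfolding Let_def
  proof (intro exI[of _ 2] allI impI ballI)
    fix R and z1 z2 :: "'d pt" and f g :: "'d pt \<Rightarrow> real" and P :: "'d pt \<Rightarrow> 'd path measure"
    assume "R \<in> {0<..Rb / 2}" "z1 \<in> cyl R (0, 0)" "z2 \<in> cyl R (0, 0)"
    moreover let ?u = "solution P (cyl (2 * R) (0, 0)) f g" and ?\<beta> = "holder_exponent (real CARD('d)) d0 \<alpha>0 p"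
    have "?\<beta> = 0"
      using True by (simp add: holder_exponent_def)
    ultimately show "ennreal \<bar>?u z1 - ?u z2\<bar> \<le>
        ennreal (2 * R powr (- ?\<beta>)
          * rho z1 z2 powr ?\<beta>) *
        (sup_abs (closure (cyl (2 * R) (0, 0))) (?u) +
         ennreal (R powr ((2 * d0 - real CARD('d)) * recip p)) * Lpq_norm p q (cyl (2 * R) (0, 0)) f)"
      by (simp only:) (rule triv, auto)
  qed
next
  case False
  then obtain p' where p': "p = ereal p'" "1 \<le> p'" using \<open>1 \<le> p\<close> by (cases p) (auto simp: one_ereal_def)
  let ?\<kappa> = "2 * d0 - real CARD('d)"
  have \<kappa>: "0 < ?\<kappa>" using assms(8) by (simp add: d0_constant_def)
  have rp: "?\<kappa> * recip p = ?\<kappa> / p'" using p' by (simp add: recip_def one_ereal_def)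
  have pq0: "1 \<le> p0" "1 \<le> q0" using assms(4) by (simp_all add: admissible_exponents_def)
  have "\<forall>p\<ge>1. \<forall>q\<ge>1. \<forall>Rb\<ge>Ru. \<forall>B. 1 - d0 * recip p - recip q = 0 \<longrightarrow>
      (\<exists>K. time_integral_estimate TYPE('d) \<delta> p0 q0 (Nb p0 \<delta>) Ru Rb B p q (?\<kappa> * recip p) K)"
    using assms(8) unfolding d0_constant_def time_integral_estimate_def by (elim conjE)
  then have "\<exists>K. time_integral_estimate TYPE('d) \<delta> p0 q0 (Nb p0 \<delta>) Ru Rb B p q (?\<kappa> * recip p) K"
    using exponent_relation[OF assms(10-12)] assms(7,10,11) by blast
  then obtain K where K: "time_integral_estimate TYPE('d) \<delta> p0 q0 (Nb p0 \<delta>) Ru Rb B p q (?\<kappa> / p') K"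
    unfolding rp by blast
  have a: "0 < \<alpha>0" "\<alpha>0 < 1" using assms(9) by (simp_all add: alpha0_constant_def)
  then have \<alpha>0: "\<alpha>0 \<in> {0<..\<alpha>0}" by simp
  obtain N where N0: "\<forall>(h :: 'd pt \<Rightarrow> real) bb \<sigma> b P.
        markov_diffusion \<delta> p0 q0 h bb \<sigma> b P \<longrightarrow> Nb p0 \<delta> * bb Ru < 1 \<longrightarrow> bb Rb = B \<longrightarrow>
        (\<forall>R\<in>{0<..Rb}. \<forall>u. caloric P (closure (cyl (2 * R) (0, 0))) u \<longrightarrow>
           (\<forall>z1\<in>cyl R (0, 0). \<forall>z2\<in>cyl R (0, 0). \<forall>\<alpha>\<in>{0<..\<alpha>0}.
              ennreal \<bar>u z1 - u z2\<bar> \<le>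
              ennreal (N * R powr (- \<alpha>) * rho z1 z2 powr \<alpha>) *
                sup_abs (closure (cyl (2 * R) (0, 0))) u))"
    using assms(9) unfolding alpha0_constant_def by (elim conjE exE)
  have N: "caloric_hoelder_estimate TYPE('d) \<delta> p0 q0 (Nb p0 \<delta>) Ru Rb B \<alpha>0 N"
    unfolding caloric_hoelder_estimate_def
    by (intro allI impI ballI) (rule N0[rule_format, OF _ _ _ _ _ _ _ \<alpha>0])
  have \<beta>: "holder_exponent (real CARD('d)) d0 \<alpha>0 p = \<alpha>0 * ?\<kappa> / (\<alpha>0 * p' + ?\<kappa>)"
    using p' by (simp add: holder_exponent_def add_diff_eq)
  show ?thesis
    unfolding Let_def \<beta> rp
  proof (intro exI[of _ "4 + 2 * max 0 N + 2 * max 0 K"] allI impI ballI)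
    fix h f g :: "'d pt \<Rightarrow> real" and bb \<sigma> b P R and z1 z2 :: "'d pt"
    assume md: "markov_diffusion \<delta> p0 q0 h bb \<sigma> b P" and bb: "Nb p0 \<delta> * bb Ru < 1" "bb Rb = B"
      and R: "R \<in> {0<..Rb / 2}"
      and fg: "g \<in> borel_measurable (restrict_space borel (closure (cyl (2 * R) (0, 0))))"
        "bounded (g ` closure (cyl (2 * R) (0, 0)))" "f \<in> Lpq p q (cyl (2 * R) (0, 0))"
      and z: "z1 \<in> cyl R (0, 0)" "z2 \<in> cyl R (0, 0)"
    have R': "0 < R" "R \<le> Rb / 2" using R by auto
    let ?u = "solution P (cyl (2 * R) (0, 0)) f g" and ?\<beta> = "\<alpha>0 * ?\<kappa> / (\<alpha>0 * p' + ?\<kappa>)"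
    note est = solution_hoelder[OF K N md bb pq0 p' assms(11) a(1) less_imp_le[OF a(2)] \<kappa> R' fg]
    show "ennreal \<bar>?u z1 - ?u z2\<bar> \<le>
      ennreal ((4 + 2 * max 0 N + 2 * max 0 K) * R powr (- ?\<beta>) *
          rho z1 z2 powr ?\<beta>) *
        (sup_abs (closure (cyl (2 * R) (0, 0))) (?u) +
         ennreal (R powr (?\<kappa> / p')) * Lpq_norm p q (cyl (2 * R) (0, 0)) f)"
    proof (cases "fst z1 \<le> fst z2")
      case True
      then show ?thesis by (rule est[OF z])
    next
      case False
      then have "fst z2 \<le> fst z1" by simp
      from est[OF z(2,1) this] show ?thesis by (simp only: rho_commute[of z2] abs_minus_commute[of "?u z2"])
    qed
  qed
qed

end
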